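(* a) The maximal operator $$\widetilde\sigma^{*}f:=\sup_{n\in\mathbb N_+}\frac{|\sigma_nf|}{\log^2(n+1)}$$ is bounded from the Hardy space $H_{1/2}$ to the Lebesgue space $L_{1/2}$. b) Let $\{\Phi_n:n\in\mathbb N\}$ be any non-decreasing sequence of positive numbers satisfying $$\limsup_{n\to\infty}\frac{\log^2(n+1)}{\Phi_n}=+\infty ,$$ and let $q_n:=M_{2n}+M_{2n-2}+\dots+M_2+M_0$. Then there exists a sequence $\{n_k:k\in\mathbb N\}$ of positive integers such that, with $f_k:=D_{M_{2n_k+1}}-D_{M_{2n_k}}$, $$\sup_{k\in\mathbb N}\frac{\left\|\dfrac{\sigma_{q_{n_k}}f_k}{\Phi_{q_{n_k}}}\right\|_{1/2}}{\|f_k\|_{H_{1/2}}}=\infty .$$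
   Context: $\mathbb N_+$ is the set of positive integers, $\mathbb N=\mathbb N_+\cup\{0\}$. Fix a bounded sequence $m=(m_0,m_1,\dots)$ of integers $m_k\ge 2$. $G_m=\prod_{k\ge0}Z_{m_k}$, where $Z_{m_k}=\{0,\dots,m_k-1\}$ is the additive group modulo $m_k$, with the product of the discrete topologies; $\mu$ is the Haar measure with $\mu(G_m)=1$. $M_0:=1$, $M_{k+1}:=m_kM_k$; every $n\in\mathbb N$ is uniquely $n=\sum_{j\ge0}n_jM_j$ with $n_j\in Z_{m_j}$. $r_k(x):=\exp(2\pi i x_k/m_k)$, $\psi_n:=\prod_{k\ge0}r_k^{n_k}$ (Vilenkin system), $D_n:=\sum_{k=0}^{n-1}\psi_k$. $I_0(x):=G_m$, $I_n(x):=\{y: y_0=x_0,\dots,y_{n-1}=x_{n-1}\}$; $\mathcal F_n$ is the $\sigma$-algebra generated by $\{I_n(x):x\in G_m\}$. For $g\in L_1(G_m)$: $\widehat g(k):=\int g\overline{\psi_k}\,d\mu$, $S_ng:=\sum_{k=0}^{n-1}\widehat g(k)\psi_k$. A martingale is a sequence $f=(f^{(n)}:n\in\mathbb N)$ of integrable functions with $f^{(n)}$ $\mathcal F_n$-measurable and $S_{M_n}f^{(k)}=f^{(n)}$ for $n\le k$; $f^*:=\sup_n|f^{(n)}|$; $H_p$ is the set of martingales with $\|f\|_{H_p}:=\|f^*\|_p<\infty$, where $\|g\|_p:=(\int|g|^pd\mu)^{1/p}$. For a martingale, $\widehat f(i):=\lim_k\int f^{(k)}\overline{\psi_i}\,d\mu$,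 $S_nf:=\sum_{k=0}^{n-1}\widehat f(k)\psi_k$, and $\sigma_nf:=\frac1n\sum_{k=1}^nS_kf$ ($n\in\mathbb N_+$). A function $g\in L_1$ is identified with the martingale $(S_{M_n}g:n\in\mathbb N)$, so $\|g\|_{H_p}=\|\sup_n|S_{M_n}g|\|_p$. An operator $T$ is bounded from $H_p$ to $L_p$ if there is a constant $C$ with $\|Tf\|_p\le C\|f\|_{H_p}$ for all $f\in H_p$. *)

theory Defs
  imports "HOL-Probability.Probability"
begin

section \<open>The group and its Haar measure\<close>

definition Vgroup :: "(nat \<Rightarrow> nat) \<Rightarrow> (nat \<Rightarrow> nat) set" where
  "Vgroup m = {x. \<forall>k. x k < m k}"

definition Vadd :: "(nat \<Rightarrow> nat) \<Rightarrow> (nat \<Rightarrow> nat) \<Rightarrow> (nat \<Rightarrow> nat) \<Rightarrow> (nat \<Rightarrow> nat)" where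
  "Vadd m x y = (\<lambda>k. (x k + y k) mod m k)"

definition Vtop :: "(nat \<Rightarrow> nat) \<Rightarrow> (nat \<Rightarrow> nat) topology" where
  "Vtop m = product_topology (\<lambda>k. discrete_topology {..<m k}) UNIV"

text \<open>
  Regularity is not listed: the group is compact and metrizable, so every finite Borel measure
  on it is regular. Existence and uniqueness of the measure are proved below
  (\<open>Vhaar_exists\<close>, \<open>Vhaar_unique\<close>).
\<close>

definition Vhaar :: "(nat \<Rightarrow> nat) \<Rightarrow> (nat \<Rightarrow> nat) measure \<Rightarrow> bool" where
  "Vhaar m \<mu> \<longleftrightarrow>
     space \<mu> = Vgroup m \<and>
     sets \<mu> = sigma_sets (Vgroup m) {U. openin (Vtop m) U} \<and>
     (\<forall>x\<in>Vgroup m. \<forall>A\<in>sets \<mu>. emeasure \<mu> (Vadd m x ` A) = emeasure \<mu> A) \<and>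
     emeasure \<mu> (Vgroup m) = 1"

definition Vcyl :: "(nat \<Rightarrow> nat) \<Rightarrow> nat \<Rightarrow> (nat \<Rightarrow> nat) \<Rightarrow> (nat \<Rightarrow> nat) set" where
  "Vcyl m n x = {y \<in> Vgroup m. \<forall>j<n. y j = x j}"

definition Vfilt :: "(nat \<Rightarrow> nat) \<Rightarrow> nat \<Rightarrow> (nat \<Rightarrow> nat) measure" where
  "Vfilt m n = sigma (Vgroup m) (Vcyl m n ` Vgroup m)"

section \<open>The Vilenkin system\<close>

primrec Mseq :: "(nat \<Rightarrow> nat) \<Rightarrow> nat \<Rightarrow> nat" where
  "Mseq m 0 = 1"
| "Mseq m (Suc k) = m k * Mseq m k"

text \<open>
  \<open>digit m n j\<close> is the coefficient \<open>n\<^sub>j\<close> of the unique expansion of \<open>n\<close> in the mixed radix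
  system \<open>Mseq m\<close>; see \<open>digit_expansion\<close> and \<open>digit_unique\<close> below.
\<close>

definition digit :: "(nat \<Rightarrow> nat) \<Rightarrow> nat \<Rightarrow> nat \<Rightarrow> nat" where
  "digit m n j = (n div Mseq m j) mod m j"

definition rad :: "(nat \<Rightarrow> nat) \<Rightarrow> nat \<Rightarrow> (nat \<Rightarrow> nat) \<Rightarrow> complex" where
  "rad m k x = exp (2 * of_real pi * \<i> * of_nat (x k) / of_nat (m k))"

text \<open>Only finitely many digits are nonzero, and the remaining factors of the product are \<open>1\<close>.\<close>

definition vpsi :: "(nat \<Rightarrow> nat) \<Rightarrow> nat \<Rightarrow> (nat \<Rightarrow> nat) \<Rightarrow> complex" where
  "vpsi m n x = (\<Prod>k\<in>{k. digit m n k \<noteq> 0}. rad m k x ^ digit m n k)"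

definition Dker :: "(nat \<Rightarrow> nat) \<Rightarrow> nat \<Rightarrow> (nat \<Rightarrow> nat) \<Rightarrow> complex" where
  "Dker m n x = (\<Sum>k<n. vpsi m k x)"

section \<open>Fourier series of integrable functions and of martingales\<close>

definition fcoeff ::
  "(nat \<Rightarrow> nat) \<Rightarrow> (nat \<Rightarrow> nat) measure \<Rightarrow> ((nat \<Rightarrow> nat) \<Rightarrow> complex) \<Rightarrow> nat \<Rightarrow> complex" where
  "fcoeff m \<mu> g k = (LINT x|\<mu>. g x * cnj (vpsi m k x))"

definition fsum ::
  "(nat \<Rightarrow> nat) \<Rightarrow> (nat \<Rightarrow> nat) measure \<Rightarrow> nat \<Rightarrow> ((nat \<Rightarrow> nat) \<Rightarrow> complex) \<Rightarrow> (nat \<Rightarrow> nat) \<Rightarrow> complex" where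
  "fsum m \<mu> n g x = (\<Sum>k<n. fcoeff m \<mu> g k * vpsi m k x)"

type_synonym vmart = "nat \<Rightarrow> (nat \<Rightarrow> nat) \<Rightarrow> complex"

text \<open>
  The identity of functions is required pointwise on the group: both sides are measurable with
  respect to \<open>Vfilt m n\<close>, whose atoms have positive measure, so this is the same as equality
  almost everywhere.
\<close>

definition is_mart :: "(nat \<Rightarrow> nat) \<Rightarrow> (nat \<Rightarrow> nat) measure \<Rightarrow> vmart \<Rightarrow> bool" where
  "is_mart m \<mu> f \<longleftrightarrow>
     (\<forall>n. integrable \<mu> (f n) \<and> f n \<in> borel_measurable (Vfilt m n)) \<and>
     (\<forall>n k. n \<le> k \<longrightarrow> (\<forall>x\<in>Vgroup m. fsum m \<mu> (Mseq m n) (f k) x = f n x))"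

definition mart_of ::
  "(nat \<Rightarrow> nat) \<Rightarrow> (nat \<Rightarrow> nat) measure \<Rightarrow> ((nat \<Rightarrow> nat) \<Rightarrow> complex) \<Rightarrow> vmart" where
  "mart_of m \<mu> g = (\<lambda>n. fsum m \<mu> (Mseq m n) g)"

definition mcoeff :: "(nat \<Rightarrow> nat) \<Rightarrow> (nat \<Rightarrow> nat) measure \<Rightarrow> vmart \<Rightarrow> nat \<Rightarrow> complex" where
  "mcoeff m \<mu> f i = lim (\<lambda>k. LINT x|\<mu>. f k x * cnj (vpsi m i x))"

definition msum ::
  "(nat \<Rightarrow> nat) \<Rightarrow> (nat \<Rightarrow> nat) measure \<Rightarrow> nat \<Rightarrow> vmart \<Rightarrow> (nat \<Rightarrow> nat) \<Rightarrow> complex" where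
  "msum m \<mu> n f x = (\<Sum>k<n. mcoeff m \<mu> f k * vpsi m k x)"

definition fejer ::
  "(nat \<Rightarrow> nat) \<Rightarrow> (nat \<Rightarrow> nat) measure \<Rightarrow> nat \<Rightarrow> vmart \<Rightarrow> (nat \<Rightarrow> nat) \<Rightarrow> complex" where
  "fejer m \<mu> n f x = (\<Sum>k=1..n. msum m \<mu> k f x) / of_nat n"

section \<open>Lebesgue and Hardy spaces\<close>

text \<open>Real powers on \<open>[0,\<infinity>]\<close>, for exponents \<open>p > 0\<close> only.\<close>

definition epow :: "ennreal \<Rightarrow> real \<Rightarrow> ennreal" where
  "epow a p = (if a = \<infinity> then \<infinity> else ennreal (enn2real a powr p))"

definition Lp_norm :: "'a measure \<Rightarrow> real \<Rightarrow> ('a \<Rightarrow> ennreal) \<Rightarrow> ennreal" where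
  "Lp_norm \<mu> p g = epow (\<integral>\<^sup>+ x. epow (g x) p \<partial>\<mu>) (1 / p)"

definition mart_max :: "vmart \<Rightarrow> (nat \<Rightarrow> nat) \<Rightarrow> ennreal" where
  "mart_max f x = (SUP n. ennreal (norm (f n x)))"

definition Hp_norm :: "(nat \<Rightarrow> nat) measure \<Rightarrow> real \<Rightarrow> vmart \<Rightarrow> ennreal" where
  "Hp_norm \<mu> p f = Lp_norm \<mu> p (mart_max f)"

definition Hardy :: "(nat \<Rightarrow> nat) \<Rightarrow> (nat \<Rightarrow> nat) measure \<Rightarrow> real \<Rightarrow> vmart set" where
  "Hardy m \<mu> p = {f. is_mart m \<mu> f \<and> Hp_norm \<mu> p f < \<infinity>}"

definition bounded_Hp_Lp ::
  "(nat \<Rightarrow> nat) \<Rightarrow> (nat \<Rightarrow> nat) measure \<Rightarrow> real \<Rightarrow> (vmart \<Rightarrow> (nat \<Rightarrow> nat) \<Rightarrow> ennreal) \<Rightarrow> bool" where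
  "bounded_Hp_Lp m \<mu> p T \<longleftrightarrow>
     (\<exists>C::real. \<forall>f\<in>Hardy m \<mu> p. Lp_norm \<mu> p (T f) \<le> ennreal C * Hp_norm \<mu> p f)"

definition fejer_max_log ::
  "(nat \<Rightarrow> nat) \<Rightarrow> (nat \<Rightarrow> nat) measure \<Rightarrow> vmart \<Rightarrow> (nat \<Rightarrow> nat) \<Rightarrow> ennreal" where
  "fejer_max_log m \<mu> f x =
     (SUP n\<in>{1..}. ennreal (norm (fejer m \<mu> n f x) / (ln (real n + 1))\<^sup>2))"

definition qnum :: "(nat \<Rightarrow> nat) \<Rightarrow> nat \<Rightarrow> nat" where
  "qnum m n = (\<Sum>j\<le>n. Mseq m (2 * j))"

section \<open>Justification of the encodings\<close>

lemma Mseq_pos: "(\<And>k. 2 \<le> m k) \<Longrightarrow> 0 < Mseq m k"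
  by (induction k) (auto simp: Suc_le_lessD less_le_trans[of 0 2])

lemma Mseq_ge: assumes "\<And>k. 2 \<le> m k" shows "k < Mseq m k"
proof (induction k)
  case (Suc k)
  have "2 * Mseq m k \<le> m k * Mseq m k" using assms by (intro mult_right_mono) auto
  also have "m k * Mseq m k = Mseq m (Suc k)" by simp
  finally show ?case using Suc by linarith
qed simp

lemma digit_expansion_aux:
  assumes "\<And>k. 2 \<le> m k"
  shows "(\<Sum>j<K. digit m n j * Mseq m j) = n mod Mseq m K"
proof (induction K)
  case (Suc K)
  have "n mod (Mseq m K * m K) = Mseq m K * (n div Mseq m K mod m K) + n mod Mseq m K"
    by (rule mod_mult2_eq)
  with Suc show ?case by (simp only: sum.lessThan_Suc Mseq.simps digit_def mult.commute add.commute)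
qed simp

lemma digit_support:
  assumes "\<And>k. 2 \<le> m k"
  shows "{j. digit m n j \<noteq> 0} \<subseteq> {..<n}"
proof -
  have "digit m n j = 0" if "n \<le> j" for j
    using Mseq_ge[of m j, OF assms] that by (simp add: digit_def)
  note zero = this
  show ?thesis
  proof
    fix j assume "j \<in> {j. digit m n j \<noteq> 0}"
    then have "\<not> n \<le> j" using zero[of j] by fastforce
    then show "j \<in> {..<n}" by simp
  qed
qed

lemma digit_expansion:
  assumes "\<And>k. 2 \<le> m k"
  shows "digit m n j < m j" "finite {j. digit m n j \<noteq> 0}"
    "n = (\<Sum>j\<in>{j. digit m n j \<noteq> 0}. digit m n j * Mseq m j)"
proof -
  show "digit m n j < m j"
    unfolding digit_def using assms[of j] by (intro mod_less_divisor) linarith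
  show "finite {j. digit m n j \<noteq> 0}"
    using digit_support[of m, OF assms] finite_subset by blast
  have "n = n mod Mseq m n" using Mseq_ge[of m n, OF assms] by simp
  also have "\<dots> = (\<Sum>j<n. digit m n j * Mseq m j)"
    using digit_expansion_aux[of m, OF assms] by simp
  also have "\<dots> = (\<Sum>j\<in>{j. digit m n j \<noteq> 0}. digit m n j * Mseq m j)"
    by (rule sum.mono_neutral_right) (use digit_support[of m, OF assms] in auto)
  finally show "n = (\<Sum>j\<in>{j. digit m n j \<noteq> 0}. digit m n j * Mseq m j)" .
qed

lemma digit_unique:
  assumes m: "\<And>k. 2 \<le> m k"
    and d: "\<And>j. d j < m j" "finite {j. d j \<noteq> 0}"
    and n: "n = (\<Sum>j\<in>{j. d j \<noteq> 0}. d j * Mseq m j)"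
  shows "d = digit m n"
proof
  fix j
  obtain K0 where K0: "{j. d j \<noteq> 0} \<subseteq> {..<K0}"
    using finite_nat_iff_bounded d(2) by blast
  have bound: "(\<Sum>i<K. d i * Mseq m i) < Mseq m K" for K
  proof (induction K)
    case (Suc K)
    have "(\<Sum>i<Suc K. d i * Mseq m i) < (d K + 1) * Mseq m K" using Suc by simp
    also have "\<dots> \<le> m K * Mseq m K" using d(1)[of K] by (intro mult_right_mono) auto
    finally show ?case by simp
  qed simp
  define K where "K = max K0 (Suc j)"
  have "n = (\<Sum>i<K. d i * Mseq m i)"
    unfolding n by (rule sum.mono_neutral_left) (use K0 K_def in auto)
  moreover have "\<exists>r. (\<Sum>i<L. d i * Mseq m i)
      = (\<Sum>i<j. d i * Mseq m i) + d j * Mseq m j + r * Mseq m (Suc j)" if "Suc j \<le> L" for L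
    using that
  proof (induction L rule: dec_induct)
    case (step L)
    then obtain r where r: "(\<Sum>i<L. d i * Mseq m i)
      = (\<Sum>i<j. d i * Mseq m i) + d j * Mseq m j + r * Mseq m (Suc j)" by blast
    have "Mseq m (Suc j) dvd Mseq m L"
      using \<open>Suc j \<le> L\<close> by (induction L rule: dec_induct) auto
    then obtain s where "Mseq m L = s * Mseq m (Suc j)" by (metis dvdE mult.commute)
    then show ?case
      using r by (intro exI[of _ "r + d L * s"]) (simp add: algebra_simps)
  qed (intro exI[of _ 0], simp)
  ultimately obtain r where
    "n = (\<Sum>i<j. d i * Mseq m i) + d j * Mseq m j + r * Mseq m (Suc j)"
    unfolding K_def by (metis max.cobounded2)
  then have "n = (\<Sum>i<j. d i * Mseq m i) + (d j + r * m j) * Mseq m j"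
    by (simp add: algebra_simps)
  then have "n div Mseq m j = d j + r * m j"
    using bound[of j] Mseq_pos[of m j, OF m] by simp
  then show "d j = digit m n j"
    using d(1)[of j] by (simp add: digit_def)
qed

definition Vprod :: "(nat \<Rightarrow> nat) \<Rightarrow> (nat \<Rightarrow> nat) measure" where
  "Vprod m = PiM UNIV (\<lambda>k. uniform_count_measure {..<m k})"

lemma Vgroup_PiE: "Vgroup m = (\<Pi>\<^sub>E k\<in>UNIV. {..<m k})"
  by (auto simp: Vgroup_def PiE_iff)

lemma space_Vprod: "space (Vprod m) = Vgroup m"
  by (simp add: Vprod_def space_PiM space_uniform_count_measure Vgroup_PiE)

lemma topspace_Vtop: "topspace (Vtop m) = Vgroup m"
  by (simp add: Vtop_def Vgroup_PiE)

lemma Vcyl_sets_Vprod: "Vcyl m n x \<in> sets (Vprod m)"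
proof -
  have *: "(\<lambda>y. y j) \<in> measurable (Vprod m) (count_space UNIV)" for j
  proof (rule measurable_compose[of _ _ "uniform_count_measure {..<m j}" "\<lambda>t. t"])
    show "(\<lambda>y. y j) \<in> Vprod m \<rightarrow>\<^sub>M uniform_count_measure {..<m j}"
      unfolding Vprod_def by measurable
    show "(\<lambda>t. t) \<in> uniform_count_measure {..<m j} \<rightarrow>\<^sub>M count_space UNIV"
      by (auto simp: measurable_def space_uniform_count_measure sets_uniform_count_measure)
  qed
  show ?thesis
  proof (induction n)
    case 0
    have "Vcyl m 0 x = space (Vprod m)" by (simp add: Vcyl_def space_Vprod)
    then show ?case by (metis sets.top)
  next
    case (Suc n)
    have "Vcyl m (Suc n) x = Vcyl m n x \<inter> ((\<lambda>y. y n) -` {x n} \<inter> space (Vprod m))"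
      by (auto simp: Vcyl_def space_Vprod less_Suc_eq)
    moreover have "(\<lambda>y. y n) -` {x n} \<inter> space (Vprod m) \<in> sets (Vprod m)"
      by (rule measurable_sets[OF *]) simp
    ultimately show ?case using Suc by (metis sets.Int)
  qed
qed

lemma openin_Vtop_cyl:
  assumes "openin (Vtop m) U" "x \<in> U"
  shows "\<exists>n. Vcyl m n x \<subseteq> U"
proof -
  have "\<exists>V. finite {i \<in> UNIV. V i \<noteq> topspace (discrete_topology {..<m i})} \<and>
      (\<forall>i\<in>UNIV. openin (discrete_topology {..<m i}) (V i)) \<and> x \<in> Pi\<^sub>E UNIV V \<and> Pi\<^sub>E UNIV V \<subseteq> U"
    using assms(1)[unfolded Vtop_def openin_product_topology_alt] assms(2) by (rule bspec)
  then obtain V where V: "finite {i \<in> UNIV. V i \<noteq> topspace (discrete_topology {..<m i})}"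
    "x \<in> Pi\<^sub>E UNIV V" "Pi\<^sub>E UNIV V \<subseteq> U"
    by (elim exE conjE)
  then obtain n where n: "{i. V i \<noteq> {..<m i}} \<subseteq> {..<n}"
    using finite_nat_iff_bounded by auto
  have "y \<in> Pi\<^sub>E UNIV V" if y: "y \<in> Vcyl m n x" for y
  proof -
    have "y i \<in> V i" for i
    proof (cases "i < n")
      case True
      then show ?thesis using y V(2) by (auto simp: Vcyl_def PiE_iff)
    next
      case False
      then have "V i = {..<m i}" using n by auto
      then show ?thesis using y by (auto simp: Vcyl_def Vgroup_def)
    qed
    then show ?thesis by auto
  qed
  then show ?thesis using V(3) by blast
qed

lemma finite_Vcyl: "finite (Vcyl m n ` Vgroup m)"
proof -
  have "Vcyl m n ` Vgroup m \<subseteq> (\<lambda>z. {y \<in> Vgroup m. \<forall>j<n. y j = z j}) ` (\<Pi>\<^sub>E j\<in>{..<n}. {..<m j})"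
  proof
    fix A assume "A \<in> Vcyl m n ` Vgroup m"
    then obtain x where x: "x \<in> Vgroup m" "A = Vcyl m n x" by auto
    then have "A = {y \<in> Vgroup m. \<forall>j<n. y j = restrict x {..<n} j}"
      "restrict x {..<n} \<in> (\<Pi>\<^sub>E j\<in>{..<n}. {..<m j})"
      by (auto simp: Vcyl_def Vgroup_def)
    then show "A \<in> (\<lambda>z. {y \<in> Vgroup m. \<forall>j<n. y j = z j}) ` (\<Pi>\<^sub>E j\<in>{..<n}. {..<m j})"
      by blast
  qed
  then show ?thesis by (rule finite_subset) (auto intro!: finite_PiE)
qed

definition Vcyls :: "(nat \<Rightarrow> nat) \<Rightarrow> (nat \<Rightarrow> nat) set set" where
  "Vcyls m = insert {} (\<Union>n. Vcyl m n ` Vgroup m)"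

lemma openin_Vcyl: "openin (Vtop m) (Vcyl m n x)"
proof -
  have 1: "openin (Vtop m) {f \<in> topspace (Vtop m). f i \<in> {..<m i} \<inter> {x i}}" for i
  proof (rule openin_continuous_map_preimage[of _ "discrete_topology {..<m i}"])
    show "continuous_map (Vtop m) (discrete_topology {..<m i}) (\<lambda>f. f i)"
      unfolding Vtop_def by (rule continuous_map_product_projection) simp
  qed simp
  show ?thesis
  proof (induction n)
    case 0
    have "Vcyl m 0 x = topspace (Vtop m)" by (simp add: Vcyl_def topspace_Vtop)
    then show ?case by (metis openin_topspace)
  next
    case (Suc n)
    have "Vcyl m (Suc n) x = Vcyl m n x \<inter> {f \<in> topspace (Vtop m). f n \<in> {..<m n} \<inter> {x n}}"
      by (auto simp: Vcyl_def topspace_Vtop less_Suc_eq Vgroup_def)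
    then show ?case using openin_Int[OF Suc 1[of n]] by (simp only:)
  qed
qed

lemma sigma_Vcyls: "sigma_sets (Vgroup m) {U. openin (Vtop m) U} = sigma_sets (Vgroup m) (Vcyls m)"
proof (rule sigma_sets_eqI)
  fix U assume "U \<in> {U. openin (Vtop m) U}"
  then have U: "openin (Vtop m) U" by simp
  let ?C = "{A \<in> (\<Union>n. Vcyl m n ` Vgroup m). A \<subseteq> U}"
  have sub: "U \<subseteq> Vgroup m" using openin_subset[OF U] by (simp add: topspace_Vtop)
  have "U \<subseteq> \<Union>?C"
  proof
    fix x assume x: "x \<in> U"
    then obtain n where n: "Vcyl m n x \<subseteq> U" using openin_Vtop_cyl[OF U] by blast
    moreover have "x \<in> Vcyl m n x" using x sub by (auto simp: Vcyl_def)
    ultimately show "x \<in> \<Union>?C" using x sub by blast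
  qed
  then have eq: "U = \<Union>?C" by blast
  interpret sigma_algebra "Vgroup m" "sigma_sets (Vgroup m) (Vcyls m)"
    by (rule sigma_algebra_sigma_sets) (auto simp: Vcyls_def Vcyl_def)
  have "countable (\<Union>n. Vcyl m n ` Vgroup m)"
    by (rule Countable_Set.countable_UN[OF countableI_type countable_finite[OF finite_Vcyl]])
  then have "countable ?C"
    by (rule countable_subset[rotated]) blast
  moreover have "?C \<subseteq> sigma_sets (Vgroup m) (Vcyls m)"
    by (auto simp: Vcyls_def intro!: sigma_sets.Basic)
  ultimately show "U \<in> sigma_sets (Vgroup m) (Vcyls m)" by (subst eq) (rule countable_Union)
next
  fix A assume "A \<in> Vcyls m"
  then have "openin (Vtop m) A" by (auto simp: Vcyls_def openin_Vcyl)
  then show "A \<in> sigma_sets (Vgroup m) {U. openin (Vtop m) U}" by blast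
qed

lemma sets_Vprod: "sets (Vprod m) = sigma_sets (Vgroup m) {U. openin (Vtop m) U}"
proof
  have "Vcyls m \<subseteq> sets (Vprod m)" using Vcyl_sets_Vprod by (auto simp: Vcyls_def)
  then show "sigma_sets (Vgroup m) {U. openin (Vtop m) U} \<subseteq> sets (Vprod m)"
    unfolding sigma_Vcyls by (metis sets.sigma_sets_subset space_Vprod)
  have *: "{f \<in> \<Pi>\<^sub>E i\<in>UNIV. {..<m i}. f i \<in> A} \<in> {U. openin (Vtop m) U}"
    if "A \<subseteq> {..<m i}" for i A
  proof -
    have "openin (Vtop m) {f \<in> topspace (Vtop m). f i \<in> A}"
    proof (rule openin_continuous_map_preimage[of _ "discrete_topology {..<m i}"])
      show "continuous_map (Vtop m) (discrete_topology {..<m i}) (\<lambda>f. f i)"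
        unfolding Vtop_def by (rule continuous_map_product_projection) simp
    qed (use that in simp)
    then show ?thesis by (simp only: topspace_Vtop Vgroup_PiE mem_Collect_eq)
  qed
  show "sets (Vprod m) \<subseteq> sigma_sets (Vgroup m) {U. openin (Vtop m) U}"
    unfolding Vprod_def sets_PiM_single Vgroup_PiE space_uniform_count_measure
  proof (rule sigma_sets_mono', rule subsetI)
    fix B assume "B \<in> {{f \<in> \<Pi>\<^sub>E i\<in>UNIV. {..<m i}. f i \<in> A} |i A.
      i \<in> UNIV \<and> A \<in> sets (uniform_count_measure {..<m i})}"
    then obtain i A where "B = {f \<in> \<Pi>\<^sub>E i\<in>UNIV. {..<m i}. f i \<in> A}" "A \<subseteq> {..<m i}"
      unfolding sets_uniform_count_measure by blast
    with * show "B \<in> {U. openin (Vtop m) U}" by blast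
  qed
qed

lemma Int_stable_Vcyls: "Int_stable (Vcyls m)"
proof -
  have *: "Vcyl m n x \<inter> Vcyl m k y \<in> Vcyls m" if "n \<le> k" "y \<in> Vgroup m" for n k x y
  proof (cases "\<exists>z. z \<in> Vcyl m n x \<inter> Vcyl m k y")
    case True
    then obtain z where z: "z \<in> Vcyl m n x" "z \<in> Vcyl m k y" by blast
    have "y j = x j" if "j < n" for j
    proof -
      have "j < k" using that \<open>n \<le> k\<close> by (rule less_le_trans)
      then have "z j = y j" using z(2) by (simp add: Vcyl_def)
      moreover have "z j = x j" using z(1) that by (simp add: Vcyl_def)
      ultimately show ?thesis by simp
    qed
    then have "Vcyl m n x \<inter> Vcyl m k y = Vcyl m k y"
      using \<open>n \<le> k\<close> by (auto simp: Vcyl_def)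
    then show ?thesis using that by (auto simp: Vcyls_def)
  next
    case False
    then have "Vcyl m n x \<inter> Vcyl m k y = {}" by blast
    then show ?thesis by (simp add: Vcyls_def)
  qed
  have "Vcyl m n x \<inter> Vcyl m k y \<in> Vcyls m" if "x \<in> Vgroup m" "y \<in> Vgroup m" for n k x y
    using *[of n k y x] *[of k n x y] that by (metis Int_commute nat_le_linear)
  then show ?thesis by (auto simp: Int_stable_def Vcyls_def)
qed

lemma Vmeasure_eqI:
  assumes "sets \<mu> = sigma_sets (Vgroup m) {U. openin (Vtop m) U}"
    and "sets \<nu> = sigma_sets (Vgroup m) {U. openin (Vtop m) U}"
    and "\<And>n x. x \<in> Vgroup m \<Longrightarrow> emeasure \<mu> (Vcyl m n x) = emeasure \<nu> (Vcyl m n x)"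
    and "emeasure \<mu> (Vgroup m) = 1" and "Vgroup m \<noteq> {}"
  shows "\<mu> = \<nu>"
proof (rule measure_eqI_generator_eq[OF Int_stable_Vcyls[of m], where \<Omega> = "Vgroup m" and A = "\<lambda>_. Vgroup m"])
  show "Vcyls m \<subseteq> Pow (Vgroup m)" by (auto simp: Vcyls_def Vcyl_def)
  show "emeasure \<mu> X = emeasure \<nu> X" if "X \<in> Vcyls m" for X
    using that assms(3) by (auto simp: Vcyls_def)
  show "sets \<mu> = sigma_sets (Vgroup m) (Vcyls m)" "sets \<nu> = sigma_sets (Vgroup m) (Vcyls m)"
    using assms(1,2) sigma_Vcyls by auto
  obtain x where x: "x \<in> Vgroup m" using assms(5) by blast
  have "Vgroup m = Vcyl m 0 x" by (auto simp: Vcyl_def)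
  then show "range (\<lambda>_. Vgroup m) \<subseteq> Vcyls m" using x by (auto simp: Vcyls_def)
qed (use assms(4) in auto)

lemma Vadd_in:
  assumes "\<And>k. 2 \<le> m k"
  shows "Vadd m x y \<in> Vgroup m"
proof -
  have "0 < m k" for k using assms[of k] by linarith
  then show ?thesis unfolding Vadd_def Vgroup_def by (intro CollectI allI mod_less_divisor)
qed

definition Vneg :: "(nat \<Rightarrow> nat) \<Rightarrow> (nat \<Rightarrow> nat) \<Rightarrow> (nat \<Rightarrow> nat)" where
  "Vneg m x = (\<lambda>k. (m k - x k) mod m k)"

lemma Vneg_in:
  assumes "\<And>k. 2 \<le> m k"
  shows "Vneg m x \<in> Vgroup m"
proof -
  have "0 < m k" for k using assms[of k] by linarith
  then show ?thesis unfolding Vneg_def Vgroup_def by (intro CollectI allI mod_less_divisor)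
qed

lemma Vadd_Vneg:
  assumes "x \<in> Vgroup m" "y \<in> Vgroup m"
  shows "Vadd m x (Vadd m (Vneg m x) y) = y" "Vadd m (Vneg m x) (Vadd m x y) = y"
proof -
  have *: "(x k + ((m k - x k) + y k)) mod m k = y k" for k
  proof -
    have "x k < m k" "y k < m k" using assms by (auto simp: Vgroup_def)
    then have "x k + ((m k - x k) + y k) = y k + m k" by simp
    then show ?thesis using \<open>y k < m k\<close> by simp
  qed
  show "Vadd m x (Vadd m (Vneg m x) y) = y"
    using * by (simp add: fun_eq_iff Vadd_def Vneg_def mod_simps)
  have "((m k - x k) + (x k + y k)) mod m k = y k" for k
    using *[of k] by (simp only: add.left_commute)
  then show "Vadd m (Vneg m x) (Vadd m x y) = y"
    by (simp add: fun_eq_iff Vadd_def Vneg_def mod_simps)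
qed

lemma Vneg_Vneg: "x \<in> Vgroup m \<Longrightarrow> Vneg m (Vneg m x) = x"
proof
  fix k assume "x \<in> Vgroup m"
  then have "x k < m k" by (simp add: Vgroup_def)
  then show "Vneg m (Vneg m x) k = x k" by (cases "x k = 0") (auto simp: Vneg_def)
qed

lemma Vadd_image_Vcyl:
  assumes "\<And>k. 2 \<le> m k" "x \<in> Vgroup m" "y \<in> Vgroup m"
  shows "Vadd m x ` Vcyl m n y = Vcyl m n (Vadd m x y)"
proof
  show "Vadd m x ` Vcyl m n y \<subseteq> Vcyl m n (Vadd m x y)"
    using Vadd_in[of m, OF assms(1)] by (auto simp: Vcyl_def) (simp add: Vadd_def)
  show "Vcyl m n (Vadd m x y) \<subseteq> Vadd m x ` Vcyl m n y"
  proof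
    fix z assume z: "z \<in> Vcyl m n (Vadd m x y)"
    then have zG: "z \<in> Vgroup m" by (simp add: Vcyl_def)
    have "Vadd m (Vneg m x) z j = Vadd m (Vneg m x) (Vadd m x y) j" if "j < n" for j
      using z that by (simp add: Vcyl_def Vadd_def)
    then have "Vadd m (Vneg m x) z \<in> Vcyl m n y"
      using Vadd_Vneg(2)[OF assms(2,3)] Vadd_in[of m, OF assms(1)] by (simp add: Vcyl_def)
    then show "z \<in> Vadd m x ` Vcyl m n y"
      using Vadd_Vneg(1)[OF assms(2) zG] by (metis image_eqI)
  qed
qed

lemma Vadd_image_eq_vimage:
  assumes "\<And>k. 2 \<le> m k" "x \<in> Vgroup m" "A \<subseteq> Vgroup m"
  shows "Vadd m x ` A = Vadd m (Vneg m x) -` A \<inter> Vgroup m"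
proof
  show "Vadd m x ` A \<subseteq> Vadd m (Vneg m x) -` A \<inter> Vgroup m"
    using assms(3) Vadd_Vneg(2)[OF assms(2)] Vadd_in[of m, OF assms(1)] by auto
  show "Vadd m (Vneg m x) -` A \<inter> Vgroup m \<subseteq> Vadd m x ` A"
  proof
    fix z assume z: "z \<in> Vadd m (Vneg m x) -` A \<inter> Vgroup m"
    then have "z = Vadd m x (Vadd m (Vneg m x) z)" using Vadd_Vneg(1)[OF assms(2)] by simp
    then show "z \<in> Vadd m x ` A" using z by blast
  qed
qed

lemma emeasure_Vprod_Vcyl:
  assumes "\<And>k. 2 \<le> m k" "x \<in> Vgroup m"
  shows "emeasure (Vprod m) (Vcyl m n x) = (\<Prod>j<n. ennreal (1 / m j))"
proof -
  have ne: "{..<m k} \<noteq> {}" for k using assms(1)[of k] by (auto simp: lessThan_empty_iff)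
  interpret product_prob_space "\<lambda>k. uniform_count_measure {..<m k}" UNIV
    by (intro product_prob_spaceI prob_space_uniform_count_measure finite_lessThan ne)
  have xm: "x j < m j" for j using assms(2) by (simp add: Vgroup_def)
  have "Vcyl m n x = {y \<in> space (Vprod m). \<forall>j\<in>{..<n}. y j \<in> {x j}}"
    by (auto simp: Vcyl_def space_Vprod)
  then have "emeasure (Vprod m) (Vcyl m n x)
      = (\<Prod>j<n. emeasure (uniform_count_measure {..<m j}) {x j})"
    unfolding Vprod_def
    using emeasure_PiM_Collect[of "{..<n}" "\<lambda>j. {x j}"] xm
    by (simp add: sets_uniform_count_measure)
  also have "\<dots> = (\<Prod>j<n. ennreal (1 / m j))"
    by (intro prod.cong refl) (use xm in \<open>simp add: emeasure_uniform_count_measure\<close>)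
  finally show ?thesis .
qed

lemma Vgroup_nonempty: "(\<And>k. 2 \<le> m k) \<Longrightarrow> Vgroup m \<noteq> {}"
  using Vneg_in by blast

lemma Vadd_measurable:
  assumes "\<And>k. 2 \<le> m k" "x \<in> Vgroup m"
  shows "Vadd m x \<in> Vprod m \<rightarrow>\<^sub>M Vprod m"
proof (rule measurable_sigma_sets[where \<Omega> = "Vgroup m" and A = "Vcyls m"])
  show "sets (Vprod m) = sigma_sets (Vgroup m) (Vcyls m)" by (simp add: sets_Vprod sigma_Vcyls)
  show sub: "Vcyls m \<subseteq> Pow (Vgroup m)" by (auto simp: Vcyls_def Vcyl_def)
  show "Vadd m x \<in> space (Vprod m) \<rightarrow> Vgroup m" using Vadd_in[of m, OF assms(1)] by auto
  fix A assume A: "A \<in> Vcyls m"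
  then have "Vadd m x -` A \<inter> Vgroup m = Vadd m (Vneg m x) ` A"
    using Vadd_image_eq_vimage[of m "Vneg m x" A] assms sub Vneg_Vneg[OF assms(2)] Vneg_in[of m, OF assms(1)]
    by auto
  moreover have "Vadd m (Vneg m x) ` A \<in> sets (Vprod m)"
    using A Vadd_image_Vcyl[of m, OF assms(1) Vneg_in[of m, OF assms(1)]] Vcyl_sets_Vprod
    by (auto simp: Vcyls_def)
  ultimately show "Vadd m x -` A \<inter> space (Vprod m) \<in> sets (Vprod m)"
    by (simp add: space_Vprod)
qed

theorem Vhaar_exists:
  assumes "\<And>k. 2 \<le> m k"
  shows "Vhaar m (Vprod m)"
  unfolding Vhaar_def
proof (intro conjI ballI)
  show "space (Vprod m) = Vgroup m" by (rule space_Vprod)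
  show "sets (Vprod m) = sigma_sets (Vgroup m) {U. openin (Vtop m) U}" by (rule sets_Vprod)
  obtain z where z: "z \<in> Vgroup m" using Vgroup_nonempty[of m, OF assms] by blast
  have "Vgroup m = Vcyl m 0 z" by (auto simp: Vcyl_def)
  then show one: "emeasure (Vprod m) (Vgroup m) = 1"
    using emeasure_Vprod_Vcyl[of m z 0, OF assms z] by simp
  fix x A assume x: "x \<in> Vgroup m" and A: "A \<in> sets (Vprod m)"
  let ?T = "Vadd m (Vneg m x)"
  have T[measurable]: "?T \<in> Vprod m \<rightarrow>\<^sub>M Vprod m"
    by (rule Vadd_measurable[of m, OF assms Vneg_in[of m, OF assms]])
  have "Vprod m = distr (Vprod m) (Vprod m) ?T"
  proof (rule Vmeasure_eqI[where m = m])
    fix n y assume y: "y \<in> Vgroup m"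
    have sub: "Vcyl m n y \<subseteq> Vgroup m" by (auto simp: Vcyl_def)
    have "emeasure (distr (Vprod m) (Vprod m) ?T) (Vcyl m n y)
        = emeasure (Vprod m) (?T -` Vcyl m n y \<inter> space (Vprod m))"
      by (rule emeasure_distr[OF T Vcyl_sets_Vprod])
    also have "?T -` Vcyl m n y \<inter> space (Vprod m) = Vadd m x ` Vcyl m n y"
      unfolding space_Vprod using Vadd_image_eq_vimage[of m x, OF assms x sub] by (rule sym)
    finally have "emeasure (distr (Vprod m) (Vprod m) ?T) (Vcyl m n y)
        = emeasure (Vprod m) (Vadd m x ` Vcyl m n y)" .
    then show "emeasure (Vprod m) (Vcyl m n y) = emeasure (distr (Vprod m) (Vprod m) ?T) (Vcyl m n y)"
      using emeasure_Vprod_Vcyl[of m, OF assms] Vadd_image_Vcyl[of m, OF assms x y] Vadd_in[of m, OF assms] y by simp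
  qed (auto simp: sets_Vprod one Vgroup_nonempty[of m, OF assms])
  then have "emeasure (Vprod m) A = emeasure (distr (Vprod m) (Vprod m) ?T) A" by simp
  also have "\<dots> = emeasure (Vprod m) (?T -` A \<inter> Vgroup m)"
    using A by (simp add: emeasure_distr T space_Vprod)
  also have "?T -` A \<inter> Vgroup m = Vadd m x ` A"
    using Vadd_image_eq_vimage[of m x, OF assms x, of A] sets.sets_into_space[OF A] by (simp add: space_Vprod)
  finally show "emeasure (Vprod m) (Vadd m x ` A) = emeasure (Vprod m) A" by simp
qed

lemma emeasure_Vhaar_Vcyl:
  assumes "\<And>k. 2 \<le> m k" "Vhaar m \<mu>" "x \<in> Vgroup m"
  shows "of_nat (Mseq m n) * emeasure \<mu> (Vcyl m n x) = 1"
  using assms(3)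
proof (induction n arbitrary: x)
  case 0
  have "Vcyl m 0 x = Vgroup m" by (auto simp: Vcyl_def)
  then show ?case using assms(2) by (simp add: Vhaar_def)
next
  case (Suc n)
  have sets: "sets \<mu> = sets (Vprod m)" using assms(2) by (simp add: Vhaar_def sets_Vprod)
  have inv: "\<forall>x\<in>Vgroup m. \<forall>A\<in>sets (Vprod m). emeasure \<mu> (Vadd m x ` A) = emeasure \<mu> A"
    using assms(2) unfolding Vhaar_def sets[symmetric] by blast
  let ?B = "\<lambda>c. Vcyl m (Suc n) (x(n := c))"
  have in_G: "x(n := c) \<in> Vgroup m" if "c < m n" for c using Suc.prems that by (auto simp: Vgroup_def)
  have eq: "emeasure \<mu> (?B c) = emeasure \<mu> (Vcyl m (Suc n) x)" if c: "c < m n" for c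
  proof -
    let ?t = "Vadd m (Vneg m x) (x(n := c))"
    have "Vadd m x ?t = x(n := c)" using Vadd_Vneg(1)[OF Suc.prems in_G[OF c]] .
    then have "Vadd m ?t x = x(n := c)" by (simp add: Vadd_def add.commute)
    then have "?B c = Vadd m ?t ` Vcyl m (Suc n) x"
      using Vadd_image_Vcyl[of m, OF assms(1) Vadd_in[of m, OF assms(1)] Suc.prems] by metis
    then show ?thesis
      using inv Vadd_in[of m, OF assms(1)] Vcyl_sets_Vprod by metis
  qed
  have "Vcyl m n x = (\<Union>c<m n. ?B c)"
    by (auto simp: Vcyl_def less_Suc_eq Vgroup_def)
  moreover have sub: "?B ` {..<m n} \<subseteq> sets \<mu>"
    using Vcyl_sets_Vprod unfolding sets by blast
  moreover have "disjoint_family_on ?B {..<m n}"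
    by (auto simp: disjoint_family_on_def Vcyl_def)
  ultimately have "emeasure \<mu> (Vcyl m n x) = (\<Sum>c<m n. emeasure \<mu> (?B c))"
    using sum_emeasure[of ?B "{..<m n}" \<mu>] sub by simp
  also have "\<dots> = of_nat (m n) * emeasure \<mu> (Vcyl m (Suc n) x)" using eq by simp
  finally show ?case using Suc.IH[OF Suc.prems] by (simp add: mult_ac)
qed

theorem Vhaar_unique:
  assumes "\<And>k. 2 \<le> m k" "Vhaar m \<mu>" "Vhaar m \<nu>"
  shows "\<mu> = \<nu>"
proof (rule Vmeasure_eqI[where m = m])
  fix n x assume x: "x \<in> Vgroup m"
  let ?M = "of_nat (Mseq m n) :: ennreal"
  have "?M * emeasure \<mu> (Vcyl m n x) = ?M * emeasure \<nu> (Vcyl m n x)"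
    using emeasure_Vhaar_Vcyl[OF assms(1,2) x] emeasure_Vhaar_Vcyl[OF assms(1,3) x] by simp
  moreover have "?M \<noteq> 0" "?M \<noteq> \<top>" using Mseq_pos[of m n, OF assms(1)] by auto
  ultimately show "emeasure \<mu> (Vcyl m n x) = emeasure \<nu> (Vcyl m n x)"
    by (simp add: ennreal_mult_cancel_left)
qed (use assms Vgroup_nonempty in \<open>auto simp: Vhaar_def\<close>)

end

theory Submission
  imports Defs
begin

text \<open>
  Put \<open>F\<^sub>n = D\<^sub>1 + \<dots> + D\<^sub>n\<close>. Expanding \<open>n\<close> in the mixed radix system bounds \<open>|F\<^sub>n|\<close> by a sum, over
  \<open>k \<le> A\<close> with \<open>M\<^sub>A \<le> n\<close>, of \<open>M\<^sub>k M\<^sub>A\<close> times the indicator of the set where all coordinates below \<open>A\<close>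
  other than the \<open>k\<close>th vanish. Hence the Fejer kernels are bounded in \<open>L\<^sub>1\<close>, and the means of a mean zero
  function living on a cylinder of level \<open>j\<close> are controlled off the cylinder by a weight whose square root
  has integral of order \<open>(j + 1) / M\<^sub>j\<close>; only \<open>n > M\<^sub>j\<close> matter there, so the logarithm in the maximal operator
  removes the factor \<open>j + 1\<close>.

  For a), stop the martingale predictably at the levels \<open>(\<epsilon> 2\<^sup>i)\<^sup>2\<close>. Consecutive stopped martingales differ
  by mean zero pieces on the cylinders where the lower level is about to be exceeded; because \<open>m\<close> is
  bounded these cylinders have total measure at most a constant times the measure of the set where
  \<open>f\<^sup>*\<close> exceeds the level. Summing over \<open>i\<close> and letting \<open>\<epsilon>\<close> tend to 0 gives the bound.

  For b), with \<open>q\<^sub>n = M\<^sub>2\<^sub>n + q\<^sub>n\<^sub>-\<^sub>1\<close>, the mean of order \<open>q\<^sub>n\<close> of the test function has modulus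
  \<open>|F|/q\<^sub>n\<close> with the kernel of index \<open>q\<^sub>n\<^sub>-\<^sub>1\<close>. For each \<open>s < n\<close> this kernel is at least \<open>M\<^sub>2\<^sub>s\<^sup>2/2\<close> on a set of
  measure comparable to \<open>1/M\<^sub>2\<^sub>s\<close>, and these \<open>n\<close> equal contributions produce \<open>n\<^sup>2\<close>, which is comparable to
  \<open>log\<^sup>2 q\<^sub>n\<close>.
\<close>

section \<open>Dirichlet and Fejer kernels\<close>

text \<open>Subtraction in the group. Subtraction of naturals truncates, so \<open>m k - t k\<close>
  is added before reducing; for \<open>t\<close> in the group this is the true difference.\<close>

definition Vsub :: "(nat \<Rightarrow> nat) \<Rightarrow> (nat \<Rightarrow> nat) \<Rightarrow> (nat \<Rightarrow> nat) \<Rightarrow> (nat \<Rightarrow> nat)" where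
  "Vsub m x t = (\<lambda>k. (x k + (m k - t k)) mod m k)"

text \<open>The Fejer kernel multiplied by \<open>n\<close>: without the division it splits
  additively along the digits of \<open>n\<close>.\<close>

definition Fker :: "(nat \<Rightarrow> nat) \<Rightarrow> nat \<Rightarrow> (nat \<Rightarrow> nat) \<Rightarrow> complex" where
  "Fker m n x = (\<Sum>k=1..n. Dker m k x)"

text \<open>For \<open>k \<ge> A\<close> no coordinate below \<open>A\<close> is left out, so in the
  sums below the term \<open>k = A\<close> stands for the whole cylinder of level
  \<open>A\<close>.\<close>

definition agree_off :: "nat \<Rightarrow> nat \<Rightarrow> (nat \<Rightarrow> nat) \<Rightarrow> (nat \<Rightarrow> nat) \<Rightarrow> bool" where
  "agree_off k A x y \<longleftrightarrow> (\<forall>i<A. i \<noteq> k \<longrightarrow> x i = y i)"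

locale vilenkin_seq =
  fixes m :: "nat \<Rightarrow> nat" and L :: nat
  assumes m_ge: "\<And>k. 2 \<le> m k" and m_le: "\<And>k. m k \<le> L"
begin

abbreviation M :: "nat \<Rightarrow> nat" where "M \<equiv> Mseq m"
abbreviation G :: "(nat \<Rightarrow> nat) set" where "G \<equiv> Vgroup m"

section \<open>Growth of the sequence \<open>M\<close>\<close>

lemma m_pos: "0 < m k" using m_ge[of k] by linarith
lemma L_ge: "2 \<le> L" using m_ge m_le by (rule order_trans)
lemma M_pos: "0 < M k" by (rule Mseq_pos[of m, OF m_ge])
lemma M_double: "2 * M k \<le> M (Suc k)"
  using mult_right_mono[OF m_ge[of k], of "M k"] by simp
lemma M_Suc_le: "M (Suc k) \<le> L * M k"
  using mult_right_mono[OF m_le[of k], of "M k"] by simp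
lemma M_mono: "i \<le> j \<Longrightarrow> M i \<le> M j"
proof (rule lift_Suc_mono_le[of M])
  show "M n \<le> M (Suc n)" for n using M_double[of n] by linarith
qed
lemma M_add: "M (n + d) = M n * (\<Prod>i<d. m (n + i))"
  by (induction d) auto
lemma M_dvd: "i \<le> j \<Longrightarrow> M i dvd M j"
  by (metis M_add le_Suc_ex dvd_triv_left)
lemma M_prod: "M n = (\<Prod>i<n. m i)"
  using M_add[of 0 n] by simp
lemma pow2_le_M: "2 ^ d * M n \<le> M (n + d)"
proof (induction d)
  case (Suc d)
  then have "2 * (2 ^ d * M n) \<le> 2 * M (n + d)" by simp
  also have "\<dots> \<le> M (n + Suc d)" unfolding add_Suc_right by (rule M_double)
  finally show ?case by simp
qed simp

lemma sum_M_lt: "(\<Sum>A<n. M A) \<le> M n"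
proof (induction n)
  case (Suc n)
  then show ?case using M_double[of n] by (simp del: Mseq.simps)
qed simp

lemma sum_M_le: "(\<Sum>A\<le>n. M A) \<le> 2 * M n"
  using sum_M_lt[of n] by (simp add: lessThan_Suc_atMost[symmetric])

lemma sum_sqrt_M: "(\<Sum>k\<le>A. sqrt (M k)) \<le> 4 * sqrt (M A)"
proof (induction A)
  case (Suc A)
  have "real (2 * M A) \<le> real (M (Suc A))" using M_double[of A] of_nat_le_iff by blast
  then have "(sqrt 2 * sqrt (M A)) \<le> sqrt (M (Suc A))"
    unfolding real_sqrt_mult[symmetric] real_sqrt_le_iff by simp
  \<comment> \<open>Growth by the ratio 4/3 sustains the constant 4, because 4 * 3/4 + 1 =
    4.\<close>
  moreover have "4/3 \<le> sqrt (2::real)" by (rule real_le_rsqrt) (simp add: power2_eq_square)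
  ultimately have "4/3 * sqrt (M A) \<le> sqrt (M (Suc A))"
    by (meson mult_right_mono of_nat_0_le_iff order_trans real_sqrt_ge_zero)
  then show ?case using Suc by simp
qed simp

section \<open>Characters and kernels in terms of digits\<close>

lemma digit_eq_0: "n < M N \<Longrightarrow> N \<le> k \<Longrightarrow> digit m n k = 0"
  using M_mono[of N k] by (simp add: digit_def)

lemma vpsi_eq_prod: "n < M N \<Longrightarrow> vpsi m n x = (\<Prod>k<N. rad m k x ^ digit m n k)"
  unfolding vpsi_def
  by (rule prod.mono_neutral_left) (use digit_eq_0[of n N] in \<open>auto simp: not_less intro: ccontr\<close>)

text \<open>Adding \<open>a * M N\<close> to \<open>i < M N\<close> leaves the digits below
  \<open>N\<close> alone and puts \<open>a\<close> in place \<open>N\<close>.\<close>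

lemma vpsi_split:
  assumes "i < M N" "a < m N"
  shows "vpsi m (a * M N + i) x = rad m N x ^ a * vpsi m i x"
proof -
  have "a * M N + i < (a + 1) * M N" using assms(1) by simp
  also have "\<dots> \<le> m N * M N" using assms(2) by (intro mult_right_mono) auto
  finally have lt: "a * M N + i < M (Suc N)" by simp
  have "digit m (a * M N + i) k = digit m i k" if k: "k < N" for k
  proof -
    from M_dvd[of "Suc k" N] k obtain s where s: "M N = M (Suc k) * s" by (auto elim: dvdE)
    have "a * M N + i = M k * (a * s * m k) + i" by (simp add: s mult_ac)
    then have "(a * M N + i) div M k = a * s * m k + i div M k"
      using M_pos[of k] by (simp only: div_mult_self4)
    then show ?thesis by (simp add: digit_def)
  qed
  moreover have "digit m (a * M N + i) N = a"
    using assms by (simp add: digit_def)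
  ultimately show ?thesis
    using vpsi_eq_prod[OF lt, of x] vpsi_eq_prod[OF assms(1), of x] by simp
qed

text \<open>Every index that is added exceeds \<open>a * M N\<close> by less than
  \<open>M N\<close>, so \<open>vpsi_split\<close> applies to each. The end point
  \<open>j = M N\<close> is included, which lets \<open>Dker_mult\<close> pass from \<open>a\<close>
  to \<open>a + 1\<close>.\<close>

lemma Dker_split:
  assumes "j \<le> M N" "a < m N"
  shows "Dker m (a * M N + j) x = Dker m (a * M N) x + rad m N x ^ a * Dker m j x"
  using assms(1)
proof (induction j)
  case (Suc j)
  then show ?case using vpsi_split[of j N a x] assms(2) by (simp add: Dker_def algebra_simps)
qed (simp add: Dker_def)

lemma Dker_mult: "a \<le> m N \<Longrightarrow> Dker m (a * M N) x = (\<Sum>i<a. rad m N x ^ i) * Dker m (M N) x"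
proof (induction a)
  case (Suc a)
  then show ?case using Dker_split[of "M N" N a x] by (simp add: algebra_simps)
qed (simp add: Dker_def)

lemma rad_eq_cis: "rad m k x = cis (2 * pi * x k / m k)"
  by (simp add: rad_def cis_conv_exp mult_ac)

lemma norm_rad [simp]: "norm (rad m k x) = 1"
  by (simp add: rad_eq_cis)

lemma norm_vpsi [simp]: "norm (vpsi m n x) = 1"
  by (simp add: vpsi_def norm_power flip: prod_norm)

lemma G_lt: "x \<in> G \<Longrightarrow> x k < m k" by (simp add: Vgroup_def)

lemma rad_eq_1_iff: assumes "x \<in> G" shows "rad m k x = 1 \<longleftrightarrow> x k = 0"
proof
  assume "rad m k x = 1"
  then have "cos (2 * pi * (x k / m k)) = 1" by (simp add: rad_eq_cis cis.ctr complex_eq_iff)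
  then obtain i :: int where "2 * pi * (x k / m k) = 2 * i * pi"
    using cos_one_2pi_int by auto
  then have "real (x k) = i * m k" using m_pos[of k] by (simp add: field_simps)
  then have i: "int (x k) = i * int (m k)" by (metis of_int_eq_iff of_int_mult of_int_of_nat_eq)
  then have "int (m k) dvd int (x k)" by simp
  then have "m k dvd x k" by simp
  then show "x k = 0" using G_lt[OF assms, of k] by (meson dvd_imp_le not_le neq0_conv)
qed (simp add: rad_eq_cis)

lemma rad_power_m: "rad m k x ^ m k = 1"
proof -
  have "rad m k x ^ m k = cis (2 * pi * real (x k))"
    using m_pos[of k] unfolding rad_eq_cis Complex.DeMoivre by (intro arg_cong[of _ _ cis]) simp
  also have "\<dots> = 1" by (intro cis_multiple_2pi) auto
  finally show ?thesis .
qed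

lemma sum_rad: "x \<in> G \<Longrightarrow> (\<Sum>i<m k. rad m k x ^ i) = (if x k = 0 then of_nat (m k) else 0)"
  using rad_eq_1_iff[of x k] by (auto simp: sum_gp_strict rad_power_m)

text \<open>Passing from \<open>N\<close> to \<open>N + 1\<close> multiplies by the powers of a root
  of unity summed over a full period, which gives \<open>m N\<close> or 0.\<close>

lemma Dker_M: "x \<in> G \<Longrightarrow> Dker m (M N) x = (if \<forall>j<N. x j = 0 then of_nat (M N) else 0)"
proof (induction N)
  case 0
  have "vpsi m 0 x = 1" by (simp add: vpsi_def digit_def)
  then show ?case by (simp add: Dker_def)
next
  case (Suc N)
  then show ?case using Dker_mult[of "m N" N x] sum_rad[of x N] by (auto simp: less_Suc_eq)
qed

text \<open>\<open>Dker_split\<close> summed over the last \<open>j\<close> indices: each gives one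
  copy of \<open>Dker m (a * M N) x\<close>, and the rotated remainders add up to
  \<open>Fker m j x\<close>.\<close>

lemma Fker_split:
  assumes "j \<le> M N" "a < m N"
  shows "Fker m (a * M N + j) x
    = Fker m (a * M N) x + of_nat j * Dker m (a * M N) x + rad m N x ^ a * Fker m j x"
  using assms(1)
proof (induction j)
  case (Suc j)
  then show ?case using Dker_split[of "Suc j" N a x] assms(2) by (simp add: Fker_def algebra_simps)
qed (simp add: Fker_def)

text \<open>Off the cylinder of level \<open>N\<close> around 0 all \<open>Dker m (a * M N)\<close>
  vanish, so consecutive blocks differ only by powers of \<open>rad m N x\<close>, and these again
  sum over a full period.\<close>

lemma Fker_M_Suc:
  assumes "x \<in> G" "\<not> (\<forall>j<N. x j = 0)"
  shows "Fker m (M (Suc N)) x = (if x N = 0 then of_nat (m N) else 0) * Fker m (M N) x"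
proof -
  have D0: "Dker m (a * M N) x = 0" if "a \<le> m N" for a
    using Dker_mult[OF that, of x] Dker_M[OF assms(1), of N] assms(2) by simp
  have "a \<le> m N \<Longrightarrow> Fker m (a * M N) x = (\<Sum>i<a. rad m N x ^ i) * Fker m (M N) x" for a
  proof (induction a)
    case (Suc a)
    then show ?case using Fker_split[of "M N" N a x] D0[of a] by (simp add: algebra_simps)
  qed (simp add: Fker_def)
  from this[of "m N"] show ?thesis using sum_rad[OF assms(1), of N] by simp
qed

lemma norm_Dker_le: "norm (Dker m n x) \<le> n"
  unfolding Dker_def by (rule order_trans[OF norm_sum]) simp

lemma norm_Fker_le: "norm (Fker m n x) \<le> real n * real n"
proof -
  have "norm (Fker m n x) \<le> (\<Sum>k=1..n. norm (Dker m k x))" unfolding Fker_def by (rule norm_sum)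
  also have "\<dots> \<le> (\<Sum>k=1..n. real n)"
    by (intro sum_mono) (metis norm_Dker_le order_trans of_nat_le_iff atLeastAtMost_iff)
  finally show ?thesis by simp
qed

text \<open>Induction on the level. Inside the cylinder of level \<open>A\<close> the trivial bound
  is, up to the factor \<open>L\<close>, the term \<open>k = A\<close> of the next level. Outside it
  \<open>Fker_M_Suc\<close> gives 0 unless \<open>x A = 0\<close>, and then the factor
  \<open>m A\<close> turns \<open>M A\<close> into \<open>M (Suc A)\<close> in every old
  term.\<close>

lemma norm_Fker_M_le:
  assumes "x \<in> G"
  shows "norm (Fker m (M A) x)
    \<le> L * (\<Sum>k\<le>A. real (M k) * real (M A) * of_bool (agree_off k A x (\<lambda>_. 0)))"
proof (induction A)
  case 0
  have "norm (Fker m (M 0) x) \<le> 1" using norm_Fker_le[of "M 0" x] by simp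
  then show ?case using L_ge by (simp add: agree_off_def)
next
  case (Suc A)
  show ?case
  proof (cases "\<forall>j<A. x j = 0")
    case True
    have "norm (Fker m (M (Suc A)) x) \<le> real (M (Suc A)) * real (M (Suc A))" by (rule norm_Fker_le)
    also have "\<dots> \<le> real (L * M A) * real (M (Suc A))"
      using M_Suc_le[of A] by (intro mult_right_mono) (auto simp only: of_nat_le_iff of_nat_0_le_iff)
    also have "\<dots> = L * (\<Sum>k\<in>{A}. real (M k) * real (M (Suc A)) * of_bool (agree_off k (Suc A) x (\<lambda>_. 0)))"
      using True by (simp add: agree_off_def less_Suc_eq)
    also have "\<dots> \<le> L * (\<Sum>k\<le>Suc A. real (M k) * real (M (Suc A)) * of_bool (agree_off k (Suc A) x (\<lambda>_. 0)))"
      by (intro mult_left_mono sum_mono2) auto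
    finally show ?thesis .
  next
    case False
    then have notI: "\<not> agree_off A A x (\<lambda>_. 0)" by (auto simp: agree_off_def)
    have "norm (Fker m (M (Suc A)) x) = m A * of_bool (x A = 0) * norm (Fker m (M A) x)"
      using Fker_M_Suc[OF assms False] by (simp add: norm_mult)
    also have "\<dots> \<le> m A * of_bool (x A = 0) *
        (L * (\<Sum>k\<le>A. real (M k) * real (M A) * of_bool (agree_off k A x (\<lambda>_. 0))))"
      by (intro mult_left_mono Suc.IH) auto
    also have "\<dots> = L * (\<Sum>k\<le>A. real (M k) * real (M (Suc A)) * (of_bool (x A = 0) * of_bool (agree_off k A x (\<lambda>_. 0))))"
      by (simp add: sum_distrib_left mult_ac)
    also have "\<dots> \<le> L * (\<Sum>k\<le>A. real (M k) * real (M (Suc A)) * of_bool (agree_off k (Suc A) x (\<lambda>_. 0)))"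
    proof (intro mult_left_mono sum_mono)
      fix k assume "k \<in> {..A}"
      show "of_bool (x A = 0) * of_bool (agree_off k A x (\<lambda>_. 0)) \<le> (of_bool (agree_off k (Suc A) x (\<lambda>_. 0)) :: real)"
        using notI by (auto simp: agree_off_def less_Suc_eq)
    qed auto
    also have "\<dots> \<le> L * (\<Sum>k\<le>Suc A. real (M k) * real (M (Suc A)) * of_bool (agree_off k (Suc A) x (\<lambda>_. 0)))"
      by (intro mult_left_mono sum_mono2) auto
    finally show ?thesis .
  qed
qed

lemma norm_Dker_mult_le: "a \<le> m N \<Longrightarrow> norm (Dker m (a * M N) x) \<le> a * norm (Dker m (M N) x)"
proof -
  assume a: "a \<le> m N"
  have "norm (\<Sum>i<a. rad m N x ^ i) \<le> (\<Sum>i<a. 1)"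
    by (rule order_trans[OF norm_sum]) (simp add: norm_power)
  then show ?thesis using Dker_mult[OF a, of x]
    by (simp add: norm_mult mult_right_mono)
qed

lemma norm_Fker_mult_le:
  "a \<le> m N \<Longrightarrow> norm (Fker m (a * M N) x)
    \<le> a * norm (Fker m (M N) x) + a * (L * M N * norm (Dker m (M N) x))"
proof (induction a)
  case (Suc a)
  have "norm (Fker m (Suc a * M N) x)
      = norm (Fker m (a * M N) x + of_nat (M N) * Dker m (a * M N) x + rad m N x ^ a * Fker m (M N) x)"
    using Fker_split[of "M N" N a x] Suc.prems by (simp add: add.commute)
  also have "\<dots> \<le> norm (Fker m (a * M N) x) + M N * norm (Dker m (a * M N) x) + norm (Fker m (M N) x)"
    by (intro norm_triangle_le add_mono) (auto simp: norm_mult norm_power)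
  also have "M N * norm (Dker m (a * M N) x) \<le> M N * (L * norm (Dker m (M N) x))"
  proof (intro mult_left_mono)
    have "norm (Dker m (a * M N) x) \<le> a * norm (Dker m (M N) x)"
      using norm_Dker_mult_le Suc.prems by simp
    also have "\<dots> \<le> L * norm (Dker m (M N) x)"
      using Suc.prems m_le[of N] by (intro mult_right_mono) auto
    finally show "norm (Dker m (a * M N) x) \<le> L * norm (Dker m (M N) x)" .
  qed auto
  finally show ?case using Suc by (simp add: algebra_simps)
qed (simp add: Fker_def)

text \<open>The leading digit is stripped at each step. The 2 counts two Dirichlet contributions:
  one inside \<open>Fker m (a * M N)\<close>, one from the \<open>j\<close> copies in
  \<open>Fker_split\<close>.\<close>

lemma norm_Fker_bound_aux:
  "n < M N \<Longrightarrow> norm (Fker m n x)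
    \<le> (\<Sum>A<N. L * norm (Fker m (M A) x) + 2 * L * L * M A * norm (Dker m (M A) x))"
proof (induction N arbitrary: n)
  case (Suc N)
  define a j where "a = n div M N" and "j = n mod M N"
  have n: "n = a * M N + j" unfolding a_def j_def by (rule div_mult_mod_eq[symmetric])
  have j: "j < M N" using M_pos by (simp add: j_def)
  have a: "a < m N" using Suc.prems by (simp add: a_def less_mult_imp_div_less)
  have aL: "real a \<le> L" using a m_le[of N] by simp
  let ?F = "norm (Fker m (M N) x)" and ?D = "norm (Dker m (M N) x)"
  have "norm (Fker m n x) \<le> norm (Fker m (a * M N) x) + j * norm (Dker m (a * M N) x) + norm (Fker m j x)"
    unfolding n Fker_split[OF less_imp_le[OF j] a]
    by (intro norm_triangle_le add_mono) (auto simp: norm_mult norm_power)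
  also have "norm (Fker m (a * M N) x) \<le> L * ?F + L * (L * M N * ?D)"
    by (rule order_trans[OF norm_Fker_mult_le]) (use a aL in \<open>auto intro!: add_mono mult_right_mono\<close>)
  also have "j * norm (Dker m (a * M N) x) \<le> M N * (L * ?D)"
  proof (intro mult_mono)
    show "norm (Dker m (a * M N) x) \<le> L * ?D"
      by (rule order_trans[OF norm_Dker_mult_le]) (use a aL in \<open>auto intro!: mult_right_mono\<close>)
  qed (use j in auto)
  also have "M N * (L * ?D) \<le> L * (L * M N * ?D)"
  proof -
    have "1 * (L * (M N * ?D)) \<le> L * (L * (M N * ?D))"
      by (intro mult_right_mono) (use L_ge in auto)
    then show ?thesis by (simp add: mult_ac)
  qed
  finally show ?case using Suc.IH[OF j] by (simp add: algebra_simps)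
qed (simp add: Fker_def)

lemma norm_Fker_bound:
  assumes "x \<in> G" "n < M N"
  shows "norm (Fker m n x)
    \<le> 3 * L\<^sup>2 * (\<Sum>A<N. \<Sum>k\<le>A. real (M k) * real (M A) * of_bool (agree_off k A x (\<lambda>_. 0)))"
proof -
  have "L * norm (Fker m (M A) x) + 2 * L * L * M A * norm (Dker m (M A) x)
      \<le> 3 * L\<^sup>2 * (\<Sum>k\<le>A. real (M k) * real (M A) * of_bool (agree_off k A x (\<lambda>_. 0)))" (is "_ \<le> _ * ?S") for A
  proof -
    \<comment> \<open>The Dirichlet part is exactly the term \<open>k = A\<close>, so it joins the
      sum for \<open>Fker m (M A)\<close>; 3 = 1 + 2.\<close>
    have "M A * norm (Dker m (M A) x) = (\<Sum>k\<in>{A}. real (M k) * real (M A) * of_bool (agree_off k A x (\<lambda>_. 0)))"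
      using Dker_M[OF assms(1), of A] by (auto simp: agree_off_def)
    also have "\<dots> \<le> ?S" by (intro sum_mono2) auto
    finally have "2 * L * L * (M A * norm (Dker m (M A) x)) \<le> 2 * L * L * ?S"
      by (intro mult_left_mono) auto
    moreover have "L * norm (Fker m (M A) x) \<le> L * (L * ?S)"
      by (intro mult_left_mono norm_Fker_M_le assms) auto
    ultimately show ?thesis by (simp add: algebra_simps power2_eq_square)
  qed
  then show ?thesis
    unfolding sum_distrib_left[of _ _ "{..<N}"]
    by (intro order_trans[OF norm_Fker_bound_aux[OF assms(2)]] sum_mono) (simp only: sum_distrib_left)
qed

end

section \<open>Averages and kernel estimates\<close>

text \<open>One representative for each cylinder of level \<open>n\<close>; this finite set replaces
  the group wherever only \<open>n\<close> coordinates matter.\<close>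

definition Zset :: "(nat \<Rightarrow> nat) \<Rightarrow> nat \<Rightarrow> (nat \<Rightarrow> nat) set" where
  "Zset m n = {z \<in> Vgroup m. \<forall>j\<ge>n. z j = 0}"

text \<open>Pointwise form of measurability with respect to \<open>Vfilt m n\<close>; it serves for
  predicates as well.\<close>

definition level_fun :: "(nat \<Rightarrow> nat) \<Rightarrow> nat \<Rightarrow> ((nat \<Rightarrow> nat) \<Rightarrow> 'b) \<Rightarrow> bool" where
  "level_fun m n g \<longleftrightarrow> (\<forall>x\<in>Vgroup m. \<forall>y\<in>Vgroup m. (\<forall>j<n. x j = y j) \<longrightarrow> g x = g y)"

text \<open>The average of a function of the first \<open>n\<close> coordinates is its integral, so nearly all integrals
  below are finite sums.\<close>

definition avg :: "(nat \<Rightarrow> nat) \<Rightarrow> nat \<Rightarrow> ((nat \<Rightarrow> nat) \<Rightarrow> 'b::real_normed_field) \<Rightarrow> 'b" where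
  "avg m n g = (\<Sum>z\<in>Zset m n. g z) / of_nat (Mseq m n)"

definition trunc :: "nat \<Rightarrow> (nat \<Rightarrow> nat) \<Rightarrow> nat \<Rightarrow> nat" where
  "trunc n x = (\<lambda>j. if j < n then x j else 0)"

text \<open>The martingale property as averaging over the children of a cylinder.
  \<open>is_mart_step_mart\<close> derives it from the definition by Fourier sums.\<close>

definition step_mart :: "(nat \<Rightarrow> nat) \<Rightarrow> vmart \<Rightarrow> bool" where
  "step_mart m f \<longleftrightarrow> (\<forall>n. level_fun m n (f n)) \<and>
     (\<forall>n. \<forall>x\<in>Vgroup m. f n x = (\<Sum>c<m n. f (Suc n) (x(n := c))) / of_nat (m n))"

lemma locD: "level_fun m n g \<Longrightarrow> x \<in> Vgroup m \<Longrightarrow> y \<in> Vgroup m \<Longrightarrow> (\<And>j. j < n \<Longrightarrow> x j = y j) \<Longrightarrow> g x = g y"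
  unfolding level_fun_def by blast

lemma level_fun_mono: "level_fun m n g \<Longrightarrow> n \<le> N \<Longrightarrow> level_fun m N g"
  unfolding level_fun_def by (meson order_less_le_trans)

lemma level_fun_comp2: "level_fun m n f \<Longrightarrow> level_fun m n g \<Longrightarrow> level_fun m n (\<lambda>x. F (f x) (g x))"
  unfolding level_fun_def by (intro ballI impI arg_cong2[of _ _ _ _ F]) blast+

lemma level_fun_comp: "level_fun m n f \<Longrightarrow> level_fun m n (\<lambda>x. F (f x))"
  unfolding level_fun_def by (intro ballI impI arg_cong[of _ _ F]) blast

lemma level_fun_sum: "(\<And>i. i \<in> I \<Longrightarrow> level_fun m n (f i)) \<Longrightarrow> level_fun m n (\<lambda>x. \<Sum>i\<in>I. f i x)"
  unfolding level_fun_def by (intro ballI impI sum.cong refl) blast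

lemma level_fun_prod: "(\<And>i. i \<in> I \<Longrightarrow> level_fun m n (f i)) \<Longrightarrow> level_fun m n (\<lambda>x. \<Prod>i\<in>I. f i x)"
  unfolding level_fun_def by (intro ballI impI prod.cong refl) blast

context vilenkin_seq
begin

section \<open>Finite averages over representatives of cylinders\<close>

lemma fun_upd_in_G: "x \<in> G \<Longrightarrow> c < m n \<Longrightarrow> x(n := c) \<in> G"
  by (auto simp: Vgroup_def)

lemma Z_in_G: "z \<in> Zset m n \<Longrightarrow> z \<in> G" by (auto simp: Zset_def)

lemma zero_in_G: "(\<lambda>_. 0) \<in> G" using m_pos by (simp add: Vgroup_def)

lemma Zset_0: "Zset m 0 = {\<lambda>_. 0}"
  using zero_in_G by (auto simp: Zset_def)

lemma trunc_in_Z: "x \<in> G \<Longrightarrow> trunc n x \<in> Zset m n"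
  using m_pos by (auto simp: Zset_def Vgroup_def trunc_def)

lemma sum_Z_Suc: "(\<Sum>z\<in>Zset m (Suc n). g z) = (\<Sum>z\<in>Zset m n. \<Sum>c<m n. g (z(n := c)))"
proof -
  have "(\<Sum>z\<in>Zset m (Suc n). g z) = (\<Sum>(z,c)\<in>Zset m n \<times> {..<m n}. g (z(n := c)))"
    by (rule sum.reindex_bij_witness[where i = "\<lambda>(z,c). z(n := c)" and j = "\<lambda>z. (z(n := 0), z n)"])
      (use m_pos in \<open>auto simp: Zset_def Vgroup_def\<close>)
  then show ?thesis by (simp add: sum.cartesian_product)
qed

lemma Z_Suc_image: "Zset m (Suc n) = (\<lambda>(z,c). z(n := c)) ` (Zset m n \<times> {..<m n})"
proof
  show "Zset m (Suc n) \<subseteq> (\<lambda>(z,c). z(n := c)) ` (Zset m n \<times> {..<m n})"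
  proof
    fix z assume z: "z \<in> Zset m (Suc n)"
    then have "z = (\<lambda>(z,c). z(n := c)) (z(n := 0), z n)" "(z(n := 0), z n) \<in> Zset m n \<times> {..<m n}"
      using m_pos by (auto simp: Zset_def Vgroup_def)
    then show "z \<in> (\<lambda>(z,c). z(n := c)) ` (Zset m n \<times> {..<m n})" by (rule image_eqI)
  qed
qed (auto simp: Zset_def Vgroup_def)

lemma finite_Z [simp]: "finite (Zset m n)"
proof (induction n)
  case (Suc n)
  then show ?case unfolding Z_Suc_image by (intro finite_imageI finite_cartesian_product) auto
qed (simp add: Zset_0)

lemma card_Z: "card (Zset m n) = M n"
proof (induction n)
  case (Suc n)
  then show ?case using sum_Z_Suc[of "\<lambda>_. 1::nat" n] by simp
qed (simp add: Zset_0)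

lemma avg_sum: "avg m n (\<lambda>t. \<Sum>i\<in>I. g i t) = (\<Sum>i\<in>I. avg m n (g i))"
  unfolding avg_def by (subst sum.swap) (simp add: sum_divide_distrib)

lemma avg_cmult: "avg m n (\<lambda>t. c * g t) = c * avg m n g"
  by (simp add: avg_def sum_distrib_left)

lemma avg_multc: "avg m n (\<lambda>t. g t * c) = avg m n g * c"
  by (simp add: avg_def sum_distrib_right)

lemma avg_add: "avg m n (\<lambda>t. f t + g t) = avg m n f + avg m n g"
  by (simp add: avg_def sum.distrib add_divide_distrib)

lemma avg_const: "avg m n (\<lambda>t. c) = c"
  using M_pos[of n] by (simp add: avg_def card_Z)

lemma avg_mono: "(\<And>t. t \<in> Zset m n \<Longrightarrow> f t \<le> g t) \<Longrightarrow> avg m n f \<le> (avg m n g :: real)"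
  unfolding avg_def by (intro divide_right_mono sum_mono) auto

lemma avg_nonneg: "(\<And>t. t \<in> Zset m n \<Longrightarrow> 0 \<le> f t) \<Longrightarrow> 0 \<le> (avg m n f :: real)"
  unfolding avg_def by (intro divide_nonneg_nonneg sum_nonneg) auto

lemma avg_cong: "(\<And>t. t \<in> Zset m n \<Longrightarrow> f t = g t) \<Longrightarrow> avg m n f = avg m n g"
  unfolding avg_def by (intro arg_cong2[of _ _ _ _ "(/)"] sum.cong) auto

lemma norm_avg_le: "norm (avg m n f) \<le> avg m n (\<lambda>t. norm (f t))"
  unfolding avg_def norm_divide norm_of_nat by (intro divide_right_mono norm_sum) auto

lemma avg_Suc: "avg m (Suc n) g = avg m n (\<lambda>x. (\<Sum>c<m n. g (x(n := c))) / of_nat (m n))"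
  by (simp add: avg_def sum_Z_Suc sum_divide_distrib)

text \<open>A factor that does not see coordinate \<open>n\<close> comes out of the average over
  that coordinate, as a known factor does from a conditional expectation.\<close>

lemma avg_Suc_mult:
  assumes "level_fun m n \<phi>"
  shows "avg m (Suc n) (\<lambda>x. g x * \<phi> x) = avg m n (\<lambda>x. (\<Sum>c<m n. g (x(n := c))) / of_nat (m n) * \<phi> x)"
  unfolding avg_Suc
proof (rule avg_cong)
  fix x assume "x \<in> Zset m n"
  then have "\<phi> (x(n := c)) = \<phi> x" if "c < m n" for c
    using that by (intro locD[OF assms]) (auto intro: fun_upd_in_G Z_in_G)
  then show "(\<Sum>c<m n. g (x(n := c)) * \<phi> (x(n := c))) / of_nat (m n)
      = (\<Sum>c<m n. g (x(n := c))) / of_nat (m n) * \<phi> x"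
    by (simp add: sum_distrib_right)
qed

lemma avg_level_fun_Suc: "level_fun m n g \<Longrightarrow> avg m (Suc n) g = avg m n g"
  using avg_Suc_mult[of n g "\<lambda>_. 1"] m_pos[of n] by simp

lemma avg_level_fun:
  assumes "level_fun m n g" "n \<le> N"
  shows "avg m N g = avg m n g"
  using assms(2)
proof (induction N rule: dec_induct)
  case (step N)
  then show ?case using avg_level_fun_Suc[OF level_fun_mono[OF assms(1)], of N] by simp
qed simp

text \<open>Independence of the coordinates.\<close>

lemma avg_prod: "avg m N (\<lambda>z. \<Prod>i<N. w i (z i)) = (\<Prod>i<N. (\<Sum>c<m i. w i c) / of_nat (m i))"
proof (induction N)
  case (Suc N)
  have "avg m (Suc N) (\<lambda>z. \<Prod>i<Suc N. w i (z i))
      = avg m N (\<lambda>z. (\<Prod>i<N. w i (z i)) * ((\<Sum>c<m N. w N c) / of_nat (m N)))"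
    unfolding avg_Suc by (rule avg_cong) (simp add: sum_distrib_left)
  then show ?case unfolding avg_multc using Suc by simp
qed (simp add: avg_def Zset_0)

lemma avg_agree:
  assumes "x \<in> G" "S \<subseteq> {..<N}"
  shows "avg m N (\<lambda>t. of_bool (\<forall>i\<in>S. x i = t i) :: real) = 1 / (\<Prod>i\<in>S. real (m i))"
proof -
  have "(\<lambda>t. of_bool (\<forall>i\<in>S. x i = t i) :: real) = (\<lambda>t. \<Prod>i<N. of_bool (i \<in> S \<longrightarrow> x i = t i))"
  proof
    fix t
    show "(of_bool (\<forall>i\<in>S. x i = t i) :: real) = (\<Prod>i<N. of_bool (i \<in> S \<longrightarrow> x i = t i))"
    proof (cases "\<forall>i\<in>S. x i = t i")
      case False
      then obtain i where "i \<in> S" "x i \<noteq> t i" by blast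
      then have "(\<Prod>i<N. of_bool (i \<in> S \<longrightarrow> x i = t i) :: real) = 0"
        using assms(2) by (intro prod_zero) auto
      then show ?thesis using False by simp
    qed simp
  qed
  moreover have "(\<Sum>c<m i. of_bool (i \<in> S \<longrightarrow> x i = c)) / of_nat (m i) = (if i \<in> S then 1 / real (m i) else 1)" for i
  proof -
    have "(\<Sum>c<m i. of_bool (x i = c)) = (1::real)"
      using G_lt[OF assms(1), of i] by (subst sum.remove[of _ "x i"]) auto
    then show ?thesis using m_pos[of i] by auto
  qed
  moreover have "avg m N (\<lambda>t. \<Prod>i<N. of_bool (i \<in> S \<longrightarrow> x i = t i) :: real)
      = (\<Prod>i<N. (\<Sum>c<m i. of_bool (i \<in> S \<longrightarrow> x i = c)) / of_nat (m i))"
    by (rule avg_prod)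
  ultimately have "avg m N (\<lambda>t. of_bool (\<forall>i\<in>S. x i = t i) :: real) = (\<Prod>i<N. if i \<in> S then 1 / real (m i) else 1)"
    by (simp only:)
  also have "\<dots> = (\<Prod>i\<in>S. 1 / real (m i))"
    using assms(2) by (subst prod.inter_restrict[symmetric]) (auto simp: Int_absorb1)
  finally show ?thesis by (simp add: prod_dividef)
qed

lemma avg_agree_lessThan:
  assumes "x \<in> G" "A \<le> N"
  shows "avg m N (\<lambda>t. of_bool (\<forall>i<A. x i = t i) :: real) = 1 / M A"
proof -
  have "avg m N (\<lambda>t. of_bool (\<forall>i\<in>{..<A}. x i = t i) :: real) = 1 / (\<Prod>i<A. real (m i))"
    by (rule avg_agree) (use assms in auto)
  then show ?thesis by (simp add: M_prod Ball_def)
qed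

text \<open>Freeing one coordinate enlarges a cylinder by a factor of at most
  \<open>L\<close>.\<close>

lemma avg_agree_off_le:
  assumes "x \<in> G" "A \<le> N"
  shows "avg m N (\<lambda>t. of_bool (agree_off k A x t) :: real) \<le> L / M A"
proof -
  let ?S = "{..<A} - {k}"
  have "avg m N (\<lambda>t. of_bool (\<forall>i\<in>?S. x i = t i) :: real) = 1 / (\<Prod>i\<in>?S. real (m i))"
    by (rule avg_agree) (use assms in auto)
  also have "(\<lambda>t. of_bool (\<forall>i\<in>?S. x i = t i) :: real) = (\<lambda>t. of_bool (agree_off k A x t))"
    by (auto simp: fun_eq_iff agree_off_def)
  also have "1 / (\<Prod>i\<in>?S. real (m i)) \<le> L / M A"
  proof -
    have P: "0 < (\<Prod>i\<in>?S. real (m i))" using m_pos by (intro prod_pos) auto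
    have "real (M A) \<le> L * (\<Prod>i\<in>?S. real (m i))"
    proof (cases "k < A")
      case True
      then have "real (M A) = m k * (\<Prod>i\<in>?S. real (m i))"
        unfolding M_prod of_nat_prod by (intro prod.remove) auto
      then show ?thesis using m_le[of k] P by simp
    next
      case False
      then have "?S = {..<A}" by auto
      then show ?thesis using L_ge P by (simp add: M_prod)
    qed
    then show ?thesis using P M_pos[of A] by (simp add: field_simps)
  qed
  finally show ?thesis .
qed

section \<open>Translates of characters and kernels\<close>

lemma Vsub_in_G: "Vsub m x t \<in> G"
  using m_pos by (simp add: Vsub_def Vgroup_def)

lemma Vsub_eq_0_iff: "x \<in> G \<Longrightarrow> t \<in> G \<Longrightarrow> Vsub m x t k = 0 \<longleftrightarrow> x k = t k"
proof -
  assume "x \<in> G" "t \<in> G"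
  then have lt: "x k < m k" "t k < m k" by (auto simp: Vgroup_def)
  show ?thesis
  proof (cases "x k < t k")
    case True
    then have "Vsub m x t k = x k + (m k - t k)" using lt by (simp add: Vsub_def)
    then show ?thesis using True lt by simp
  next
    case False
    then have "x k + (m k - t k) = (x k - t k) + m k" using lt by linarith
    then have "Vsub m x t k = ((x k - t k) + m k) mod m k" by (simp only: Vsub_def)
    also have "\<dots> = x k - t k" using lt by simp
    finally show ?thesis using False by simp
  qed
qed

lemma agree_off_Vsub: "x \<in> G \<Longrightarrow> t \<in> G \<Longrightarrow> agree_off k A (Vsub m x t) (\<lambda>_. 0) \<longleftrightarrow> agree_off k A x t"
  by (simp add: agree_off_def Vsub_eq_0_iff)

lemma cis_mod: "0 < q \<Longrightarrow> cis (2 * pi * real (a mod q) / real q) = cis (2 * pi * real a / real q)"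
proof -
  assume q: "0 < q"
  have "real a = real q * real (a div q) + real (a mod q)"
    by (metis mult_div_mod_eq of_nat_add of_nat_mult)
  then have "2 * pi * real a / real q = 2 * pi * real (a div q) + 2 * pi * real (a mod q) / real q"
    using q by (simp add: field_simps)
  then have "cis (2 * pi * real a / real q) = cis (2 * pi * real (a div q)) * cis (2 * pi * real (a mod q) / real q)"
    by (simp only: cis_mult)
  also have "cis (2 * pi * real (a div q)) = 1" by (intro cis_multiple_2pi) auto
  finally show ?thesis by simp
qed

lemma rad_Vsub: "t \<in> G \<Longrightarrow> rad m k (Vsub m x t) = rad m k x * cnj (rad m k t)"
proof -
  assume "t \<in> G"
  then have t: "t k < m k" by (simp add: Vgroup_def)
  \<comment> \<open>The summand \<open>m k\<close> in \<open>Vsub\<close> contributes a full turn,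
    invisible to \<open>cis\<close>.\<close>
  have "2 * pi * real (x k + (m k - t k)) / m k = (2 * pi * x k / m k + - (2 * pi * t k / m k)) + 2 * pi"
    using t m_pos[of k] by (simp add: of_nat_diff field_simps)
  then have "cis (2 * pi * real (x k + (m k - t k)) / m k)
      = cis (2 * pi * x k / m k) * cis (- (2 * pi * t k / m k)) * cis (2 * pi)"
    by (simp only: cis_mult)
  then show ?thesis
    by (simp add: rad_eq_cis Vsub_def cis_mod m_pos cis_cnj)
qed

lemma vpsi_Vsub: "t \<in> G \<Longrightarrow> vpsi m n (Vsub m x t) = vpsi m n x * cnj (vpsi m n t)"
  by (simp add: vpsi_def rad_Vsub power_mult_distrib prod.distrib)

lemma level_fun_rad: "k < N \<Longrightarrow> level_fun m N (rad m k)"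
  by (simp add: level_fun_def rad_def)

lemma level_fun_vpsi: assumes "i < M N" shows "level_fun m N (vpsi m i)"
proof -
  have "level_fun m N (\<lambda>x. \<Prod>k<N. rad m k x ^ digit m i k)"
    by (intro level_fun_prod level_fun_comp[OF level_fun_rad]) auto
  moreover have "vpsi m i = (\<lambda>x. \<Prod>k<N. rad m k x ^ digit m i k)"
    using vpsi_eq_prod[OF assms] by (rule ext)
  ultimately show ?thesis by simp
qed

lemma level_fun_Dker: "n \<le> M N \<Longrightarrow> level_fun m N (Dker m n)"
  unfolding Dker_def by (intro level_fun_sum level_fun_vpsi) auto

lemma level_fun_Fker: "n \<le> M N \<Longrightarrow> level_fun m N (Fker m n)"
  unfolding Fker_def by (intro level_fun_sum level_fun_Dker) auto

lemma level_fun_Vsub: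
  assumes "level_fun m N g"
  shows "level_fun m N (\<lambda>t. g (Vsub m x t))"
  unfolding level_fun_def
proof (intro ballI impI)
  fix t s :: "nat \<Rightarrow> nat" assume "\<forall>j<N. t j = s j"
  then show "g (Vsub m x t) = g (Vsub m x s)"
    by (intro locD[OF assms] Vsub_in_G) (simp add: Vsub_def)
qed

section \<open>Averages of translated Fejer kernels\<close>

lemma obtain_level:
  assumes "1 \<le> n"
  obtains N where "M N \<le> n" "n < M (Suc N)"
proof -
  have "n < M n" by (rule Mseq_ge[of m, OF m_ge])
  then obtain k where "\<forall>i\<le>k. \<not> n < M i" "n < M (k + 1)"
    using ex_least_nat_less[of "\<lambda>k. n < M k" n] assms by auto
  then show ?thesis using that[of k] by auto
qed

lemma avg_kernel_bound:
  assumes "x \<in> G" "n < M (Suc N0)" "\<And>t. 0 \<le> w t"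
  shows "avg m N (\<lambda>t. w t * norm (Fker m n (Vsub m x t)))
    \<le> 3 * L\<^sup>2 * (\<Sum>A\<le>N0. \<Sum>k\<le>A. real (M k) * real (M A) * avg m N (\<lambda>t. w t * of_bool (agree_off k A x t)))"
proof -
  have "avg m N (\<lambda>t. w t * norm (Fker m n (Vsub m x t)))
      \<le> avg m N (\<lambda>t. 3 * L\<^sup>2 * (\<Sum>A\<le>N0. \<Sum>k\<le>A. real (M k) * real (M A) * (w t * of_bool (agree_off k A x t))))"
  proof (rule avg_mono)
    fix t assume "t \<in> Zset m N"
    then have "t \<in> G" by (rule Z_in_G)
    have "norm (Fker m n (Vsub m x t))
        \<le> 3 * L\<^sup>2 * (\<Sum>A<Suc N0. \<Sum>k\<le>A. real (M k) * real (M A) * of_bool (agree_off k A (Vsub m x t) (\<lambda>_. 0)))"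
      by (rule norm_Fker_bound[OF Vsub_in_G assms(2)])
    also have "\<dots> = 3 * L\<^sup>2 * (\<Sum>A\<le>N0. \<Sum>k\<le>A. real (M k) * real (M A) * of_bool (agree_off k A x t))"
      by (simp add: agree_off_Vsub[OF assms(1) \<open>t \<in> G\<close>] lessThan_Suc_atMost)
    finally have "w t * norm (Fker m n (Vsub m x t))
        \<le> w t * (3 * L\<^sup>2 * (\<Sum>A\<le>N0. \<Sum>k\<le>A. real (M k) * real (M A) * of_bool (agree_off k A x t)))"
      by (intro mult_left_mono assms)
    then show "w t * norm (Fker m n (Vsub m x t))
        \<le> 3 * L\<^sup>2 * (\<Sum>A\<le>N0. \<Sum>k\<le>A. real (M k) * real (M A) * (w t * of_bool (agree_off k A x t)))"
      by (simp add: sum_distrib_left mult_ac)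
  qed
  then show ?thesis by (simp only: avg_cmult avg_sum)
qed

text \<open>With weight 1 each term averages to at most \<open>L * M k\<close>. The geometric sums
  over \<open>k\<close> and over \<open>A\<close> cost a factor 2 each, so 12 = 3 * 2 * 2, and the
  second one ends at \<open>M N0 \<le> n\<close>.\<close>

lemma avg_kernel_L1:
  assumes "x \<in> G" "1 \<le> n" "n \<le> M N"
  shows "avg m N (\<lambda>t. norm (Fker m n (Vsub m x t))) \<le> 12 * real L ^ 3 * n"
proof -
  from obtain_level[OF assms(2)] obtain N0 where N0: "M N0 \<le> n" "n < M (Suc N0)" .
  have "N0 \<le> N"
  proof (rule ccontr)
    assume "\<not> N0 \<le> N"
    then have "M (Suc N) \<le> M N0" by (intro M_mono) auto
    then have "2 * M N \<le> M N" using M_double[of N] N0(1) assms(3) by linarith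
    then show False using M_pos[of N] by simp
  qed
  have "avg m N (\<lambda>t. 1 * norm (Fker m n (Vsub m x t)))
      \<le> 3 * L\<^sup>2 * (\<Sum>A\<le>N0. \<Sum>k\<le>A. real (M k) * real (M A) * avg m N (\<lambda>t. 1 * of_bool (agree_off k A x t)))"
    by (rule avg_kernel_bound[OF assms(1) N0(2)]) simp
  also have "\<dots> \<le> 3 * L\<^sup>2 * (\<Sum>A\<le>N0. \<Sum>k\<le>A. real (M k) * real (M A) * (L / M A))"
    using \<open>N0 \<le> N\<close> by (intro mult_left_mono sum_mono) (auto intro!: avg_agree_off_le assms(1))
  also have "\<dots> = 3 * real L ^ 3 * (\<Sum>A\<le>N0. real (\<Sum>k\<le>A. M k))"
  proof -
    have M0: "M A = 0 \<longleftrightarrow> False" for A using M_pos[of A] by simp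
    show ?thesis by (simp add: M0 sum_distrib_left power2_eq_square power3_eq_cube mult_ac)
  qed
  also have "\<dots> \<le> 3 * real L ^ 3 * (\<Sum>A\<le>N0. real (2 * M A))"
    by (intro mult_left_mono sum_mono of_nat_mono sum_M_le) auto
  also have "(\<Sum>A\<le>N0. real (2 * M A)) = 2 * real (\<Sum>A\<le>N0. M A)"
    by (simp add: sum_distrib_left)
  also have "\<dots> \<le> 2 * real (2 * M N0)"
    by (intro mult_left_mono of_nat_mono sum_M_le) auto
  also have "\<dots> \<le> 4 * real n" using N0(1) by simp
  finally show ?thesis by (simp add: mult_left_mono)
qed

text \<open>The right-hand side does not see \<open>n\<close> except through the factor that turns \<open>Fker\<close> into a mean; this is
  what allows the supremum over \<open>n\<close> below. Cells with \<open>A > j\<close> contribute at most \<open>N0 - j\<close> equal sums,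
  and \<open>N0 - j\<close> is absorbed by \<open>n / Mseq m j\<close>.\<close>

lemma avg_kernel_atom:
  assumes x: "x \<in> G" and z: "z \<in> G" and j: "M j < n" "j \<le> N" and n: "n \<le> M N" and far: "\<not> (\<forall>i<j. x i = z i)"
  shows "avg m N (\<lambda>t. of_bool (\<forall>i<j. z i = t i) * norm (Fker m n (Vsub m x t)))
    \<le> n * (6 * L\<^sup>2 * (\<Sum>A\<le>j. \<Sum>k\<le>A. real (M k) * real (M A) / (real (M j))\<^sup>2 * of_bool (agree_off k A x z)))"
proof -
  have "1 \<le> n" using j by simp
  from obtain_level[OF this] obtain N0 where N0: "M N0 \<le> n" "n < M (Suc N0)" .
  have "N0 \<le> N"
  proof (rule ccontr)
    assume "\<not> N0 \<le> N"
    then have "M (Suc N) \<le> M N0" by (intro M_mono) auto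
    then have "2 * M N \<le> M N" using M_double[of N] N0(1) n by linarith
    then show False using M_pos[of N] by simp
  qed
  have "j \<le> N0"
  proof (rule ccontr)
    assume "\<not> j \<le> N0"
    then have "M (Suc N0) \<le> M j" by (intro M_mono) auto
    then show False using j N0 by simp
  qed
  define a where "a k A = avg m N (\<lambda>t. of_bool (\<forall>i<j. z i = t i) * of_bool (agree_off k A x t) :: real)" for k A
  define Q where "Q = (\<Sum>A\<le>j. \<Sum>k\<le>A. real (M k) * real (M A) / (real (M j))\<^sup>2 * of_bool (agree_off k A x z))"
  \<comment> \<open>For \<open>A \<le> j\<close> the condition on \<open>t\<close> concerns
    coordinates where \<open>t\<close> equals \<open>z\<close>, so it becomes a condition on
    \<open>z\<close> and only the measure of the cylinder remains.\<close>
  have a1: "a k A \<le> of_bool (agree_off k A x z) / M j" if "A \<le> j" for k A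
  proof -
    have "a k A \<le> avg m N (\<lambda>t. of_bool (agree_off k A x z) * of_bool (\<forall>i<j. z i = t i))"
      unfolding a_def by (rule avg_mono) (use that in \<open>auto simp: agree_off_def\<close>)
    also have "\<dots> = of_bool (agree_off k A x z) * (1 / M j)"
      unfolding avg_cmult avg_agree_lessThan[OF z j(2)] ..
    finally show ?thesis by simp
  qed
  have a2: "a k A \<le> of_bool (agree_off k j x z) * of_bool (k < j) / M A" if "j < A" "A \<le> N" for k A
  proof -
    \<comment> \<open>Since \<open>x\<close> and \<open>z\<close> differ below \<open>j\<close>, the
      omitted \<open>k\<close> must be the place where they differ. Then \<open>t\<close> is
      prescribed on all coordinates below \<open>A\<close>: by \<open>z\<close> below
      \<open>j\<close>, by \<open>x\<close> from \<open>j\<close> on.\<close>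
    let ?w = "\<lambda>i. if i < j then z i else x i"
    have w: "?w \<in> G" using x z by (auto simp: Vgroup_def)
    have "a k A \<le> avg m N (\<lambda>t. of_bool (agree_off k j x z) * of_bool (k < j) * of_bool (\<forall>i<A. ?w i = t i))"
      unfolding a_def
    proof (rule avg_mono)
      fix t
      show "of_bool (\<forall>i<j. z i = t i) * of_bool (agree_off k A x t)
        \<le> (of_bool (agree_off k j x z) * of_bool (k < j) * of_bool (\<forall>i<A. ?w i = t i) :: real)"
      proof (cases "(\<forall>i<j. z i = t i) \<and> agree_off k A x t")
        case True
        then have "k < j" using far that by (force simp: agree_off_def)
        moreover have "agree_off k j x z" using True that by (auto simp: agree_off_def)
        moreover have "\<forall>i<A. ?w i = t i" using True \<open>k < j\<close> by (auto simp: agree_off_def)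
        ultimately show ?thesis by simp
      qed auto
    qed
    also have "\<dots> = of_bool (agree_off k j x z) * of_bool (k < j) * (1 / M A)"
      unfolding avg_cmult avg_agree_lessThan[OF w that(2)] ..
    finally show ?thesis by simp
  qed
  have Mj: "0 < real (M j)" using M_pos by simp
  let ?T = "\<lambda>A. \<Sum>k\<le>A. real (M k) * real (M A) * a k A"
  let ?R = "\<Sum>k\<le>j. real (M k) * of_bool (agree_off k j x z)"
  have S1: "(\<Sum>A\<le>j. ?T A) \<le> M j * Q"
  proof -
    have "(\<Sum>A\<le>j. ?T A) \<le> (\<Sum>A\<le>j. \<Sum>k\<le>A. real (M k) * real (M A) * (of_bool (agree_off k A x z) / M j))"
      by (intro sum_mono mult_left_mono a1) auto
    also have "\<dots> = M j * Q"
      unfolding Q_def sum_distrib_left using Mj by (intro sum.cong refl) (simp add: power2_eq_square)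
    finally show ?thesis .
  qed
  have RQ: "?R \<le> M j * Q"
  proof -
    have "?R = M j * (\<Sum>A\<in>{j}. \<Sum>k\<le>A. real (M k) * real (M A) / (real (M j))\<^sup>2 * of_bool (agree_off k A x z))"
      using Mj by (simp add: sum_distrib_left power2_eq_square)
    also have "\<dots> \<le> M j * Q" unfolding Q_def by (intro mult_left_mono sum_mono2 sum_nonneg) auto
    finally show ?thesis .
  qed
  have T2: "?T A \<le> ?R" if "A \<in> {j<..N0}" for A
  proof -
    have "?T A \<le> (\<Sum>k\<le>A. real (M k) * real (M A) * (of_bool (agree_off k j x z) * of_bool (k < j) / M A))"
      using that \<open>N0 \<le> N\<close> by (intro sum_mono mult_left_mono a2) auto
    also have "\<dots> = (\<Sum>k\<le>A. real (M k) * (of_bool (agree_off k j x z) * of_bool (k < j)))"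
      using M_pos[of A] by (intro sum.cong) auto
    also have "\<dots> = (\<Sum>k\<le>j. real (M k) * (of_bool (agree_off k j x z) * of_bool (k < j)))"
      using that by (intro sum.mono_neutral_right) auto
    also have "\<dots> \<le> ?R" by (intro sum_mono mult_left_mono) auto
    finally show ?thesis .
  qed
  have Q0: "0 \<le> Q" unfolding Q_def by (intro sum_nonneg) auto
  have S2: "(\<Sum>A\<in>{j<..N0}. ?T A) \<le> n * Q"
  proof -
    have "(\<Sum>A\<in>{j<..N0}. ?T A) \<le> of_nat (card {j<..N0}) * ?R" by (rule sum_bounded_above) (rule T2)
    also have "\<dots> = (N0 - j) * ?R" by simp
    also have "\<dots> \<le> (N0 - j) * (M j * Q)" by (intro mult_left_mono RQ) auto
    also have "\<dots> = real ((N0 - j) * M j) * Q" by simp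
    also have "\<dots> \<le> real n * Q"
    proof (intro mult_right_mono of_nat_mono Q0)
      \<comment> \<open>The number of levels beyond \<open>j\<close> is beaten by the growth of
        \<open>M\<close> from \<open>j\<close> to \<open>N0\<close>, so no logarithm appears
        here.\<close>
      have "N0 - j \<le> 2 ^ (N0 - j)" by (rule less_imp_le) (rule less_exp)
      then have "(N0 - j) * M j \<le> 2 ^ (N0 - j) * M j" by (rule mult_right_mono) simp
      also have "\<dots> \<le> M (j + (N0 - j))" by (rule pow2_le_M)
      also have "\<dots> \<le> n" using N0 \<open>j \<le> N0\<close> by simp
      finally show "(N0 - j) * M j \<le> n" .
    qed
    finally show ?thesis .
  qed
  have "avg m N (\<lambda>t. of_bool (\<forall>i<j. z i = t i) * norm (Fker m n (Vsub m x t)))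
      \<le> 3 * L\<^sup>2 * (\<Sum>A\<le>N0. ?T A)"
    unfolding a_def by (rule avg_kernel_bound[OF x N0(2)]) simp
  also have "(\<Sum>A\<le>N0. ?T A) = (\<Sum>A\<le>j. ?T A) + (\<Sum>A\<in>{j<..N0}. ?T A)"
    using \<open>j \<le> N0\<close> by (subst sum.union_disjoint[symmetric]) (auto intro: sum.cong)
  also have "\<dots> \<le> n * Q + n * Q"
  proof (rule add_mono[OF _ S2])
    have "M j * Q \<le> n * Q" using j Q0 by (intro mult_right_mono) auto
    then show "(\<Sum>A\<le>j. ?T A) \<le> n * Q" using S1 by simp
  qed
  finally have "avg m N (\<lambda>t. of_bool (\<forall>i<j. z i = t i) * norm (Fker m n (Vsub m x t)))
      \<le> 3 * L\<^sup>2 * (n * Q + n * Q)" by (simp add: mult_left_mono)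
  also have "\<dots> = n * (6 * L\<^sup>2 * Q)" by simp
  finally show ?thesis unfolding Q_def .
qed

end

section \<open>Fejer means of martingales as averages\<close>

locale vilenkin = vilenkin_seq +
  fixes \<mu> :: "(nat \<Rightarrow> nat) measure"
  assumes haar: "Vhaar m \<mu>"
begin

section \<open>Integrals of functions of finitely many coordinates\<close>

lemma space_mu: "space \<mu> = G" using haar by (simp add: Vhaar_def)

lemma prob_space_mu: "prob_space \<mu>"
  using haar by (intro prob_spaceI) (simp add: Vhaar_def)

sublocale prob_space \<mu> by (rule prob_space_mu)

lemma sets_Vcyl: "Vcyl m n x \<in> sets \<mu>"
  using haar Vcyl_sets_Vprod[of m n x] by (simp add: Vhaar_def sets_Vprod)

lemma measure_Vcyl: "z \<in> G \<Longrightarrow> measure \<mu> (Vcyl m n z) = 1 / M n"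
proof -
  assume z: "z \<in> G"
  have "ennreal (real (M n) * measure \<mu> (Vcyl m n z)) = ennreal 1"
    using emeasure_Vhaar_Vcyl[OF m_ge haar z, of n]
    by (simp add: emeasure_eq_measure ennreal_mult ennreal_of_nat_eq_real_of_nat)
  then have "real (M n) * measure \<mu> (Vcyl m n z) = 1"
    by (subst (asm) ennreal_inj) auto
  then show ?thesis using M_pos[of n] by (simp add: field_simps)
qed

lemma Z_Vcyl_iff: "x \<in> G \<Longrightarrow> z \<in> Zset m n \<Longrightarrow> x \<in> Vcyl m n z \<longleftrightarrow> z = trunc n x"
  by (auto simp: Zset_def Vcyl_def trunc_def fun_eq_iff)

lemma level_fun_trunc: "level_fun m n g \<Longrightarrow> x \<in> G \<Longrightarrow> g (trunc n x) = g x"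
  by (rule locD[OF _ Z_in_G[OF trunc_in_Z]]) (auto simp: trunc_def)

text \<open>Such a function is a finite combination of indicators of cylinders, each of measure
  \<open>1 / M n\<close>.\<close>

lemma has_integral_level_fun:
  fixes g :: "(nat \<Rightarrow> nat) \<Rightarrow> 'b::{banach, second_countable_topology, real_normed_field}"
  assumes "level_fun m n g"
  shows "has_bochner_integral \<mu> g (avg m n g)"
proof -
  have "has_bochner_integral \<mu> (\<lambda>x. \<Sum>z\<in>Zset m n. indicator (Vcyl m n z) x *\<^sub>R g z)
      (\<Sum>z\<in>Zset m n. measure \<mu> (Vcyl m n z) *\<^sub>R g z)"
    by (intro has_bochner_integral_sum has_bochner_integral_scaleR_left has_bochner_integral_real_indicator sets_Vcyl)
      (simp add: emeasure_eq_measure)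
  also have "(\<Sum>z\<in>Zset m n. measure \<mu> (Vcyl m n z) *\<^sub>R g z) = (\<Sum>z\<in>Zset m n. (1 / M n) *\<^sub>R g z)"
    by (intro sum.cong refl) (simp add: measure_Vcyl Z_in_G)
  also have "\<dots> = avg m n g"
    by (simp add: avg_def scaleR_conv_of_real sum_divide_distrib)
  finally show ?thesis
  proof (rule has_bochner_integral_cong[THEN iffD1, rotated -1])
    fix x assume "x \<in> space \<mu>"
    then have x: "x \<in> G" by (simp add: space_mu)
    have "(\<Sum>z\<in>Zset m n. indicator (Vcyl m n z) x *\<^sub>R g z) = (\<Sum>z\<in>Zset m n. if z = trunc n x then g z else 0)"
      by (intro sum.cong refl) (simp add: indicator_def Z_Vcyl_iff[OF x])
    also have "\<dots> = g x" using trunc_in_Z[OF x, of n] level_fun_trunc[OF assms x] by simp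
    finally show "(\<Sum>z\<in>Zset m n. indicator (Vcyl m n z) x *\<^sub>R g z) = g x" .
  qed auto
qed

lemma nn_integral_level_fun:
  assumes "level_fun m n g" "\<And>x. 0 \<le> g x"
  shows "(\<integral>\<^sup>+ x. ennreal (g x) \<partial>\<mu>) = ennreal (avg m n g)"
  using has_integral_level_fun[OF assms(1)] assms(2)
  by (subst nn_integral_eq_integral) (auto simp: has_bochner_integral_iff)

lemma borel_measurable_level_fun:
  fixes g :: "(nat \<Rightarrow> nat) \<Rightarrow> real"
  shows "level_fun m n g \<Longrightarrow> g \<in> borel_measurable \<mu>"
  using has_integral_level_fun by (auto simp: has_bochner_integral_iff)

section \<open>Fourier sums and Fejer means as averages\<close>

lemma fcoeff_eq:
  assumes "level_fun m n g" "n \<le> N" "k < M N"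
  shows "fcoeff m \<mu> g k = avg m N (\<lambda>t. g t * cnj (vpsi m k t))"
  unfolding fcoeff_def
  by (intro has_bochner_integral_integral_eq has_integral_level_fun level_fun_comp2[where F = "\<lambda>a b. a * cnj b"]
      level_fun_mono[OF assms(1,2)] level_fun_vpsi assms(3))

lemma fsum_eq:
  assumes "level_fun m n g" "n \<le> N" "K \<le> M N"
  shows "fsum m \<mu> K g x = avg m N (\<lambda>t. g t * Dker m K (Vsub m x t))"
proof -
  have "fsum m \<mu> K g x = (\<Sum>k<K. avg m N (\<lambda>t. g t * cnj (vpsi m k t)) * vpsi m k x)"
    unfolding fsum_def using fcoeff_eq[OF assms(1,2)] assms(3) by (intro sum.cong refl) auto
  also have "\<dots> = avg m N (\<lambda>t. \<Sum>k<K. g t * cnj (vpsi m k t) * vpsi m k x)"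
    by (simp only: avg_sum avg_multc)
  also have "\<dots> = avg m N (\<lambda>t. g t * Dker m K (Vsub m x t))"
    by (intro avg_cong) (simp add: Dker_def vpsi_Vsub Z_in_G sum_distrib_left mult_ac)
  finally show ?thesis .
qed

text \<open>The translated kernel is \<open>M n\<close> times the indicator of the cylinder of
  \<open>x\<close>, which contains a single representative.\<close>

lemma avg_Dker_M:
  assumes "level_fun m n g" "x \<in> G"
  shows "avg m n (\<lambda>t. g t * Dker m (M n) (Vsub m x t)) = g x"
proof -
  have "(\<Sum>t\<in>Zset m n. g t * Dker m (M n) (Vsub m x t)) = (\<Sum>t\<in>Zset m n. if t = trunc n x then g t * of_nat (M n) else 0)"
  proof (intro sum.cong refl)
    fix t assume t: "t \<in> Zset m n"
    have "(\<forall>j<n. Vsub m x t j = 0) \<longleftrightarrow> t = trunc n x"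
      using t Vsub_eq_0_iff[OF assms(2) Z_in_G[OF t]] by (auto simp: Zset_def trunc_def fun_eq_iff)
    then show "g t * Dker m (M n) (Vsub m x t) = (if t = trunc n x then g t * of_nat (M n) else 0)"
      by (simp add: Dker_M Vsub_in_G)
  qed
  also have "\<dots> = g x * of_nat (M n)"
    using trunc_in_Z[OF assms(2), of n] level_fun_trunc[OF assms] by simp
  finally show ?thesis using M_pos[of n] by (simp add: avg_def)
qed

lemma level_fun_step:
  fixes g :: "(nat \<Rightarrow> nat) \<Rightarrow> 'b::real_normed_field"
  assumes "level_fun m (Suc n) g"
  shows "level_fun m n (\<lambda>x. (\<Sum>c<m n. g (x(n := c))) / of_nat (m n))"
  unfolding level_fun_def
proof (intro ballI impI)
  fix x y assume xy: "x \<in> G" "y \<in> G" "\<forall>j<n. x j = y j"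
  have "g (x(n := c)) = g (y(n := c))" if "c < m n" for c
    by (rule locD[OF assms]) (use that xy in \<open>auto intro: fun_upd_in_G\<close>)
  then show "(\<Sum>c<m n. g (x(n := c))) / of_nat (m n) = (\<Sum>c<m n. g (y(n := c))) / of_nat (m n)"
    by simp
qed

lemma level_fun_cong: "(\<And>x. x \<in> G \<Longrightarrow> f x = g x) \<Longrightarrow> level_fun m n f \<longleftrightarrow> level_fun m n g"
  by (simp add: level_fun_def)

lemma level_fun_fsum: "K \<le> M n \<Longrightarrow> level_fun m n (fsum m \<mu> K g)"
proof -
  assume "K \<le> M n"
  then have "level_fun m n (\<lambda>x. \<Sum>k<K. fcoeff m \<mu> g k * vpsi m k x)"
    by (intro level_fun_sum level_fun_comp[where F = "\<lambda>a. _ * a"] level_fun_vpsi) auto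
  then show ?thesis unfolding fsum_def .
qed

text \<open>The kernel has level \<open>n\<close>, so coordinate \<open>n\<close> can be averaged
  out first; the kernel then reproduces the resulting function of level \<open>n\<close>.\<close>

lemma fsum_M_Suc:
  assumes "level_fun m (Suc n) g" "x \<in> G"
  shows "fsum m \<mu> (M n) g x = (\<Sum>c<m n. g (x(n := c))) / of_nat (m n)"
proof -
  have "fsum m \<mu> (M n) g x = avg m (Suc n) (\<lambda>t. g t * Dker m (M n) (Vsub m x t))"
    using assms(1) by (rule fsum_eq) (auto intro: M_mono simp del: Mseq.simps)
  also have "\<dots> = avg m n (\<lambda>t. (\<Sum>c<m n. g (t(n := c))) / of_nat (m n) * Dker m (M n) (Vsub m x t))"
    by (rule avg_Suc_mult) (intro level_fun_Vsub level_fun_Dker order_refl)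
  also have "\<dots> = (\<Sum>c<m n. g (x(n := c))) / of_nat (m n)"
    by (rule avg_Dker_M[OF level_fun_step[OF assms(1)] assms(2)])
  finally show ?thesis .
qed

lemma is_mart_step_mart:
  assumes "is_mart m \<mu> f"
  shows "step_mart m f"
proof -
  have eq: "fsum m \<mu> (M n) (f k) x = f n x" if "n \<le> k" "x \<in> G" for n k x
    using assms that by (auto simp: is_mart_def)
  have level_fun: "level_fun m n (f n)" for n
    using level_fun_fsum[of "M n" n "f n"] level_fun_cong[of "fsum m \<mu> (M n) (f n)" "f n" n] eq by auto
  show ?thesis
    unfolding step_mart_def using level_fun fsum_M_Suc[OF level_fun] eq[of _ "Suc _"] by simp
qed

lemma step_martD:
  assumes "step_mart m f"
  shows "level_fun m n (f n)" "x \<in> G \<Longrightarrow> (\<Sum>c<m n. f (Suc n) (x(n := c))) / of_nat (m n) = f n x"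
  using assms by (simp_all add: step_mart_def)

text \<open>The factor has level \<open>N\<close>, so averaging out the later coordinates one by one
  turns \<open>f k\<close> into \<open>f N\<close>.\<close>

lemma avg_mart:
  assumes "step_mart m f" "level_fun m N \<phi>" "N \<le> k"
  shows "avg m k (\<lambda>t. f k t * \<phi> t) = avg m N (\<lambda>t. f N t * \<phi> t)"
  using assms(3)
proof (induction k rule: dec_induct)
  case (step k)
  have "avg m (Suc k) (\<lambda>t. f (Suc k) t * \<phi> t)
      = avg m k (\<lambda>t. (\<Sum>c<m k. f (Suc k) (t(k := c))) / of_nat (m k) * \<phi> t)"
    by (rule avg_Suc_mult[OF level_fun_mono[OF assms(2)]]) (use step in simp)
  also have "\<dots> = avg m k (\<lambda>t. f k t * \<phi> t)"
    by (rule avg_cong) (simp add: step_martD(2)[OF assms(1)] Z_in_G)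
  finally show ?case using step by simp
qed simp

lemma mcoeff_eq:
  assumes "step_mart m f" "i < M N"
  shows "mcoeff m \<mu> f i = avg m N (\<lambda>t. f N t * cnj (vpsi m i t))"
proof -
  have "(LINT x|\<mu>. f k x * cnj (vpsi m i x)) = avg m N (\<lambda>t. f N t * cnj (vpsi m i t))" if "N \<le> k" for k
  proof -
    have level_fun: "level_fun m N (\<lambda>t. cnj (vpsi m i t))" by (intro level_fun_comp[where F = cnj] level_fun_vpsi assms)
    have "(LINT x|\<mu>. f k x * cnj (vpsi m i x)) = avg m k (\<lambda>t. f k t * cnj (vpsi m i t))"
      by (intro has_bochner_integral_integral_eq has_integral_level_fun level_fun_comp2[where F = "(*)"]
          step_martD assms level_fun_mono[OF level_fun that])
    also have "\<dots> = avg m N (\<lambda>t. f N t * cnj (vpsi m i t))" by (rule avg_mart[OF assms(1) level_fun that])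
    finally show ?thesis .
  qed
  \<comment> \<open>The sequence is constant from \<open>N\<close> on, so \<open>lim\<close> is a
    genuine limit and not a default value.\<close>
  then have "(\<lambda>k. LINT x|\<mu>. f k x * cnj (vpsi m i x)) \<longlonglongrightarrow> avg m N (\<lambda>t. f N t * cnj (vpsi m i t))"
    by (intro tendsto_eventually eventually_sequentiallyI)
  then show ?thesis unfolding mcoeff_def by (rule limI)
qed

lemma fejer_eq:
  assumes "step_mart m f" "n \<le> M N"
  shows "fejer m \<mu> n f x = avg m N (\<lambda>t. f N t * Fker m n (Vsub m x t)) / of_nat n"
proof -
  have msum: "msum m \<mu> k f x = avg m N (\<lambda>t. f N t * Dker m k (Vsub m x t))" if "k \<le> M N" for k
  proof -
    have "msum m \<mu> k f x = (\<Sum>i<k. avg m N (\<lambda>t. f N t * cnj (vpsi m i t)) * vpsi m i x)"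
      unfolding msum_def using mcoeff_eq[OF assms(1)] that by (intro sum.cong refl) auto
    also have "\<dots> = avg m N (\<lambda>t. \<Sum>i<k. f N t * cnj (vpsi m i t) * vpsi m i x)"
      by (simp only: avg_sum avg_multc)
    also have "\<dots> = avg m N (\<lambda>t. f N t * Dker m k (Vsub m x t))"
      by (intro avg_cong) (simp add: Dker_def vpsi_Vsub Z_in_G sum_distrib_left mult_ac)
    finally show ?thesis .
  qed
  have "(\<Sum>k=1..n. msum m \<mu> k f x) = (\<Sum>k=1..n. avg m N (\<lambda>t. f N t * Dker m k (Vsub m x t)))"
    by (intro sum.cong refl msum) (use assms(2) in auto)
  also have "\<dots> = avg m N (\<lambda>t. f N t * Fker m n (Vsub m x t))"
    by (simp only: avg_sum[symmetric] Fker_def sum_distrib_left)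
  finally show ?thesis by (simp add: fejer_def)
qed

end

section \<open>Stopped martingales\<close>

definition increment :: "vmart \<Rightarrow> vmart" where
  "increment f n x = (if n = 0 then f 0 x else f n x - f (n - 1) x)"

text \<open>The bound is imposed on the whole parent cylinder, which makes the condition predictable; as \<open>0 - 1 = 0\<close>,
  for \<open>i = 0\<close> the parent is the group itself.\<close>

definition active :: "(nat \<Rightarrow> nat) \<Rightarrow> vmart \<Rightarrow> real \<Rightarrow> nat \<Rightarrow> (nat \<Rightarrow> nat) \<Rightarrow> bool" where
  "active m f v n x \<longleftrightarrow> (\<forall>i\<le>n. \<forall>y\<in>Vgroup m. (\<forall>l<i - 1. y l = x l) \<longrightarrow> norm (f i y) \<le> v)"

text \<open>\<open>j\<close> is the last level at which \<open>x\<close> is active. This is decided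
  by the coordinates below \<open>j\<close>, so the points stopping at \<open>j\<close> form a union
  of cylinders of level \<open>j\<close>.\<close>

definition stops_at :: "(nat \<Rightarrow> nat) \<Rightarrow> vmart \<Rightarrow> real \<Rightarrow> nat \<Rightarrow> (nat \<Rightarrow> nat) \<Rightarrow> bool" where
  "stops_at m f v j x \<longleftrightarrow> active m f v j x \<and> \<not> active m f v (Suc j) x"

text \<open>The martingale transform by the predictable indicator; it is identically 0 if level 0 is
  already inactive.\<close>

definition stopped :: "(nat \<Rightarrow> nat) \<Rightarrow> vmart \<Rightarrow> real \<Rightarrow> vmart" where
  "stopped m f v n x = (\<Sum>i\<le>n. of_bool (active m f v i x) * increment f i x)"

lemma sum_increment: "(\<Sum>i\<le>n. increment f i x) = f n x"
  by (induction n) (auto simp: increment_def)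

lemma active_antimono: "active m f v j x \<Longrightarrow> i \<le> j \<Longrightarrow> active m f v i x"
  unfolding active_def by (meson order_trans)

lemma active_mono: "active m f v j x \<Longrightarrow> v \<le> v' \<Longrightarrow> active m f v' j x"
  unfolding active_def by (meson order_trans)

lemma active_cong:
  assumes "\<And>l. l < j - 1 \<Longrightarrow> x l = y l"
  shows "active m f v j x \<longleftrightarrow> active m f v j y"
proof -
  have "(\<forall>l<i - 1. u l = x l) \<longleftrightarrow> (\<forall>l<i - 1. u l = y l)" if "i \<le> j" for i u
  proof -
    have "l < j - 1" if "l < i - 1" for l using that \<open>i \<le> j\<close> by linarith
    then show ?thesis using assms by auto
  qed
  then show ?thesis unfolding active_def by blast
qed

lemma active_norm: "active m f v j x \<Longrightarrow> x \<in> Vgroup m \<Longrightarrow> norm (f j x) \<le> v"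
  unfolding active_def by blast

lemma active_0_cong: "active m f v 0 x \<longleftrightarrow> active m f v 0 y"
  by (rule active_cong) simp

lemma stops_at_cong: "(\<And>l. l < j \<Longrightarrow> x l = y l) \<Longrightarrow> stops_at m f v j x \<longleftrightarrow> stops_at m f v j y"
  unfolding stops_at_def using active_cong[of j x y] active_cong[of "Suc j" x y] by simp

lemma stops_at_unique: "stops_at m f v i x \<Longrightarrow> stops_at m f v j x \<Longrightarrow> i = j"
  unfolding stops_at_def by (metis active_antimono linorder_neqE_nat not_less_eq_eq not_less)

lemma stop_cases:
  assumes "active m f v 0 x" "\<not> active m f v n x"
  obtains j where "j < n" "stops_at m f v j x"
  using ex_least_nat_less[of "\<lambda>j. \<not> active m f v j x" n] assms unfolding stops_at_def by force

lemma stopped_active: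
  assumes "active m f v n x"
  shows "stopped m f v n x = f n x"
proof -
  have "stopped m f v n x = (\<Sum>i\<le>n. increment f i x)"
    unfolding stopped_def by (intro sum.cong refl) (use assms active_antimono in auto)
  then show ?thesis by (simp add: sum_increment)
qed

lemma stopped_stops_at:
  assumes "stops_at m f v j x" "j \<le> n"
  shows "stopped m f v n x = f j x"
proof -
  have *: "active m f v i x \<longleftrightarrow> i \<le> j" for i
    using assms(1) unfolding stops_at_def by (meson active_antimono not_less_eq_eq)
  have "stopped m f v n x = (\<Sum>i\<le>j. increment f i x)"
    unfolding stopped_def * by (intro sum.mono_neutral_cong_right) (use assms(2) in auto)
  then show ?thesis by (simp add: sum_increment)
qed

text \<open>Stopping happens before the bound is exceeded: the stopped value is 0 or a value of
  \<open>f\<close> at a level where \<open>x\<close> is still active.\<close>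

lemma norm_stopped_le:
  assumes "0 \<le> v" "x \<in> Vgroup m"
  shows "norm (stopped m f v n x) \<le> v"
proof (cases "active m f v 0 x")
  case False
  then have "\<not> active m f v i x" for i using active_antimono[of m f v i x 0] by auto
  then show ?thesis using assms(1) by (simp add: stopped_def)
next
  case True
  show ?thesis
  proof (cases "active m f v n x")
    case True
    then show ?thesis using stopped_active[OF True] active_norm[OF True assms(2)] by simp
  next
    case False
    then obtain j where j: "j < n" "stops_at m f v j x" using stop_cases[OF True False] by blast
    then show ?thesis using stopped_stops_at[OF j(2), of n] active_norm[of m f v j x] assms(2)
      by (simp add: stops_at_def)
  qed
qed

lemma sqrt_sum_le: "(\<And>i. i \<in> I \<Longrightarrow> 0 \<le> a i) \<Longrightarrow> sqrt (\<Sum>i\<in>I. a i) \<le> (\<Sum>i\<in>I. sqrt (a i))"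
proof (induction I rule: infinite_finite_induct)
  case (insert i I)
  have "sqrt (a i + sum a I) \<le> sqrt (a i) + sqrt (sum a I)"
    by (rule sqrt_add_le_add_sqrt) (use insert in \<open>auto intro: sum_nonneg\<close>)
  then show ?case using insert by fastforce
qed auto

context vilenkin
begin

section \<open>Mean zero pieces between two stopping levels\<close>

lemma level_fun_active: "level_fun m p (\<lambda>x. active m f v (Suc p) x)"
  unfolding level_fun_def by (intro ballI impI active_cong) simp

lemma level_fun_agree: "j \<le> p \<Longrightarrow> level_fun m p (\<lambda>x. \<forall>i<j. z i = x i)"
  unfolding level_fun_def by (metis order_less_le_trans)

text \<open>Averaging out coordinate \<open>p\<close> turns \<open>f (Suc p)\<close> into
  \<open>f p\<close>, so the two halves of the increment cancel.\<close>

lemma avg_increment_0: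
  assumes "step_mart m f" "level_fun m p \<phi>" "p < n"
  shows "avg m n (\<lambda>t. \<phi> t * increment f (Suc p) t) = 0"
proof -
  have l: "level_fun m (Suc p) (\<lambda>t. f (Suc p) t * \<phi> t)" "level_fun m (Suc p) (\<lambda>t. f p t * \<phi> t)"
    by (intro level_fun_comp2[where F = "(*)"] level_fun_mono[OF assms(2)] step_martD(1)[OF assms(1)]
        level_fun_mono[OF step_martD(1)[OF assms(1)]]; simp)+
  have "avg m n (\<lambda>t. \<phi> t * increment f (Suc p) t) = avg m n (\<lambda>t. f (Suc p) t * \<phi> t) - avg m n (\<lambda>t. f p t * \<phi> t)"
    by (simp add: avg_def increment_def algebra_simps sum_subtractf diff_divide_distrib)
  also have "avg m n (\<lambda>t. f (Suc p) t * \<phi> t) = avg m (Suc p) (\<lambda>t. f (Suc p) t * \<phi> t)"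
    by (rule avg_level_fun[OF l(1)]) (use assms(3) in simp)
  also have "\<dots> = avg m p (\<lambda>t. f p t * \<phi> t)"
    by (rule avg_mart[OF assms(1,2)]) simp
  also have "\<dots> = avg m (Suc p) (\<lambda>t. f p t * \<phi> t)"
    by (rule avg_level_fun_Suc[symmetric]) (intro level_fun_comp2[where F = "(*)"] assms(2) step_martD(1)[OF assms(1)])
  also have "\<dots> = avg m n (\<lambda>t. f p t * \<phi> t)"
    by (rule avg_level_fun[OF l(2), symmetric]) (use assms(3) in simp)
  finally show ?thesis by simp
qed

text \<open>On the cylinder of \<open>z\<close> the lower stopped martingale rests at
  \<open>f j\<close>. The upper one adds only increments beyond \<open>j\<close>, with coefficients
  known one coordinate earlier, and each of these averages to 0.\<close>

lemma avg_atom_0: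
  assumes f: "step_mart m f" and z: "stops_at m f v j z" and "v \<le> v'" "j \<le> n"
  shows "avg m n (\<lambda>t. of_bool (\<forall>i<j. z i = t i) * (stopped m f v' n t - stopped m f v n t)) = 0"
proof -
  have "avg m n (\<lambda>t. of_bool (\<forall>i<j. z i = t i) * (stopped m f v' n t - stopped m f v n t))
      = avg m n (\<lambda>t. \<Sum>p\<in>{j..<n}. of_bool ((\<forall>i<j. z i = t i) \<and> active m f v' (Suc p) t) * increment f (Suc p) t)"
  proof (rule avg_cong)
    fix t
    show "of_bool (\<forall>i<j. z i = t i) * (stopped m f v' n t - stopped m f v n t)
      = (\<Sum>p\<in>{j..<n}. of_bool ((\<forall>i<j. z i = t i) \<and> active m f v' (Suc p) t) * increment f (Suc p) t)"
    proof (cases "\<forall>i<j. z i = t i")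
      case True
      then have st: "stops_at m f v j t" using z stops_at_cong[of j z t] by auto
      then have "active m f v' j t" using assms(3) active_mono by (auto simp: stops_at_def)
      then have "(\<Sum>i\<le>j. of_bool (active m f v' i t) * increment f i t) = (\<Sum>i\<le>j. increment f i t)"
        by (intro sum.cong refl) (use active_antimono in auto)
      then have 1: "(\<Sum>i\<le>j. of_bool (active m f v' i t) * increment f i t) = f j t" by (simp add: sum_increment)
      have "stopped m f v' n t = f j t + (\<Sum>i\<in>{j<..n}. of_bool (active m f v' i t) * increment f i t)"
        unfolding stopped_def 1[symmetric] using assms(4)
        by (subst sum.union_disjoint[symmetric]) (auto intro: sum.cong)
      also have "(\<Sum>i\<in>{j<..n}. of_bool (active m f v' i t) * increment f i t)
          = (\<Sum>p\<in>{j..<n}. of_bool (active m f v' (Suc p) t) * increment f (Suc p) t)"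
        by (rule sum.reindex_bij_witness[where i = Suc and j = "\<lambda>i. i - 1"]) auto
      finally show ?thesis using True stopped_stops_at[OF st assms(4)] by simp
    next
      case False
      then have "(\<forall>i<j. z i = t i) \<longleftrightarrow> False" by blast
      then show ?thesis by (simp only: simp_thms of_bool_eq mult_zero_left sum.neutral_const)
    qed
  qed
  also have "\<dots> = (\<Sum>p\<in>{j..<n}. avg m n (\<lambda>t. of_bool ((\<forall>i<j. z i = t i) \<and> active m f v' (Suc p) t) * increment f (Suc p) t))"
    by (rule avg_sum)
  also have "\<dots> = 0"
  proof (intro sum.neutral ballI avg_increment_0[OF f])
    fix p assume p: "p \<in> {j..<n}"
    then show "level_fun m p (\<lambda>t. of_bool ((\<forall>i<j. z i = t i) \<and> active m f v' (Suc p) t))"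
      by (intro level_fun_comp2[where F = "\<lambda>a b. of_bool (a \<and> b)"] level_fun_agree level_fun_active) auto
    show "p < n" using p by simp
  qed
  finally show ?thesis .
qed

text \<open>\<open>n\<close> times the Fejer mean of order \<open>n\<close> when \<open>g\<close> is
  the martingale at level \<open>n\<close>; this level is deep enough since
  \<open>n \<le> M n\<close>.\<close>

definition kernel_op :: "nat \<Rightarrow> ((nat \<Rightarrow> nat) \<Rightarrow> complex) \<Rightarrow> (nat \<Rightarrow> nat) \<Rightarrow> complex" where
  "kernel_op n g x = avg m n (\<lambda>t. g t * Fker m n (Vsub m x t))"

lemma le_M: "n \<le> M n" using Mseq_ge[of m n, OF m_ge] by simp

lemma norm_kernel_op_le:
  assumes "x \<in> G" "1 \<le> n" "\<And>t. t \<in> G \<Longrightarrow> norm (g t) \<le> c"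
  shows "norm (kernel_op n g x) \<le> c * (12 * real L ^ 3 * n)"
proof -
  have "0 \<le> c" using assms(3)[OF assms(1)] norm_ge_zero order_trans by blast
  have "norm (kernel_op n g x) \<le> avg m n (\<lambda>t. norm (g t * Fker m n (Vsub m x t)))"
    unfolding kernel_op_def by (rule norm_avg_le)
  also have "\<dots> \<le> avg m n (\<lambda>t. c * norm (Fker m n (Vsub m x t)))"
    by (rule avg_mono) (auto simp: norm_mult intro!: mult_right_mono assms(3) Z_in_G)
  also have "\<dots> \<le> c * (12 * real L ^ 3 * n)"
    unfolding avg_cmult by (intro mult_left_mono avg_kernel_L1 assms le_M \<open>0 \<le> c\<close>)
  finally show ?thesis .
qed

definition stop_points :: "vmart \<Rightarrow> real \<Rightarrow> nat \<Rightarrow> (nat \<Rightarrow> nat) set" where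
  "stop_points f v j = {z \<in> Zset m j. stops_at m f v j z}"

lemma finite_stop_points [simp]: "finite (stop_points f v j)" by (simp add: stop_points_def)

lemma agree_Z_iff: "z \<in> Zset m j \<Longrightarrow> (\<forall>i<j. z i = t i) \<longleftrightarrow> z = trunc j t"
  by (auto simp: Zset_def trunc_def fun_eq_iff)

lemma sum_stop_points:
  assumes "t \<in> G"
  shows "(\<Sum>z\<in>stop_points f v j. of_bool (\<forall>i<j. z i = t i)) = (of_bool (stops_at m f v j t) :: 'a::semiring_1)"
proof -
  have st: "stops_at m f v j (trunc j t) \<longleftrightarrow> stops_at m f v j t" by (rule stops_at_cong) (simp add: trunc_def)
  have "(\<Sum>z\<in>stop_points f v j. of_bool (\<forall>i<j. z i = t i)) = (\<Sum>z\<in>stop_points f v j. if z = trunc j t then 1 else (0::'a))"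
    by (intro sum.cong refl) (auto simp: stop_points_def agree_Z_iff)
  also have "\<dots> = of_bool (trunc j t \<in> stop_points f v j)" by simp
  finally show ?thesis using st trunc_in_Z[OF assms] by (simp add: stop_points_def)
qed

text \<open>The difference of the stopped martingales lives on stopping cylinders, while
  \<open>x\<close> never stops. So only off-cylinder kernel estimates enter, applied to pieces of
  size at most 4 \<open>v\<close> + \<open>v\<close> = 5 \<open>v\<close>.\<close>

lemma kernel_op_atoms:
  assumes f: "step_mart m f" and x: "x \<in> G" "active m f v n x"
    and active0: "\<And>j. active m f v j x" and l: "0 < v" "v' = 4 * v" and n: "1 \<le> n"
  shows "norm (kernel_op n (\<lambda>t. stopped m f v' n t - stopped m f v n t) x)
    \<le> (\<Sum>j<n. \<Sum>z\<in>stop_points f v j. of_bool (M j < n) * (5 * v * (n * (6 * L\<^sup>2 *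
        (\<Sum>A\<le>j. \<Sum>k\<le>A. real (M k) * real (M A) / (real (M j))\<^sup>2 * of_bool (agree_off k A x z))))))"
proof -
  let ?b = "\<lambda>t. stopped m f v' n t - stopped m f v n t"
  have b_norm: "norm (?b t) \<le> 5 * v" if "t \<in> G" for t
    using norm_triangle_ineq4[of "stopped m f v' n t" "stopped m f v n t"]
      norm_stopped_le[of v' t m f n] norm_stopped_le[of v t m f n] that l by auto
  have b_dec: "?b t = (\<Sum>j<n. \<Sum>z\<in>stop_points f v j. of_bool (\<forall>i<j. z i = t i) * ?b t)" if t: "t \<in> G" for t
  proof -
    have "(\<Sum>j<n. \<Sum>z\<in>stop_points f v j. of_bool (\<forall>i<j. z i = t i) * ?b t) = (\<Sum>j<n. of_bool (stops_at m f v j t)) * ?b t"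
      by (simp only: sum_stop_points[OF t] sum_distrib_right[symmetric])
    also have "\<dots> = ?b t"
    proof (cases "active m f v n t")
      \<comment> \<open>Without stopping up to \<open>n\<close>, both stopped martingales equal
        \<open>f n\<close> and the difference vanishes.\<close>
      case True
      moreover have "active m f v' n t" using True l by (auto intro: active_mono)
      ultimately show ?thesis by (simp add: stopped_active)
    next
      case False
      have "active m f v 0 t" using active0[of 0] active_0_cong by blast
      then obtain j where j: "j < n" "stops_at m f v j t" using stop_cases False by blast
      then have "(\<Sum>j<n. of_bool (stops_at m f v j t)) = (\<Sum>i<n. if i = j then 1 else (0::complex))"
        by (intro sum.cong refl) (auto dest: stops_at_unique)
      then show ?thesis using j(1) by simp
    qed
    finally show ?thesis ..
  qed
  have "kernel_op n ?b x = avg m n (\<lambda>t. \<Sum>j<n. \<Sum>z\<in>stop_points f v j. of_bool (\<forall>i<j. z i = t i) * ?b t * Fker m n (Vsub m x t))"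
    unfolding kernel_op_def
  proof (rule avg_cong)
    fix t assume t: "t \<in> Zset m n"
    have "?b t * Fker m n (Vsub m x t)
        = (\<Sum>j<n. \<Sum>z\<in>stop_points f v j. of_bool (\<forall>i<j. z i = t i) * ?b t) * Fker m n (Vsub m x t)"
      by (rule arg_cong[where f = "\<lambda>u. u * Fker m n (Vsub m x t)", OF b_dec[OF Z_in_G[OF t]]])
    then show "?b t * Fker m n (Vsub m x t)
        = (\<Sum>j<n. \<Sum>z\<in>stop_points f v j. of_bool (\<forall>i<j. z i = t i) * ?b t * Fker m n (Vsub m x t))"
      by (simp only: sum_distrib_right)
  qed
  also have "\<dots> = (\<Sum>j<n. \<Sum>z\<in>stop_points f v j. avg m n (\<lambda>t. of_bool (\<forall>i<j. z i = t i) * ?b t * Fker m n (Vsub m x t)))"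
    by (simp only: avg_sum)
  finally have "norm (kernel_op n ?b x)
      \<le> (\<Sum>j<n. \<Sum>z\<in>stop_points f v j. norm (avg m n (\<lambda>t. of_bool (\<forall>i<j. z i = t i) * ?b t * Fker m n (Vsub m x t))))"
    by (simp only:) (intro order_trans[OF norm_sum] sum_mono order_refl)
  also have "\<dots> \<le> (\<Sum>j<n. \<Sum>z\<in>stop_points f v j. of_bool (M j < n) * (5 * v * (n * (6 * L\<^sup>2 *
        (\<Sum>A\<le>j. \<Sum>k\<le>A. real (M k) * real (M A) / (real (M j))\<^sup>2 * of_bool (agree_off k A x z))))))"
  proof (intro sum_mono)
    fix j z assume j: "j \<in> {..<n}" and "z \<in> stop_points f v j"
    then have z: "z \<in> Zset m j" "stops_at m f v j z" by (auto simp: stop_points_def)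
    show "norm (avg m n (\<lambda>t. of_bool (\<forall>i<j. z i = t i) * ?b t * Fker m n (Vsub m x t)))
      \<le> of_bool (M j < n) * (5 * v * (n * (6 * L\<^sup>2 *
        (\<Sum>A\<le>j. \<Sum>k\<le>A. real (M k) * real (M A) / (real (M j))\<^sup>2 * of_bool (agree_off k A x z)))))"
    proof (cases "M j < n")
      \<comment> \<open>For \<open>n \<le> M j\<close> the kernel is constant on the cylinder of
        \<open>z\<close>, so the mean zero piece annihilates it.\<close>
      case False
      then have F: "level_fun m j (\<lambda>t. Fker m n (Vsub m x t))" by (intro level_fun_Vsub level_fun_Fker) simp
      have "avg m n (\<lambda>t. of_bool (\<forall>i<j. z i = t i) * ?b t * Fker m n (Vsub m x t))
          = avg m n (\<lambda>t. of_bool (\<forall>i<j. z i = t i) * ?b t * Fker m n (Vsub m x z))"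
      proof (rule avg_cong)
        fix t assume "t \<in> Zset m n"
        then have "Fker m n (Vsub m x t) = Fker m n (Vsub m x z)" if "\<forall>i<j. z i = t i"
          using that z by (intro locD[OF F]) (auto simp: Z_in_G)
        then show "of_bool (\<forall>i<j. z i = t i) * ?b t * Fker m n (Vsub m x t)
            = of_bool (\<forall>i<j. z i = t i) * ?b t * Fker m n (Vsub m x z)" by auto
      qed
      also have "\<dots> = 0"
        unfolding avg_multc using avg_atom_0[OF f z(2), of v' n] l j by simp
      finally show ?thesis using False by simp
    next
      case True
      \<comment> \<open>Otherwise \<open>x\<close> would stop at \<open>j\<close> together with
        \<open>z\<close>.\<close>
      have far: "\<not> (\<forall>i<j. x i = z i)"
      proof
        assume "\<forall>i<j. x i = z i"
        then have "active m f v (Suc j) x \<longleftrightarrow> active m f v (Suc j) z" by (intro active_cong) simp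
        then show False using active0[of "Suc j"] z(2) by (simp add: stops_at_def)
      qed
      have "norm (avg m n (\<lambda>t. of_bool (\<forall>i<j. z i = t i) * ?b t * Fker m n (Vsub m x t)))
          \<le> avg m n (\<lambda>t. norm (of_bool (\<forall>i<j. z i = t i) * ?b t * Fker m n (Vsub m x t)))"
        by (rule norm_avg_le)
      also have "\<dots> \<le> avg m n (\<lambda>t. 5 * v * (of_bool (\<forall>i<j. z i = t i) * norm (Fker m n (Vsub m x t))))"
        by (rule avg_mono) (auto simp: norm_mult intro!: mult_right_mono b_norm Z_in_G)
      also have "\<dots> \<le> 5 * v * (n * (6 * L\<^sup>2 *
        (\<Sum>A\<le>j. \<Sum>k\<le>A. real (M k) * real (M A) / (real (M j))\<^sup>2 * of_bool (agree_off k A x z))))"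
        unfolding avg_cmult
        by (intro mult_left_mono avg_kernel_atom x Z_in_G[OF z(1)] True le_M far) (use l j in auto)
      finally show ?thesis using True by simp
    qed
  qed
  finally show ?thesis .
qed

end

section \<open>The pointwise estimate\<close>

lemma epow_mono: "a \<le> b \<Longrightarrow> 0 \<le> p \<Longrightarrow> epow a p \<le> epow b p"
  unfolding epow_def by (auto simp: top_unique less_top intro!: ennreal_leI powr_mono2 enn2real_mono)

lemma epow_half_square: "epow (B * B) (1/2) = B"
proof (cases B)
  case (real r)
  then have "enn2real (B * B) = r * r" by (simp add: ennreal_mult[symmetric])
  moreover have "B * B \<noteq> \<infinity>" using real by (simp add: ennreal_mult[symmetric])
  ultimately show ?thesis using real by (simp add: epow_def powr_half_sqrt)
qed (simp add: epow_def ennreal_top_mult)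

lemma epow_2: "epow B 2 = B * B"
proof (cases B)
  case (real r)
  then show ?thesis by (cases "r = 0") (auto simp: epow_def ennreal_mult[symmetric] powr_numeral power2_eq_square)
qed (simp add: epow_def ennreal_top_mult)

lemma epow_half_ennreal: "0 \<le> r \<Longrightarrow> epow (ennreal r) (1/2) = ennreal (sqrt r)"
  by (simp add: epow_def powr_half_sqrt)

text \<open>Comparison with \<open>B * B\<close> takes the root out of the supremum.\<close>

lemma epow_half_SUP_le:
  assumes "\<And>n. n \<in> I \<Longrightarrow> 0 \<le> v n" "\<And>n. n \<in> I \<Longrightarrow> ennreal (sqrt (v n)) \<le> B"
  shows "epow (SUP n\<in>I. ennreal (v n)) (1/2) \<le> B"
proof -
  have "(SUP n\<in>I. ennreal (v n)) \<le> B * B"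
  proof (rule SUP_least)
    fix n assume n: "n \<in> I"
    have "ennreal (v n) = ennreal (sqrt (v n)) * ennreal (sqrt (v n))"
      using assms(1)[OF n] by (simp add: ennreal_mult[symmetric])
    also have "\<dots> \<le> B * B" by (intro mult_mono assms(2)[OF n]) auto
    finally show "ennreal (v n) \<le> B * B" .
  qed
  then have "epow (SUP n\<in>I. ennreal (v n)) (1/2) \<le> epow (B * B) (1/2)" by (intro epow_mono) auto
  then show ?thesis by (simp only: epow_half_square)
qed

text \<open>The largest dyadic number below \<open>s\<close> dominates: the geometric series up to
  it is less than twice that number.\<close>

lemma sum_dyadic_le:
  assumes "0 < \<epsilon>" "0 \<le> s"
  shows "(\<Sum>i<n. \<epsilon> * 2 ^ i * of_bool (\<epsilon> * 2 ^ i < s)) \<le> 2 * (s::real)"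
proof (induction n)
  case (Suc n)
  show ?case
  proof (cases "\<epsilon> * 2 ^ n < s")
    case True
    have "(\<Sum>i<Suc n. \<epsilon> * 2 ^ i * of_bool (\<epsilon> * 2 ^ i < s)) \<le> (\<Sum>i<Suc n. \<epsilon> * 2 ^ i)"
      by (intro sum_mono) (use assms in auto)
    also have "\<dots> = \<epsilon> * (2 ^ Suc n - 1)"
      by (simp only: sum_distrib_left[symmetric] sum_gp_strict) simp
    also have "\<dots> \<le> 2 * (\<epsilon> * 2 ^ n)" using assms by (simp add: algebra_simps)
    finally show ?thesis using True by simp
  qed (use Suc in simp)
qed (use assms in simp)

context vilenkin
begin

lemma sets_level_fun: "level_fun m n P \<Longrightarrow> {x \<in> G. P x} \<in> sets \<mu>"
proof -
  assume "level_fun m n P"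
  then have "(\<lambda>x. of_bool (P x) :: real) \<in> borel_measurable \<mu>"
    by (intro borel_measurable_level_fun level_fun_comp[where F = of_bool])
  then have "{x \<in> space \<mu>. of_bool (P x) = (1::real)} \<in> sets \<mu>" by measurable
  then show ?thesis by (simp add: space_mu)
qed

lemma emeasure_level_fun: "level_fun m n P \<Longrightarrow> emeasure \<mu> {x \<in> G. P x} = ennreal (avg m n (\<lambda>x. of_bool (P x)))"
proof -
  assume l: "level_fun m n P"
  have "emeasure \<mu> {x \<in> G. P x} = (\<integral>\<^sup>+ x. indicator {x \<in> G. P x} x \<partial>\<mu>)"
    using sets_level_fun[OF l] by simp
  also have "\<dots> = (\<integral>\<^sup>+ x. ennreal (of_bool (P x)) \<partial>\<mu>)"
    by (intro nn_integral_cong) (simp add: space_mu indicator_def)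
  also have "\<dots> = ennreal (avg m n (\<lambda>x. of_bool (P x)))"
    by (intro nn_integral_level_fun level_fun_comp[where F = of_bool] l) simp
  finally show ?thesis .
qed

text \<open>The termwise square root of the bound in \<open>avg_kernel_atom\<close>, divided by
  \<open>j + 1\<close>. The logarithm pays for this division, and it makes the integral of order
  \<open>1 / M j\<close>.\<close>

definition atom_weight :: "nat \<Rightarrow> (nat \<Rightarrow> nat) \<Rightarrow> (nat \<Rightarrow> nat) \<Rightarrow> real" where
  "atom_weight j x z = (\<Sum>A\<le>j. \<Sum>k\<le>A. sqrt (M k) * sqrt (M A) / ((real j + 1) * M j) * of_bool (agree_off k A x z))"

lemma atom_weight_nonneg: "0 \<le> atom_weight j x z"
  unfolding atom_weight_def by (intro sum_nonneg) auto

lemma ln_M_le: "M j < n \<Longrightarrow> real j + 1 \<le> 4 * ln (real n + 1)"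
proof -
  assume "M j < n"
  moreover have "2 ^ j \<le> M j" using pow2_le_M[of j 0] by simp
  ultimately have "2 ^ j \<le> n" by linarith
  then have "real (2 ^ j) \<le> real n" by (rule of_nat_mono)
  then have j: "2 ^ j \<le> real n" by simp
  moreover have "1 \<le> (2::real) ^ j" by simp
  ultimately have "1 \<le> real n" by linarith
  \<comment> \<open>Squaring \<open>n + 1\<close> makes room for one more factor 2, so the bound
    reaches \<open>j + 1\<close> and not only \<open>j\<close>.\<close>
  have "2 ^ Suc j \<le> (real n + 1) * (real n + 1)"
    using mult_mono[OF j, of 2 "real n + 1"] \<open>1 \<le> real n\<close> by (simp add: algebra_simps)
  then have "ln (2 ^ Suc j) \<le> ln ((real n + 1) * (real n + 1))" by (subst ln_le_cancel_iff) auto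
  then have "(real j + 1) * ln 2 \<le> 2 * ln (real n + 1)"
    by (simp only: ln_mult ln_realpow) (simp add: ln_mult ln_realpow algebra_simps)
  moreover have "(real j + 1) * (1/2) \<le> (real j + 1) * ln 2"
    using ln2_ge_two_thirds by (intro mult_left_mono) auto
  ultimately have "(real j + 1) * (1/2) \<le> 2 * ln (real n + 1)" by (rule order_trans[rotated])
  then show ?thesis by (simp add: field_simps)
qed

lemma ln_ge_half: "1 \<le> n \<Longrightarrow> 1/2 \<le> ln (real n + 1)"
proof -
  assume "1 \<le> n"
  then have "ln 2 \<le> ln (real n + 1)" by (subst ln_le_cancel_iff) auto
  then show ?thesis using ln2_ge_two_thirds by linarith
qed

text \<open>The root is subadditive, so it passes inside all the sums. The condition
  \<open>M j < n\<close> gives \<open>ln_M_le\<close>, which supplies the divisor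
  \<open>j + 1\<close> of \<open>atom_weight\<close> at the cost of a factor 4: 24 = 6 * 4.\<close>

lemma kernel_op_atoms_sqrt:
  assumes f: "step_mart m f" and x: "x \<in> G" and active0: "\<And>j. active m f v j x" and l: "0 < v" and n: "1 \<le> n"
  shows "sqrt (norm (kernel_op n (\<lambda>t. stopped m f (4 * v) n t - stopped m f v n t) x) / n) / ln (real n + 1)
    \<le> 24 * L * sqrt v * (\<Sum>j<n. \<Sum>z\<in>stop_points f v j. atom_weight j x z)"
proof -
  let ?q = "\<lambda>j z. \<Sum>A\<le>j. \<Sum>k\<le>A. real (M k) * real (M A) / (real (M j))\<^sup>2 * of_bool (agree_off k A x z)"
  let ?N = "norm (kernel_op n (\<lambda>t. stopped m f (4 * v) n t - stopped m f v n t) x)"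
  have ln0: "0 < ln (real n + 1)" using ln_ge_half[OF n] by linarith
  have "?N \<le> (\<Sum>j<n. \<Sum>z\<in>stop_points f v j. of_bool (M j < n) * (5 * v * (n * (6 * L\<^sup>2 * ?q j z))))"
    by (rule kernel_op_atoms[OF f x active0 active0 l refl n])
  also have "\<dots> = n * ((30 * v * L\<^sup>2) * (\<Sum>j<n. \<Sum>z\<in>stop_points f v j. of_bool (M j < n) * ?q j z))"
    by (simp add: sum_distrib_left mult_ac)
  finally have "?N / n \<le> (30 * v * L\<^sup>2) * (\<Sum>j<n. \<Sum>z\<in>stop_points f v j. of_bool (M j < n) * ?q j z)"
    using n by (simp add: divide_le_eq mult.commute)
  \<comment> \<open>30 is raised to the square 36, whose root is 6.\<close>
  also have "\<dots> \<le> (36 * v * L\<^sup>2) * (\<Sum>j<n. \<Sum>z\<in>stop_points f v j. of_bool (M j < n) * ?q j z)"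
    using l by (intro mult_right_mono sum_nonneg mult_nonneg_nonneg) auto
  finally have "sqrt (?N / n) \<le> sqrt ((36 * v * L\<^sup>2) * (\<Sum>j<n. \<Sum>z\<in>stop_points f v j. of_bool (M j < n) * ?q j z))"
    by (rule real_sqrt_le_mono)
  also have "\<dots> = 6 * L * sqrt v * sqrt (\<Sum>j<n. \<Sum>z\<in>stop_points f v j. of_bool (M j < n) * ?q j z)"
    by (simp add: real_sqrt_mult)
  also have "sqrt (\<Sum>j<n. \<Sum>z\<in>stop_points f v j. of_bool (M j < n) * ?q j z)
      \<le> (\<Sum>j<n. \<Sum>z\<in>stop_points f v j. of_bool (M j < n) * (\<Sum>A\<le>j. \<Sum>k\<le>A. sqrt (M k) * sqrt (M A) / M j * of_bool (agree_off k A x z)))"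
  proof -
    have qn: "0 \<le> ?q j z" for j z by (intro sum_nonneg) auto
    have q: "sqrt (of_bool (M j < n) * ?q j z)
        \<le> of_bool (M j < n) * (\<Sum>A\<le>j. \<Sum>k\<le>A. sqrt (M k) * sqrt (M A) / M j * of_bool (agree_off k A x z))" for j z
    proof -
      have "sqrt (?q j z) \<le> (\<Sum>A\<le>j. sqrt (\<Sum>k\<le>A. real (M k) * real (M A) / (real (M j))\<^sup>2 * of_bool (agree_off k A x z)))"
        by (intro sqrt_sum_le sum_nonneg) auto
      also have "\<dots> \<le> (\<Sum>A\<le>j. \<Sum>k\<le>A. sqrt (real (M k) * real (M A) / (real (M j))\<^sup>2 * of_bool (agree_off k A x z)))"
        by (intro sum_mono sqrt_sum_le) auto
      also have "\<dots> = (\<Sum>A\<le>j. \<Sum>k\<le>A. sqrt (M k) * sqrt (M A) / M j * of_bool (agree_off k A x z))"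
        by (intro sum.cong refl) (simp add: real_sqrt_mult real_sqrt_divide)
      finally show ?thesis by simp
    qed
    show ?thesis
      by (intro order_trans[OF sqrt_sum_le] sum_mono order_trans[OF q order_refl] sum_nonneg mult_nonneg_nonneg qn) auto
  qed
  finally have *: "sqrt (?N / n) \<le> 6 * L * sqrt v *
      (\<Sum>j<n. \<Sum>z\<in>stop_points f v j. of_bool (M j < n) * (\<Sum>A\<le>j. \<Sum>k\<le>A. sqrt (M k) * sqrt (M A) / M j * of_bool (agree_off k A x z)))"
    using l by (simp add: mult_left_mono)
  also have "\<dots> \<le> 6 * L * sqrt v * (\<Sum>j<n. \<Sum>z\<in>stop_points f v j. 4 * ln (real n + 1) * atom_weight j x z)"
  proof (intro mult_left_mono sum_mono)
    fix j z
    have "of_bool (M j < n) \<le> 4 * ln (real n + 1) / (real j + 1)"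
      using ln_M_le[of j n] ln0 by auto
    then have "of_bool (M j < n) * (\<Sum>A\<le>j. \<Sum>k\<le>A. sqrt (M k) * sqrt (M A) / M j * of_bool (agree_off k A x z))
        \<le> 4 * ln (real n + 1) / (real j + 1) * (\<Sum>A\<le>j. \<Sum>k\<le>A. sqrt (M k) * sqrt (M A) / M j * of_bool (agree_off k A x z))"
      by (intro mult_right_mono sum_nonneg) auto
    also have "\<dots> = 4 * ln (real n + 1) * atom_weight j x z"
      by (simp add: atom_weight_def sum_distrib_left divide_simps)
    finally show "of_bool (M j < n) * (\<Sum>A\<le>j. \<Sum>k\<le>A. sqrt (M k) * sqrt (M A) / M j * of_bool (agree_off k A x z))
        \<le> 4 * ln (real n + 1) * atom_weight j x z" .
  qed (use l in auto)
  also have "\<dots> = 24 * L * sqrt v * (\<Sum>j<n. \<Sum>z\<in>stop_points f v j. atom_weight j x z) * ln (real n + 1)"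
    by (simp add: sum_distrib_left sum_distrib_right mult_ac)
  finally show ?thesis using ln0 by (simp add: divide_le_eq)
qed

lemma kernel_op_bounded_sqrt:
  assumes x: "x \<in> G" and n: "1 \<le> n" and g: "\<And>t. t \<in> G \<Longrightarrow> norm (g t) \<le> 5 * v" and "0 \<le> v"
  shows "sqrt (norm (kernel_op n g x) / n) / ln (real n + 1) \<le> 24 * real L ^ 2 * sqrt v"
proof -
  have "norm (kernel_op n g x) / n \<le> 5 * v * (12 * real L ^ 3)"
    using norm_kernel_op_le[OF x n g] n by (simp add: divide_le_eq mult_ac)
  also have "\<dots> = 60 * v * real L ^ 3" by simp
  \<comment> \<open>Rounded up to a perfect square with root 12; the lower bound 1/2 for the
    logarithm then doubles 12 to 24.\<close>
  also have "\<dots> \<le> 144 * v * real L ^ 4"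
  proof -
    have "real L ^ 3 \<le> real L ^ 4" using L_ge by (intro power_increasing) auto
    then show ?thesis using \<open>0 \<le> v\<close> by (intro mult_mono) auto
  qed
  also have "\<dots> = (12 * real L ^ 2)\<^sup>2 * v" by (simp add: power_mult_distrib flip: power_mult)
  finally have "sqrt (norm (kernel_op n g x) / n) \<le> sqrt ((12 * real L ^ 2)\<^sup>2 * v)" by (rule real_sqrt_le_mono)
  also have "\<dots> = 12 * real L ^ 2 * sqrt v" by (simp only: real_sqrt_mult real_sqrt_abs) simp
  also have "\<dots> \<le> 24 * real L ^ 2 * sqrt v * ln (real n + 1)"
  proof -
    have "(24 * real L ^ 2 * sqrt v) * (1/2) \<le> (24 * real L ^ 2 * sqrt v) * ln (real n + 1)"
      using ln_ge_half[OF n] \<open>0 \<le> v\<close> by (intro mult_left_mono) auto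
    then show ?thesis by simp
  qed
  finally have le: "sqrt (norm (kernel_op n g x) / n) \<le> 24 * real L ^ 2 * sqrt v * ln (real n + 1)" .
  have ln0: "0 < ln (real n + 1)" using ln_ge_half[OF n] by linarith
  from le show ?thesis unfolding pos_divide_le_eq[OF ln0] .
qed

text \<open>One majorant for both kinds of points: at least 1 wherever activity ends, and elsewhere
  at least the total weight of the stopping cylinders. The first summand covers failure at level 0,
  when there is no stopping cylinder at all.\<close>

definition stop_weight :: "vmart \<Rightarrow> real \<Rightarrow> (nat \<Rightarrow> nat) \<Rightarrow> ennreal" where
  "stop_weight f v x = of_bool (\<not> active m f v 0 (\<lambda>_. 0)) +
     (\<Sum>j. ennreal (\<Sum>z\<in>stop_points f v j. of_bool (\<forall>i<j. z i = x i) + atom_weight j x z))"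

lemma one_le_stop_weight:
  assumes "x \<in> G" "\<not> active m f v n x"
  shows "1 \<le> stop_weight f v x"
proof (cases "active m f v 0 x")
  case False
  then show ?thesis using active_0_cong[of m f v x "\<lambda>_. 0"] by (simp add: stop_weight_def)
next
  case True
  then obtain j where j: "stops_at m f v j x" using stop_cases assms(2) by blast
  let ?h = "\<lambda>j. ennreal (\<Sum>z\<in>stop_points f v j. of_bool (\<forall>i<j. z i = x i) + atom_weight j x z)"
  have "(\<Sum>z\<in>stop_points f v j. of_bool (\<forall>i<j. z i = x i)) \<le> (\<Sum>z\<in>stop_points f v j. of_bool (\<forall>i<j. z i = x i) + atom_weight j x z)"
    by (intro sum_mono) (simp add: atom_weight_nonneg)
  then have "1 \<le> (\<Sum>z\<in>stop_points f v j. of_bool (\<forall>i<j. z i = x i) + atom_weight j x z)"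
    unfolding sum_stop_points[OF assms(1)] using j by simp
  then have "1 \<le> ?h j" by simp
  also have "\<dots> = sum ?h {j}" by simp
  also have "\<dots> \<le> suminf ?h" by (rule sum_le_suminf) auto
  also have "\<dots> \<le> stop_weight f v x" unfolding stop_weight_def by simp
  finally show ?thesis .
qed

text \<open>Points that are always active use the off-cylinder estimate. At all others the weight is
  at least 1, and the uniform bound for the kernel operator suffices.\<close>

lemma kernel_op_level_le:
  assumes f: "step_mart m f" and x: "x \<in> G" and l: "0 < v" and n: "1 \<le> n"
  shows "ennreal (sqrt (norm (kernel_op n (\<lambda>t. stopped m f (4 * v) n t - stopped m f v n t) x) / n) / ln (real n + 1))
    \<le> ennreal (24 * real L ^ 2 * sqrt v) * stop_weight f v x"
proof (cases "\<forall>j. active m f v j x")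
  case True
  let ?h = "\<lambda>j. (\<Sum>z\<in>stop_points f v j. of_bool (\<forall>i<j. z i = x i) + atom_weight j x z)"
  have hn: "0 \<le> ?h j" for j by (intro sum_nonneg add_nonneg_nonneg atom_weight_nonneg) simp
  have "sqrt (norm (kernel_op n (\<lambda>t. stopped m f (4 * v) n t - stopped m f v n t) x) / n) / ln (real n + 1)
      \<le> 24 * L * sqrt v * (\<Sum>j<n. \<Sum>z\<in>stop_points f v j. atom_weight j x z)"
    by (rule kernel_op_atoms_sqrt[OF f x _ l n]) (use True in simp)
  also have "\<dots> \<le> 24 * real L ^ 2 * sqrt v * (\<Sum>j<n. ?h j)"
  proof -
    have "real (24 * L) \<le> 24 * (real L)\<^sup>2" using L_ge by (simp add: power2_eq_square)
    then show ?thesis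
      using l by (intro mult_mono sum_mono) (auto intro!: sum_nonneg atom_weight_nonneg)
  qed
  finally have "ennreal (sqrt (norm (kernel_op n (\<lambda>t. stopped m f (4 * v) n t - stopped m f v n t) x) / n) / ln (real n + 1))
      \<le> ennreal (24 * real L ^ 2 * sqrt v * (\<Sum>j<n. ?h j))" by (rule ennreal_leI)
  also have "\<dots> = ennreal (24 * real L ^ 2 * sqrt v) * (\<Sum>j<n. ennreal (?h j))"
    using l hn by (subst sum_ennreal) (auto simp: ennreal_mult sum_nonneg)
  also have "(\<Sum>j<n. ennreal (?h j)) \<le> stop_weight f v x"
  proof -
    have "(\<Sum>j<n. ennreal (?h j)) \<le> (\<Sum>j. ennreal (?h j))" by (rule sum_le_suminf) auto
    also have "\<dots> \<le> stop_weight f v x" unfolding stop_weight_def by simp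
    finally show ?thesis .
  qed
  finally show ?thesis by (simp add: mult_left_mono)
next
  case False
  then obtain j where "\<not> active m f v j x" by blast
  from one_le_stop_weight[OF x this] have 1: "1 \<le> stop_weight f v x" .
  have "norm (stopped m f (4 * v) n t - stopped m f v n t) \<le> 5 * v" if "t \<in> G" for t
    using norm_triangle_ineq4[of "stopped m f (4 * v) n t" "stopped m f v n t"]
      norm_stopped_le[of "4 * v" t m f n] norm_stopped_le[of v t m f n] that l by auto
  then have "sqrt (norm (kernel_op n (\<lambda>t. stopped m f (4 * v) n t - stopped m f v n t) x) / n) / ln (real n + 1)
      \<le> 24 * real L ^ 2 * sqrt v"
    using l by (intro kernel_op_bounded_sqrt x n) auto
  then have "ennreal (sqrt (norm (kernel_op n (\<lambda>t. stopped m f (4 * v) n t - stopped m f v n t) x) / n) / ln (real n + 1))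
      \<le> ennreal (24 * real L ^ 2 * sqrt v) * 1" by (simp add: ennreal_leI)
  also have "\<dots> \<le> ennreal (24 * real L ^ 2 * sqrt v) * stop_weight f v x" by (intro mult_left_mono 1) auto
  finally show ?thesis .
qed

lemma mart_bounded: "step_mart m f \<Longrightarrow> \<exists>B. \<forall>i\<le>n. \<forall>y\<in>G. norm (f i y) \<le> B"
proof -
  assume f: "step_mart m f"
  let ?S = "\<Union>i\<le>n. (\<lambda>z. norm (f i z)) ` Zset m i"
  have "finite ?S" by auto
  then have *: "s \<le> Max ?S" if "s \<in> ?S" for s using that by (rule Max_ge)
  have "norm (f i y) \<le> Max ?S" if "i \<le> n" "y \<in> G" for i y
  proof (rule *)
    have "f i y = f i (trunc i y)" using level_fun_trunc[OF step_martD(1)[OF f] that(2)] by simp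
    then show "norm (f i y) \<in> ?S" using that trunc_in_Z[OF that(2), of i] by auto
  qed
  then show ?thesis by blast
qed

lemma kernel_op_add: "kernel_op n (\<lambda>t. f t + g t) x = kernel_op n f x + kernel_op n g x"
  by (simp add: kernel_op_def distrib_right avg_add)

lemma kernel_op_sum: "kernel_op n (\<lambda>t. \<Sum>i\<in>I. g i t) x = (\<Sum>i\<in>I. kernel_op n (g i) x)"
  by (simp add: kernel_op_def sum_distrib_right avg_sum)

lemma kernel_op_cong: "(\<And>t. t \<in> G \<Longrightarrow> f t = g t) \<Longrightarrow> kernel_op n f x = kernel_op n g x"
  unfolding kernel_op_def by (intro avg_cong) (simp add: Z_in_G)

text \<open>The martingale stopped at the lowest level is bounded by \<open>\<epsilon>\<close>
  squared, which yields the first term; the rest is a telescoping sum over consecutive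
  levels.\<close>

lemma fejer_sqrt_le:
  assumes f: "step_mart m f" and x: "x \<in> G" and e: "0 < \<epsilon>" and n: "1 \<le> n"
  shows "ennreal (sqrt (norm (fejer m \<mu> n f x) / (ln (real n + 1))\<^sup>2))
    \<le> ennreal (24 * real L ^ 2 * \<epsilon>) + (\<Sum>i. ennreal (24 * real L ^ 2 * (\<epsilon> * 2 ^ i)) * stop_weight f ((\<epsilon> * 2 ^ i)\<^sup>2) x)"
proof -
  \<comment> \<open>levels whose square roots are dyadic, because the exponent is 1/2\<close>
  define lv where "lv i = (\<epsilon> * 2 ^ i)\<^sup>2" for i :: nat
  have lv_Suc: "lv (Suc i) = 4 * lv i" for i by (simp add: lv_def power2_eq_square)
  have lv_pos: "0 < lv i" for i using e by (simp add: lv_def)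
  have sqrt_lv: "sqrt (lv i) = \<epsilon> * 2 ^ i" for i using e by (simp add: lv_def)
  obtain B where B: "\<And>i y. i \<le> n \<Longrightarrow> y \<in> G \<Longrightarrow> norm (f i y) \<le> B" using mart_bounded[OF f, of n] by blast
  \<comment> \<open>The top level exceeds all values of \<open>f\<close> up to level
    \<open>n\<close>, so nothing is stopped there; \<open>K\<close> depends on
    \<open>n\<close>.\<close>
  obtain K where K: "B / \<epsilon>\<^sup>2 < 4 ^ K" using real_arch_pow[of 4] by auto
  have "lv K = \<epsilon>\<^sup>2 * 4 ^ K" by (simp add: lv_def power_mult_distrib power_mult[symmetric] mult.commute[of K]) (simp add: power_mult)
  then have K: "B \<le> lv K" using K e by (simp add: field_simps)
  have actK: "active m f (lv K) n t" for t
    unfolding active_def using B K by (meson order_trans)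
  define b where "b i t = stopped m f (4 * lv i) n t - stopped m f (lv i) n t" for i t
  have dec: "f n t = stopped m f (lv 0) n t + (\<Sum>i<K. b i t)" for t
  proof -
    have "(\<Sum>i<K. b i t) = stopped m f (lv K) n t - stopped m f (lv 0) n t"
      unfolding b_def lv_Suc[symmetric] by (rule sum_lessThan_telescope)
    then show ?thesis using stopped_active[OF actK] by simp
  qed
  let ?r = "\<lambda>g. sqrt (norm (kernel_op n g x) / n) / ln (real n + 1)"
  have ln0: "0 < ln (real n + 1)" using ln_ge_half[OF n] by linarith
  have "fejer m \<mu> n f x = kernel_op n (f n) x / of_nat n"
    using fejer_eq[OF f le_M] by (simp add: kernel_op_def)
  then have "sqrt (norm (fejer m \<mu> n f x) / (ln (real n + 1))\<^sup>2) = ?r (f n)"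
    by (simp only: norm_divide norm_of_nat real_sqrt_divide[of _ "_\<^sup>2"] real_sqrt_abs abs_of_pos[OF ln0])
  also have "kernel_op n (f n) x = kernel_op n (stopped m f (lv 0) n) x + (\<Sum>i<K. kernel_op n (b i) x)"
    by (simp only: kernel_op_cong[OF dec] kernel_op_add kernel_op_sum)
  also have "sqrt (norm (kernel_op n (stopped m f (lv 0) n) x + (\<Sum>i<K. kernel_op n (b i) x)) / n) / ln (real n + 1)
      \<le> ?r (stopped m f (lv 0) n) + (\<Sum>i<K. ?r (b i))"
  proof -
    have "norm (kernel_op n (stopped m f (lv 0) n) x + (\<Sum>i<K. kernel_op n (b i) x)) / n
        \<le> (norm (kernel_op n (stopped m f (lv 0) n) x) + (\<Sum>i<K. norm (kernel_op n (b i) x))) / n"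
      by (intro divide_right_mono norm_triangle_le add_left_mono norm_sum) auto
    also have "\<dots> = norm (kernel_op n (stopped m f (lv 0) n) x) / n + (\<Sum>i<K. norm (kernel_op n (b i) x) / n)"
      by (simp add: add_divide_distrib sum_divide_distrib)
    finally have "sqrt (norm (kernel_op n (stopped m f (lv 0) n) x + (\<Sum>i<K. kernel_op n (b i) x)) / n)
        \<le> sqrt (norm (kernel_op n (stopped m f (lv 0) n) x) / n + (\<Sum>i<K. norm (kernel_op n (b i) x) / n))"
      by (rule real_sqrt_le_mono)
    also have "\<dots> \<le> sqrt (norm (kernel_op n (stopped m f (lv 0) n) x) / n) + sqrt (\<Sum>i<K. norm (kernel_op n (b i) x) / n)"
      by (rule sqrt_add_le_add_sqrt) (auto intro: sum_nonneg)
    also have "sqrt (\<Sum>i<K. norm (kernel_op n (b i) x) / n) \<le> (\<Sum>i<K. sqrt (norm (kernel_op n (b i) x) / n))"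
      by (rule sqrt_sum_le) auto
    finally show ?thesis
      using ln0 by (simp add: sum_divide_distrib[symmetric] add_divide_distrib[symmetric] divide_right_mono)
  qed
  finally have "sqrt (norm (fejer m \<mu> n f x) / (ln (real n + 1))\<^sup>2) \<le> ?r (stopped m f (lv 0) n) + (\<Sum>i<K. ?r (b i))" .
  then have "ennreal (sqrt (norm (fejer m \<mu> n f x) / (ln (real n + 1))\<^sup>2)) \<le> ennreal (?r (stopped m f (lv 0) n) + (\<Sum>i<K. ?r (b i)))"
    by (rule ennreal_leI)
  also have "\<dots> = ennreal (?r (stopped m f (lv 0) n)) + (\<Sum>i<K. ennreal (?r (b i)))"
    using ln0 by (subst sum_ennreal) (auto intro!: ennreal_plus sum_nonneg)
  also have "\<dots> \<le> ennreal (24 * real L ^ 2 * \<epsilon>) + (\<Sum>i<K. ennreal (24 * real L ^ 2 * (\<epsilon> * 2 ^ i)) * stop_weight f (lv i) x)"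
  proof (intro add_mono sum_mono ennreal_leI)
    have "norm (stopped m f (lv 0) n t) \<le> 5 * lv 0" if "t \<in> G" for t
      using norm_stopped_le[of "lv 0" t m f n] lv_pos[of 0] that by simp
    then have "?r (stopped m f (lv 0) n) \<le> 24 * real L ^ 2 * sqrt (lv 0)"
      using lv_pos[of 0] by (intro kernel_op_bounded_sqrt x n) auto
    then show "?r (stopped m f (lv 0) n) \<le> 24 * real L ^ 2 * \<epsilon>" by (simp add: sqrt_lv)
    show "ennreal (?r (b i)) \<le> ennreal (24 * real L ^ 2 * (\<epsilon> * 2 ^ i)) * stop_weight f (lv i) x" for i
      using kernel_op_level_le[OF f x lv_pos n, of i] unfolding b_def sqrt_lv .
  qed
  \<comment> \<open>The full series depends neither on \<open>K\<close> nor on \<open>n\<close>, so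
    the supremum over \<open>n\<close> can be taken afterwards.\<close>
  also have "(\<Sum>i<K. ennreal (24 * real L ^ 2 * (\<epsilon> * 2 ^ i)) * stop_weight f (lv i) x)
      \<le> (\<Sum>i. ennreal (24 * real L ^ 2 * (\<epsilon> * 2 ^ i)) * stop_weight f (lv i) x)"
    by (rule sum_le_suminf) auto
  finally show ?thesis unfolding lv_def by (simp add: add_left_mono)
qed

end

section \<open>The maximal inequality\<close>

context vilenkin
begin

lemma level_fun_agree_off: "A \<le> j \<Longrightarrow> level_fun m j (\<lambda>x. agree_off k A x z)"
  unfolding level_fun_def agree_off_def by (intro ballI impI) (metis order_less_le_trans)

lemma agree_off_commute: "agree_off k A x z \<longleftrightarrow> agree_off k A z x"
  by (auto simp: agree_off_def)

lemma level_fun_atom_weight: "level_fun m j (\<lambda>x. atom_weight j x z)"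
  unfolding atom_weight_def
  by (intro level_fun_sum level_fun_comp[where F = "\<lambda>a. _ * of_bool a"] level_fun_agree_off) auto

text \<open>The sum over \<open>k\<close> is at most \<open>4 * sqrt (M A)\<close>, and this cancels
  \<open>M A\<close> in the denominator. There remain \<open>j + 1\<close> equal terms, balanced by
  the divisor \<open>j + 1\<close>.\<close>

lemma avg_atom_weight_le:
  assumes "z \<in> G"
  shows "avg m j (\<lambda>x. atom_weight j x z) \<le> 4 * L / M j"
proof -
  have M0: "0 < real (M A)" for A using M_pos by simp
  have "avg m j (\<lambda>x. atom_weight j x z)
      = (\<Sum>A\<le>j. \<Sum>k\<le>A. sqrt (M k) * sqrt (M A) / ((real j + 1) * M j) * avg m j (\<lambda>x. of_bool (agree_off k A z x)))"
    unfolding atom_weight_def agree_off_commute[of _ _ _ z] avg_sum avg_cmult ..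
  also have "\<dots> \<le> (\<Sum>A\<le>j. \<Sum>k\<le>A. sqrt (M k) * sqrt (M A) / ((real j + 1) * M j) * (L / M A))"
    by (intro sum_mono mult_left_mono avg_agree_off_le assms) auto
  also have "\<dots> = (\<Sum>A\<le>j. (\<Sum>k\<le>A. sqrt (M k)) * (sqrt (M A) * L / ((real j + 1) * M j * M A)))"
    unfolding sum_distrib_right by (intro sum.cong refl) simp
  also have "\<dots> \<le> (\<Sum>A\<le>j. 4 * sqrt (M A) * (sqrt (M A) * L / ((real j + 1) * M j * M A)))"
    by (intro sum_mono mult_right_mono sum_sqrt_M) auto
  also have "\<dots> = (\<Sum>A\<le>j. 4 * L / ((real j + 1) * M j))"
  proof (intro sum.cong refl)
    fix A
    have "4 * sqrt (M A) * (sqrt (M A) * L / ((real j + 1) * M j * M A))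
        = 4 * (sqrt (M A) * sqrt (M A)) * L / ((real j + 1) * M j * M A)" by (simp only: mult.assoc times_divide_eq_right)
    also have "sqrt (M A) * sqrt (M A) = real (M A)" by simp
    finally show "4 * sqrt (M A) * (sqrt (M A) * L / ((real j + 1) * M j * M A)) = 4 * L / ((real j + 1) * M j)"
      using M0[of A] by simp
  qed
  also have "\<dots> = (real j + 1) * (4 * L / ((real j + 1) * M j))" by (simp only: sum_constant card_atMost of_nat_Suc add.commute)
  also have "\<dots> = 4 * L / M j"
    unfolding times_divide_eq_right by (rule mult_divide_mult_cancel_left) linarith
  finally show ?thesis .
qed

lemma level_fun_stops_at: "level_fun m j (\<lambda>x. stops_at m f v j x)"
  unfolding level_fun_def by (intro ballI impI stops_at_cong) simp

lemma level_fun_exceeds: "step_mart m f \<Longrightarrow> level_fun m n (\<lambda>x. v < norm (f n x))"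
  by (intro level_fun_comp[where F = "\<lambda>a. v < norm a"] step_martD)

lemma sets_exceeds: "step_mart m f \<Longrightarrow> {x \<in> G. \<exists>n. v < norm (f n x)} \<in> sets \<mu>"
proof -
  assume "step_mart m f"
  then have "(\<Union>n. {x \<in> G. v < norm (f n x)}) \<in> sets \<mu>"
    using sets_level_fun[OF level_fun_exceeds] by auto
  also have "(\<Union>n. {x \<in> G. v < norm (f n x)}) = {x \<in> G. \<exists>n. v < norm (f n x)}" by auto
  finally show ?thesis .
qed

text \<open>A cylinder that stops at level \<open>j\<close> has a child on which the level is exceeded, and the child carries
  at least the fraction \<open>1 / L\<close> of its measure.\<close>

lemma card_stop_points_le:
  assumes f: "step_mart m f"
  shows "ennreal (card (stop_points f v j) / M j)
    \<le> ennreal L * emeasure \<mu> {x \<in> G. stops_at m f v j x \<and> v < norm (f (Suc j) x)}"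
proof -
  let ?P = "\<lambda>x. stops_at m f v j x \<and> v < norm (f (Suc j) x)"
  have level_fun: "level_fun m (Suc j) ?P"
    by (intro level_fun_comp2[where F = "(\<and>)"] level_fun_mono[OF level_fun_stops_at] level_fun_exceeds f) simp
  have "real (card (stop_points f v j)) = (\<Sum>z\<in>stop_points f v j. 1)" by simp
  also have "\<dots> \<le> (\<Sum>z\<in>stop_points f v j. \<Sum>c<m j. of_bool (?P (z(j := c))))"
  proof (intro sum_mono)
    fix z assume "z \<in> stop_points f v j"
    then have z: "z \<in> G" "stops_at m f v j z" by (auto simp: stop_points_def Z_in_G)
    then have "active m f v j z" "\<not> active m f v (Suc j) z" by (auto simp: stops_at_def)
    then obtain y where y: "y \<in> G" "\<forall>l<j. y l = z l" "v < norm (f (Suc j) y)"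
      unfolding active_def by (auto simp: le_Suc_eq not_le)
    have "f (Suc j) (z(j := y j)) = f (Suc j) y"
      by (rule locD[OF step_martD(1)[OF f]]) (use y z in \<open>auto intro!: fun_upd_in_G G_lt simp: less_Suc_eq\<close>)
    moreover have "stops_at m f v j (z(j := y j))"
      using z(2) stops_at_cong[of j z "z(j := y j)"] by auto
    ultimately have P: "?P (z(j := y j))" using y by simp
    have "(1::real) = (\<Sum>c\<in>{y j}. of_bool (?P (z(j := c))))" using P by simp
    also have "\<dots> \<le> (\<Sum>c<m j. of_bool (?P (z(j := c))))"
      by (intro sum_mono2) (use y(1) in \<open>auto intro: G_lt\<close>)
    finally show "(1::real) \<le> (\<Sum>c<m j. of_bool (?P (z(j := c))))" .
  qed
  also have "\<dots> \<le> (\<Sum>z\<in>Zset m j. \<Sum>c<m j. of_bool (?P (z(j := c))))"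
    by (intro sum_mono2) (auto simp: stop_points_def intro: sum_nonneg)
  also have "\<dots> = M (Suc j) * avg m (Suc j) (\<lambda>x. of_bool (?P x))"
    using M_pos[of "Suc j"] by (simp only: avg_def sum_Z_Suc) simp
  also have "\<dots> \<le> (L * M j) * avg m (Suc j) (\<lambda>x. of_bool (?P x))"
    by (intro mult_right_mono of_nat_mono M_Suc_le avg_nonneg) auto
  finally have "card (stop_points f v j) / M j \<le> L * avg m (Suc j) (\<lambda>x. of_bool (?P x))"
    using M_pos[of j] by (simp add: divide_le_eq mult_ac)
  then have "ennreal (card (stop_points f v j) / M j) \<le> ennreal (L * avg m (Suc j) (\<lambda>x. of_bool (?P x)))"
    by (rule ennreal_leI)
  also have "\<dots> = ennreal L * ennreal (avg m (Suc j) (\<lambda>x. of_bool (?P x)))"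
    by (intro ennreal_mult avg_nonneg) auto
  also have "\<dots> = ennreal L * emeasure \<mu> {x \<in> G. ?P x}"
    unfolding emeasure_level_fun[OF level_fun] ..
  finally show ?thesis .
qed

lemma measurable_stop_weight: "stop_weight f v \<in> borel_measurable \<mu>"
proof -
  have "(\<lambda>x. ennreal (\<Sum>z\<in>stop_points f v j. of_bool (\<forall>i<j. z i = x i) + atom_weight j x z)) \<in> borel_measurable \<mu>" for j
    by (intro measurable_compose[OF borel_measurable_level_fun[of j] measurable_ennreal] level_fun_sum
        level_fun_comp2[where F = "\<lambda>a b. of_bool a + b"] level_fun_agree order_refl level_fun_atom_weight)
  then show ?thesis unfolding stop_weight_def[abs_def] by measurable
qed

text \<open>Each stopping cylinder of level \<open>j\<close> costs at most
  \<open>(1 + 4 * L) / M j\<close>, and \<open>card_stop_points_le\<close> bounds their number by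
  the measure of an exceedance set. These sets are disjoint for different \<open>j\<close>, as a
  point stops at most once.\<close>

lemma nn_integral_stop_weight_le:
  assumes f: "step_mart m f"
  shows "(\<integral>\<^sup>+ x. stop_weight f v x \<partial>\<mu>) \<le> ennreal (1 + (1 + 4 * real L) * L) * emeasure \<mu> {x \<in> G. \<exists>n. v < norm (f n x)}"
proof -
  let ?Y = "{x \<in> G. \<exists>n. v < norm (f n x)}"
  let ?h = "\<lambda>j x. (\<Sum>z\<in>stop_points f v j. of_bool (\<forall>i<j. z i = x i) + atom_weight j x z)"
  have level_fun: "level_fun m j (?h j)" for j
    by (intro level_fun_sum level_fun_comp2[where F = "\<lambda>a b. of_bool a + b"] level_fun_agree order_refl level_fun_atom_weight)
  have meas: "(\<lambda>x. ennreal (?h j x)) \<in> borel_measurable \<mu>" for j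
    by (rule measurable_compose[OF borel_measurable_level_fun[OF level_fun] measurable_ennreal])
  have h: "(\<integral>\<^sup>+ x. ennreal (?h j x) \<partial>\<mu>) \<le> ennreal (1 + 4 * real L) * ennreal (card (stop_points f v j) / M j)" for j
  proof -
    have "(\<integral>\<^sup>+ x. ennreal (?h j x) \<partial>\<mu>) = ennreal (avg m j (?h j))"
      by (rule nn_integral_level_fun[OF level_fun]) (auto intro!: sum_nonneg add_nonneg_nonneg atom_weight_nonneg)
    also have "\<dots> \<le> ennreal ((1 + 4 * real L) * (card (stop_points f v j) / M j))"
    proof (rule ennreal_leI)
      have "avg m j (?h j) = (\<Sum>z\<in>stop_points f v j. avg m j (\<lambda>x. of_bool (\<forall>i<j. z i = x i)) + avg m j (\<lambda>x. atom_weight j x z))"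
        by (simp only: avg_sum avg_add)
      also have "\<dots> \<le> (\<Sum>z\<in>stop_points f v j. 1 / M j + 4 * L / M j)"
        by (intro sum_mono add_mono avg_atom_weight_le) (auto simp: avg_agree_lessThan stop_points_def Z_in_G)
      also have "\<dots> = (1 + 4 * real L) * (card (stop_points f v j) / M j)"
        by (simp add: add_divide_distrib[symmetric])
      finally show "avg m j (?h j) \<le> (1 + 4 * real L) * (card (stop_points f v j) / M j)" .
    qed
    also have "\<dots> = ennreal (1 + 4 * real L) * ennreal (card (stop_points f v j) / M j)"
      by (intro ennreal_mult) auto
    finally show ?thesis .
  qed
  \<comment> \<open>\<open>f 0\<close> is constant, so a failure at level 0 means that the bound is
    exceeded on the whole group.\<close>
  have base: "of_bool (\<not> active m f v 0 (\<lambda>_. 0)) \<le> emeasure \<mu> ?Y"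
  proof (cases "active m f v 0 (\<lambda>_. 0)")
    case False
    then obtain y where y: "y \<in> G" "v < norm (f 0 y)" by (auto simp: active_def not_le)
    have "v < norm (f 0 x)" if "x \<in> G" for x
    proof -
      have "f 0 x = f 0 y" by (rule locD[OF step_martD(1)[OF f] that y(1)]) simp
      then show ?thesis using y(2) by simp
    qed
    then have "?Y = G" by blast
    then show ?thesis using emeasure_space_1 by (simp add: space_mu)
  qed simp
  let ?E = "\<lambda>j. {x \<in> G. stops_at m f v j x \<and> v < norm (f (Suc j) x)}"
  have E_sets: "?E j \<in> sets \<mu>" for j
    by (intro sets_level_fun[of "Suc j"] level_fun_comp2[where F = "(\<and>)"] level_fun_mono[OF level_fun_stops_at] level_fun_exceeds f) simp
  have "(\<Sum>j. emeasure \<mu> (?E j)) = emeasure \<mu> (\<Union>j. ?E j)"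
    using E_sets by (intro suminf_emeasure) (auto simp: disjoint_family_on_def dest: stops_at_unique)
  also have "\<dots> \<le> emeasure \<mu> ?Y"
    by (intro emeasure_mono sets_exceeds f) auto
  finally have E: "(\<Sum>j. emeasure \<mu> (?E j)) \<le> emeasure \<mu> ?Y" .
  have "(\<Sum>j. ennreal (card (stop_points f v j) / M j)) \<le> (\<Sum>j. ennreal L * emeasure \<mu> (?E j))"
    by (rule suminf_le[OF card_stop_points_le[OF f]]) auto
  also have "\<dots> = ennreal L * (\<Sum>j. emeasure \<mu> (?E j))" by (rule ennreal_suminf_cmult)
  also have "\<dots> \<le> ennreal L * emeasure \<mu> ?Y" by (rule mult_left_mono[OF E]) simp
  finally have cards: "(\<Sum>j. ennreal (card (stop_points f v j) / M j)) \<le> ennreal L * emeasure \<mu> ?Y" .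
  have "(\<integral>\<^sup>+ x. stop_weight f v x \<partial>\<mu>)
      = of_bool (\<not> active m f v 0 (\<lambda>_. 0)) + (\<Sum>j. \<integral>\<^sup>+ x. ennreal (?h j x) \<partial>\<mu>)"
  proof -
    have "(\<integral>\<^sup>+ x. stop_weight f v x \<partial>\<mu>)
        = (\<integral>\<^sup>+ x. of_bool (\<not> active m f v 0 (\<lambda>_. 0)) \<partial>\<mu>) + (\<integral>\<^sup>+ x. (\<Sum>j. ennreal (?h j x)) \<partial>\<mu>)"
      unfolding stop_weight_def by (rule nn_integral_add) (intro borel_measurable_const borel_measurable_suminf_order meas)+
    also have "(\<integral>\<^sup>+ x. (\<Sum>j. ennreal (?h j x)) \<partial>\<mu>) = (\<Sum>j. \<integral>\<^sup>+ x. ennreal (?h j x) \<partial>\<mu>)"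
      by (rule nn_integral_suminf[OF meas])
    finally show ?thesis by (simp only: nn_integral_const emeasure_space_1 mult_1_right)
  qed
  also have "\<dots> \<le> emeasure \<mu> ?Y + (\<Sum>j. ennreal (1 + 4 * real L) * ennreal (card (stop_points f v j) / M j))"
    by (rule add_mono[OF base suminf_le[OF h]]) auto
  also have "\<dots> = emeasure \<mu> ?Y + ennreal (1 + 4 * real L) * (\<Sum>j. ennreal (card (stop_points f v j) / M j))"
    by (simp only: ennreal_suminf_cmult)
  also have "\<dots> \<le> emeasure \<mu> ?Y + ennreal (1 + 4 * real L) * (ennreal L * emeasure \<mu> ?Y)"
    by (rule add_left_mono[OF mult_left_mono[OF cards]]) simp
  also have "\<dots> = (ennreal 1 + ennreal (1 + 4 * real L) * ennreal L) * emeasure \<mu> ?Y"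
    by (simp add: distrib_right mult.assoc)
  also have "ennreal 1 + ennreal (1 + 4 * real L) * ennreal L = ennreal (1 + (1 + 4 * real L) * L)"
  proof -
    have "ennreal (1 + 4 * real L) * ennreal L = ennreal ((1 + 4 * real L) * L)"
      by (intro ennreal_mult[symmetric]) auto
    then show ?thesis by (simp only:) (rule ennreal_plus[symmetric]; simp)
  qed
  finally show ?thesis .
qed

text \<open>A dyadic layer cake formula for the root of the maximal function: at each point the
  levels below the root sum to at most twice it.\<close>

lemma sum_levels_le:
  assumes f: "step_mart m f" and e: "0 < \<epsilon>"
  shows "(\<Sum>i. ennreal (\<epsilon> * 2 ^ i) * emeasure \<mu> {x \<in> G. \<exists>n. (\<epsilon> * 2 ^ i)\<^sup>2 < norm (f n x)})
    \<le> 2 * (\<integral>\<^sup>+ x. epow (mart_max f x) (1/2) \<partial>\<mu>)"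
proof -
  let ?Y = "\<lambda>i. {x \<in> G. \<exists>n. (\<epsilon> * 2 ^ i)\<^sup>2 < norm (f n x)}"
  have [measurable]: "?Y i \<in> sets \<mu>" for i by (rule sets_exceeds[OF f])
  have "(\<Sum>i. ennreal (\<epsilon> * 2 ^ i) * emeasure \<mu> (?Y i)) = (\<Sum>i. \<integral>\<^sup>+ x. ennreal (\<epsilon> * 2 ^ i) * indicator (?Y i) x \<partial>\<mu>)"
    by (simp add: nn_integral_cmult_indicator)
  also have "\<dots> = (\<integral>\<^sup>+ x. (\<Sum>i. ennreal (\<epsilon> * 2 ^ i) * indicator (?Y i) x) \<partial>\<mu>)"
    by (rule nn_integral_suminf[symmetric]) measurable
  also have "\<dots> \<le> (\<integral>\<^sup>+ x. 2 * epow (mart_max f x) (1/2) \<partial>\<mu>)"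
  proof (intro nn_integral_mono)
    fix x
    show "(\<Sum>i. ennreal (\<epsilon> * 2 ^ i) * indicator (?Y i) x) \<le> 2 * epow (mart_max f x) (1/2)"
    proof (cases "mart_max f x")
      case (real r)
      have r: "norm (f n x) \<le> r" for n
      proof -
        have "ennreal (norm (f n x)) \<le> mart_max f x" unfolding mart_max_def by (rule SUP_upper) simp
        then show ?thesis using real by simp
      qed
      have bound: "ennreal (\<epsilon> * 2 ^ i) * indicator (?Y i) x \<le> ennreal (\<epsilon> * 2 ^ i * of_bool (\<epsilon> * 2 ^ i < sqrt r))" for i
      proof (cases "x \<in> ?Y i")
        case True
        then obtain n where "(\<epsilon> * 2 ^ i)\<^sup>2 < norm (f n x)" by auto
        then have "(\<epsilon> * 2 ^ i)\<^sup>2 < r" using r[of n] by linarith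
        then have "\<epsilon> * 2 ^ i < sqrt r" by (rule real_less_rsqrt)
        then show ?thesis using True by simp
      qed simp
      have "(\<Sum>i. ennreal (\<epsilon> * 2 ^ i) * indicator (?Y i) x) \<le> ennreal (2 * sqrt r)"
        unfolding suminf_eq_SUP
      proof (rule SUP_least)
        fix n :: nat
        have "(\<Sum>i<n. ennreal (\<epsilon> * 2 ^ i) * indicator (?Y i) x)
            \<le> (\<Sum>i<n. ennreal (\<epsilon> * 2 ^ i * of_bool (\<epsilon> * 2 ^ i < sqrt r)))"
          by (intro sum_mono bound)
        also have "\<dots> = ennreal (\<Sum>i<n. \<epsilon> * 2 ^ i * of_bool (\<epsilon> * 2 ^ i < sqrt r))"
          using e by (intro sum_ennreal) auto
        also have "\<dots> \<le> ennreal (2 * sqrt r)"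
          by (intro ennreal_leI sum_dyadic_le e) (use real in simp)
        finally show "(\<Sum>i<n. ennreal (\<epsilon> * 2 ^ i) * indicator (?Y i) x) \<le> ennreal (2 * sqrt r)" .
      qed
      also have "\<dots> = 2 * epow (mart_max f x) (1/2)"
        unfolding real using real by (subst epow_half_ennreal) (auto simp: ennreal_mult)
      finally show ?thesis .
    qed (simp add: epow_def ennreal_mult_top)
  qed
  also have "\<dots> = 2 * (\<integral>\<^sup>+ x. epow (mart_max f x) (1/2) \<partial>\<mu>)"
  proof (rule nn_integral_cmult)
    have "(\<lambda>x. norm (f n x)) \<in> borel_measurable \<mu>" for n
      by (intro borel_measurable_level_fun[of n] level_fun_comp[where F = norm] step_martD f)
    then have [measurable]: "mart_max f \<in> borel_measurable \<mu>"
      unfolding mart_max_def[abs_def] by measurable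
    show "(\<lambda>x. epow (mart_max f x) (1/2)) \<in> borel_measurable \<mu>"
      unfolding epow_def by measurable
  qed
  finally show ?thesis .
qed

text \<open>On a probability space the lowest level contributes only
  \<open>24 * L ^ 2 * \<epsilon>\<close>, chosen equal to an arbitrary \<open>e\<close>. The other
  levels are summed by \<open>sum_levels_le\<close>, whose factor 2 makes 48.\<close>

lemma fejer_max_log_bound:
  assumes f: "step_mart m f"
  shows "(\<integral>\<^sup>+ x. epow (fejer_max_log m \<mu> f x) (1/2) \<partial>\<mu>)
    \<le> ennreal (48 * real L ^ 2 * (1 + (1 + 4 * real L) * L)) * (\<integral>\<^sup>+ x. epow (mart_max f x) (1/2) \<partial>\<mu>)"
proof (rule ennreal_le_epsilon)
  let ?C = "24 * real L ^ 2" and ?D = "1 + (1 + 4 * real L) * real L"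
  let ?X = "\<integral>\<^sup>+ x. epow (mart_max f x) (1/2) \<partial>\<mu>"
  have C0: "0 < ?C" using L_ge by simp
  fix e :: real assume e: "0 < e"
  define \<epsilon> where "\<epsilon> = e / ?C"
  have e0: "0 < \<epsilon>" using e C0 by (simp add: \<epsilon>_def)
  have Ce: "?C * \<epsilon> = e" using C0 by (simp add: \<epsilon>_def)
  let ?Y = "\<lambda>i. {x \<in> G. \<exists>n. (\<epsilon> * 2 ^ i)\<^sup>2 < norm (f n x)}"
  have "(\<integral>\<^sup>+ x. epow (fejer_max_log m \<mu> f x) (1/2) \<partial>\<mu>)
      \<le> (\<integral>\<^sup>+ x. ennreal (?C * \<epsilon>) + (\<Sum>i. ennreal (?C * (\<epsilon> * 2 ^ i)) * stop_weight f ((\<epsilon> * 2 ^ i)\<^sup>2) x) \<partial>\<mu>)"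
  proof (intro nn_integral_mono)
    fix x assume "x \<in> space \<mu>"
    then have x: "x \<in> G" by (simp add: space_mu)
    show "epow (fejer_max_log m \<mu> f x) (1/2)
        \<le> ennreal (?C * \<epsilon>) + (\<Sum>i. ennreal (?C * (\<epsilon> * 2 ^ i)) * stop_weight f ((\<epsilon> * 2 ^ i)\<^sup>2) x)"
      unfolding fejer_max_log_def by (intro epow_half_SUP_le fejer_sqrt_le f x e0) auto
  qed
  also have "\<dots> = ennreal (?C * \<epsilon>) + (\<Sum>i. ennreal (?C * (\<epsilon> * 2 ^ i)) * (\<integral>\<^sup>+ x. stop_weight f ((\<epsilon> * 2 ^ i)\<^sup>2) x \<partial>\<mu>))"
  proof -
    note measurable_stop_weight[measurable]
    show ?thesis using emeasure_space_1
      by (subst nn_integral_add) (auto simp: nn_integral_suminf nn_integral_cmult)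
  qed
  also have "\<dots> \<le> ennreal (?C * \<epsilon>) + (\<Sum>i. ennreal (?C * (\<epsilon> * 2 ^ i)) * (ennreal ?D * emeasure \<mu> (?Y i)))"
    by (intro add_left_mono suminf_le mult_left_mono nn_integral_stop_weight_le f) auto
  also have "(\<Sum>i. ennreal (?C * (\<epsilon> * 2 ^ i)) * (ennreal ?D * emeasure \<mu> (?Y i)))
      = (\<Sum>i. ennreal (?C * ?D) * (ennreal (\<epsilon> * 2 ^ i) * emeasure \<mu> (?Y i)))"
  proof (intro arg_cong[where f = suminf] ext)
    fix i
    have "ennreal (?C * (\<epsilon> * 2 ^ i)) * ennreal ?D = ennreal (?C * ?D) * ennreal (\<epsilon> * 2 ^ i)"
      using e0 by (subst (1 2) ennreal_mult[symmetric]) (auto simp: mult_ac)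
    then show "ennreal (?C * (\<epsilon> * 2 ^ i)) * (ennreal ?D * emeasure \<mu> (?Y i))
        = ennreal (?C * ?D) * (ennreal (\<epsilon> * 2 ^ i) * emeasure \<mu> (?Y i))"
      by (simp only: mult.assoc[symmetric])
  qed
  also have "\<dots> = ennreal (?C * ?D) * (\<Sum>i. ennreal (\<epsilon> * 2 ^ i) * emeasure \<mu> (?Y i))" by simp
  also have "\<dots> \<le> ennreal (?C * ?D) * (2 * ?X)"
    by (intro mult_left_mono sum_levels_le f e0) auto
  also have "\<dots> = ennreal (48 * real L ^ 2 * ?D) * ?X"
  proof -
    have "ennreal (?C * ?D) * 2 = ennreal (?C * ?D) * ennreal 2" by simp
    also have "\<dots> = ennreal (48 * real L ^ 2 * ?D)" by (subst ennreal_mult[symmetric]) auto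
    finally show ?thesis by (simp only: mult.assoc[symmetric])
  qed
  finally show "(\<integral>\<^sup>+ x. epow (fejer_max_log m \<mu> f x) (1/2) \<partial>\<mu>) \<le> ennreal (48 * real L ^ 2 * ?D) * ?X + ennreal e"
    unfolding Ce by (simp add: add.commute add_left_mono)
qed

lemma bounded_fejer_max_log: "bounded_Hp_Lp m \<mu> (1/2) (fejer_max_log m \<mu>)"
  unfolding bounded_Hp_Lp_def
proof (intro exI ballI)
  let ?C = "48 * real L ^ 2 * (1 + (1 + 4 * real L) * L)"
  fix f assume "f \<in> Hardy m \<mu> (1/2)"
  then have f: "step_mart m f" by (auto simp: Hardy_def intro: is_mart_step_mart)
  let ?A = "\<integral>\<^sup>+ x. epow (fejer_max_log m \<mu> f x) (1/2) \<partial>\<mu>"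
  let ?X = "\<integral>\<^sup>+ x. epow (mart_max f x) (1/2) \<partial>\<mu>"
  have "Lp_norm \<mu> (1/2) (fejer_max_log m \<mu> f) = ?A * ?A" by (simp add: Lp_norm_def epow_2)
  also have "\<dots> \<le> (ennreal ?C * ?X) * (ennreal ?C * ?X)"
    by (intro mult_mono fejer_max_log_bound f) auto
  also have "\<dots> = (ennreal ?C * ennreal ?C) * (?X * ?X)" by (simp only: mult_ac)
  also have "ennreal ?C * ennreal ?C = ennreal (?C * ?C)" by (intro ennreal_mult[symmetric]) auto
  also have "?X * ?X = Hp_norm \<mu> (1/2) f" by (simp add: Hp_norm_def Lp_norm_def epow_2)
  finally show "Lp_norm \<mu> (1/2) (fejer_max_log m \<mu> f) \<le> ennreal (?C * ?C) * Hp_norm \<mu> (1/2) f" .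
qed

end

section \<open>Fejer means of the test martingales\<close>

lemma qnum_Suc: "qnum m (Suc n) = Mseq m (2 * Suc n) + qnum m n"
  by (simp add: qnum_def)

declare Mseq.simps(2) [simp del]

context vilenkin_seq
begin

section \<open>Size of the indices \<open>qnum m k\<close>\<close>

lemma qnum_le: "qnum m k \<le> M (2 * k + 1)"
proof (induction k)
  case 0
  show ?case using M_pos[of 1] by (simp add: qnum_def)
next
  case (Suc k)
  have "qnum m (Suc k) = M (2 * Suc k) + qnum m k" by (rule qnum_Suc)
  also have "\<dots> \<le> M (2 * Suc k) + M (2 * Suc k)"
    by (intro add_left_mono order_trans[OF Suc M_mono]) simp
  also have "\<dots> \<le> M (Suc (2 * Suc k))" using M_double[of "2 * Suc k"] by linarith
  finally show ?case by (simp only: Suc_eq_plus1)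
qed

lemma qnum_le_double: "qnum m k \<le> 2 * M (2 * k)"
proof (cases k)
  case 0
  then show ?thesis by (simp add: qnum_def)
next
  case (Suc j)
  have "qnum m j \<le> M (2 * k)"
    by (rule order_trans[OF qnum_le M_mono]) (use Suc in simp)
  moreover have "qnum m k = M (2 * k) + qnum m j" unfolding Suc by (rule qnum_Suc)
  ultimately show ?thesis by linarith
qed

lemma qnum_pos: "0 < qnum m k"
proof (cases k)
  case (Suc j)
  then show ?thesis using qnum_Suc[of m j] M_pos[of "2 * Suc j"] by simp
qed (simp add: qnum_def)

lemma le_qnum: "k \<le> qnum m k"
proof (cases k)
  case (Suc j)
  then show ?thesis using qnum_Suc[of m j] Mseq_ge[of m "2 * Suc j", OF m_ge] by simp
qed simp

lemma M_le_pow: "M n \<le> L ^ n"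
proof (induction n)
  case (Suc n)
  then show ?case using mult_mono[OF m_le[of n] Suc] by (simp add: Mseq.simps)
qed simp

section \<open>Lower bounds for kernels of index \<open>qnum m k\<close>\<close>

lemma Dker_on_cylinder:
  assumes "\<forall>j<N. x j = 0" "n \<le> M N"
  shows "Dker m n x = of_nat n"
proof -
  have "vpsi m i x = 1" if "i < n" for i
    using that assms by (simp add: vpsi_eq_prod[of i N] rad_def)
  then show ?thesis by (simp add: Dker_def)
qed

lemma Fker_on_cylinder:
  assumes "\<forall>j<N. x j = 0" "n \<le> M N"
  shows "Fker m n x = of_real (real n * (real n + 1) / 2)"
proof -
  have "Fker m n x = (\<Sum>k=1..n. of_nat k)"
    unfolding Fker_def using assms(2) by (intro sum.cong refl Dker_on_cylinder[OF assms(1)]) auto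
  also have "\<dots> = of_real (real n * (real n + 1) / 2)"
    by (induction n) (auto simp: algebra_simps add_divide_distrib)
  finally show ?thesis .
qed

text \<open>\<open>x s \<noteq> 0\<close> makes \<open>Fker_M_Suc\<close> available from level
  \<open>Suc s\<close> on; there the nonzero next coordinate gives the factor 0, and zero
  persists.\<close>

lemma Fker_M_eq_0:
  assumes "x \<in> G" "x s \<noteq> 0" "x (Suc s) \<noteq> 0" "Suc (Suc s) \<le> N"
  shows "Fker m (M N) x = 0"
  using assms(4)
proof (induction N rule: dec_induct)
  case base
  have "\<not> (\<forall>j<Suc s. x j = 0)" using assms(2) by auto
  then show ?case using Fker_M_Suc[OF assms(1), of "Suc s"] assms(3) by simp
next
  case (step N)
  have "s < N" using step(1) by simp
  then have "\<not> (\<forall>j<N. x j = 0)" using assms(2) by (intro notI) simp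
  then show ?case using Fker_M_Suc[OF assms(1), of N] step.IH by simp
qed

text \<open>At \<open>k = s\<close> all kernels involved are explicit on the cylinder of level
  \<open>2 * s\<close>. Afterwards the leading block vanishes because of the nonzero coordinates, so
  each step only rotates the kernel.\<close>

lemma norm_Fker_qnum_ge:
  assumes x: "x \<in> G" "\<forall>j<2 * s. x j = 0" "x (2 * s) \<noteq> 0" "x (Suc (2 * s)) \<noteq> 0" and "s \<le> k"
  shows "(real (M (2 * s)))\<^sup>2 / 2 \<le> norm (Fker m (qnum m k) x)"
  using \<open>s \<le> k\<close>
proof (induction k rule: dec_induct)
  case base
  let ?M = "real (M (2 * s))"
  define q where "q = (\<Sum>j<s. M (2 * j))"
  have qn: "qnum m s = 1 * M (2 * s) + q"
    by (simp add: qnum_def q_def lessThan_Suc_atMost[symmetric])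
  have q: "q \<le> M (2 * s)"
  proof (cases s)
    case (Suc j)
    then have "q = qnum m j" by (simp add: q_def qnum_def lessThan_Suc_atMost)
    also have "\<dots> \<le> M (2 * s)" by (rule order_trans[OF qnum_le M_mono]) (use Suc in simp)
    finally show ?thesis .
  qed (simp add: q_def)
  have M1: "1 \<le> ?M" using M_pos[of "2 * s"] by (simp add: Suc_le_eq)
  have "Fker m (qnum m s) x = Fker m (1 * M (2 * s)) x + of_nat q * Dker m (1 * M (2 * s)) x
      + rad m (2 * s) x ^ 1 * Fker m q x"
    unfolding qn by (rule Fker_split[OF q]) (use m_ge[of "2 * s"] in linarith)
  also have "\<dots> = of_real (?M * (?M + 1) / 2 + real q * ?M) + rad m (2 * s) x * of_real (real q * (real q + 1) / 2)"
    unfolding mult_1 power_one_right Fker_on_cylinder[OF x(2) order_refl] Dker_on_cylinder[OF x(2) order_refl] Fker_on_cylinder[OF x(2) q]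
    by (simp only: of_real_add of_real_mult of_real_of_nat_eq)
  finally have eq: "Fker m (qnum m s) x
      = of_real (?M * (?M + 1) / 2 + real q * ?M) + rad m (2 * s) x * of_real (real q * (real q + 1) / 2)" .
  \<comment> \<open>The phase of \<open>rad\<close> is arbitrary, so the last term is treated as a
    loss; the mixed term \<open>q * M (2 * s)\<close> outweighs it.\<close>
  have "norm (complex_of_real (?M * (?M + 1) / 2 + real q * ?M)) - norm (rad m (2 * s) x * of_real (real q * (real q + 1) / 2))
      \<le> norm (Fker m (qnum m s) x)"
    unfolding eq by (rule norm_diff_ineq)
  moreover have "norm (rad m (2 * s) x * of_real (real q * (real q + 1) / 2)) = real q * (real q + 1) / 2"
    by (simp only: norm_mult norm_rad norm_of_real) simp
  moreover have "norm (complex_of_real (?M * (?M + 1) / 2 + real q * ?M)) = ?M * (?M + 1) / 2 + real q * ?M"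
    unfolding norm_of_real by (intro abs_of_nonneg) auto
  moreover have "real q * (real q + 1) / 2 \<le> real q * ?M"
  proof -
    have "real q * ((real q + 1) / 2) \<le> real q * ?M"
      by (intro mult_left_mono) (use q M1 in \<open>auto simp flip: of_nat_le_iff\<close>)
    then show ?thesis by simp
  qed
  moreover have "?M\<^sup>2 / 2 \<le> ?M * (?M + 1) / 2"
    unfolding power2_eq_square by (intro divide_right_mono mult_left_mono) auto
  ultimately show ?case by linarith
next
  case (step k)
  let ?N = "2 * Suc k"
  have q: "qnum m k \<le> M ?N" using qnum_le[of k] M_mono[of "2 * k + 1" ?N] by simp
  have D: "Dker m (1 * M ?N) x = 0"
    using Dker_M[OF x(1), of ?N] x(3) step(1) by (auto intro!: exI[of _ "2 * s"])
  have F: "Fker m (1 * M ?N) x = 0"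
    unfolding mult_1 by (rule Fker_M_eq_0[OF x(1,3,4)]) (use step(1) in simp)
  have "Fker m (qnum m (Suc k)) x = Fker m (1 * M ?N + qnum m k) x"
    unfolding qnum_Suc mult_1 ..
  also have "\<dots> = Fker m (1 * M ?N) x + of_nat (qnum m k) * Dker m (1 * M ?N) x + rad m ?N x ^ 1 * Fker m (qnum m k) x"
    by (rule Fker_split[OF q]) (use m_ge[of ?N] in linarith)
  also have "\<dots> = rad m ?N x * Fker m (qnum m k) x" unfolding D F by simp
  finally show ?case using step.IH by (simp add: norm_mult)
qed

end

section \<open>The test functions and their Fejer means\<close>

context vilenkin
begin

definition Ddiff :: "nat \<Rightarrow> (nat \<Rightarrow> nat) \<Rightarrow> complex" where
  "Ddiff N x = Dker m (M (Suc N)) x - Dker m (M N) x"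

lemma level_fun_Ddiff: "level_fun m (Suc N) (Ddiff N)"
  unfolding Ddiff_def[abs_def]
  by (intro level_fun_comp2[where F = "(-)"] level_fun_Dker M_mono order_refl) simp

lemma Ddiff_eq: "x \<in> G \<Longrightarrow> Ddiff N x = of_bool (\<forall>j<N. x j = 0) * (of_bool (x N = 0) * of_nat (M (Suc N)) - of_nat (M N))"
  unfolding Ddiff_def by (simp only: Dker_M) (auto simp: less_Suc_eq)

lemma Ddiff_upd: "x \<in> G \<Longrightarrow> c < m N \<Longrightarrow>
    Ddiff N (x(N := c)) = of_bool (\<forall>j<N. x j = 0) * (of_bool (c = 0) * of_nat (M (Suc N)) - of_nat (M N))"
  by (subst Ddiff_eq[OF fun_upd_in_G]) auto

lemma sum_of_bool_0: "(\<Sum>c<m N. of_bool (c = 0) * h c) = (h 0 :: complex)"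
proof -
  have "(\<Sum>c<m N. of_bool (c = 0) * h c) = (\<Sum>c\<in>{0}. of_bool (c = 0) * h c)"
    by (rule sum.mono_neutral_right) (use m_pos[of N] in auto)
  then show ?thesis by simp
qed

lemma sum_Ddiff: "x \<in> G \<Longrightarrow> (\<Sum>c<m N. Ddiff N (x(N := c))) = 0"
proof -
  assume x: "x \<in> G"
  have "(\<Sum>c<m N. Ddiff N (x(N := c)))
      = of_bool (\<forall>j<N. x j = 0) * ((\<Sum>c<m N. of_bool (c = 0) * of_nat (M (Suc N))) - (\<Sum>c<m N. of_nat (M N)))"
    unfolding sum_subtractf[symmetric] sum_distrib_left
    by (intro sum.cong refl) (simp only: Ddiff_upd[OF x] lessThan_iff)
  also have "\<dots> = 0" unfolding sum_of_bool_0 by (simp add: Mseq.simps)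
  finally show ?thesis .
qed

text \<open>The function averages to 0 over coordinate \<open>N\<close>, so the levels up to
  \<open>N\<close> vanish; from the next level on the kernel reproduces it.\<close>

lemma mart_of_Ddiff:
  assumes x: "x \<in> G"
  shows "mart_of m \<mu> (Ddiff N) k x = of_bool (N < k) * Ddiff N x"
proof (cases "N < k")
  case True
  then have "mart_of m \<mu> (Ddiff N) k x = avg m k (\<lambda>t. Ddiff N t * Dker m (M k) (Vsub m x t))"
    unfolding mart_of_def by (intro fsum_eq[OF level_fun_Ddiff]) auto
  also have "\<dots> = Ddiff N x"
    by (rule avg_Dker_M[OF level_fun_mono[OF level_fun_Ddiff] x]) (use True in simp)
  finally show ?thesis using True by simp
next
  case False
  then have k: "k \<le> N" by simp
  have "mart_of m \<mu> (Ddiff N) k x = avg m (Suc N) (\<lambda>t. Ddiff N t * Dker m (M k) (Vsub m x t))"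
    unfolding mart_of_def by (intro fsum_eq[OF level_fun_Ddiff] M_mono) (use k in auto)
  also have "\<dots> = avg m N (\<lambda>t. (\<Sum>c<m N. Ddiff N (t(N := c))) / of_nat (m N) * Dker m (M k) (Vsub m x t))"
    by (rule avg_Suc_mult) (intro level_fun_Vsub level_fun_Dker M_mono k)
  also have "\<dots> = avg m N (\<lambda>t. 0)"
    by (intro avg_cong) (simp add: sum_Ddiff Z_in_G)
  finally show ?thesis using False by (simp add: avg_const)
qed

lemma step_mart_Ddiff: "step_mart m (mart_of m \<mu> (Ddiff N))"
  unfolding step_mart_def
proof (intro conjI allI ballI)
  show "level_fun m k (mart_of m \<mu> (Ddiff N) k)" for k
    unfolding mart_of_def by (rule level_fun_fsum) simp
  fix k x assume x: "x \<in> G"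
  have "(\<Sum>c<m k. mart_of m \<mu> (Ddiff N) (Suc k) (x(k := c))) = of_bool (N < Suc k) * (\<Sum>c<m k. Ddiff N (x(k := c)))"
    unfolding sum_distrib_left by (intro sum.cong refl mart_of_Ddiff fun_upd_in_G x) simp
  also have "\<dots> = of_nat (m k) * mart_of m \<mu> (Ddiff N) k x"
  proof (cases "N < k")
    case True
    have "Ddiff N (x(k := c)) = Ddiff N x" if "c < m k" for c
      by (rule locD[OF level_fun_Ddiff fun_upd_in_G[OF x that] x]) (use True in auto)
    then show ?thesis using True by (simp add: mart_of_Ddiff[OF x])
  next
    case False
    then show ?thesis using sum_Ddiff[OF x, of N] by (cases "k = N") (auto simp: mart_of_Ddiff[OF x])
  qed
  finally show "mart_of m \<mu> (Ddiff N) k x = (\<Sum>c<m k. mart_of m \<mu> (Ddiff N) (Suc k) (x(k := c))) / of_nat (m k)"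
    using m_pos[of k] by simp
qed

text \<open>These are the powers of a primitive root of unity, the value of \<open>rad m N\<close>
  where the coordinate \<open>N\<close> is 1.\<close>

lemma sum_rad_upd: "(\<Sum>c<m N. rad m N (x(N := c))) = 0"
proof -
  let ?u = "(\<lambda>_. 0)(N := 1)"
  have u: "?u \<in> G" using zero_in_G m_ge[of N] by (intro fun_upd_in_G) auto
  have "rad m N (x(N := c)) = rad m N ?u ^ c" for c
    by (simp add: rad_eq_cis Complex.DeMoivre mult_ac)
  then show ?thesis using sum_rad[OF u, of N] by simp
qed

lemma Vsub_0: "x \<in> G \<Longrightarrow> Vsub m x (\<lambda>_. 0) = x"
  using G_lt by (auto simp: Vsub_def)

text \<open>\<open>Fker_split\<close> writes the kernel as a part of level \<open>N\<close> plus
  \<open>rad m N\<close> times \<open>Fker m q\<close>. Averaging over coordinate \<open>N\<close>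
  removes the first part, and the second leaves \<open>rad m N x * Fker m q x\<close>.\<close>

lemma norm_fejer_Ddiff:
  assumes x: "x \<in> G" and q: "q \<le> M N"
  shows "norm (fejer m \<mu> (M N + q) (mart_of m \<mu> (Ddiff N)) x) = norm (Fker m q x) / (M N + q)"
proof -
  let ?A = "\<lambda>y. Fker m (M N) y + of_nat q * Dker m (M N) y"
  let ?g = "\<lambda>t. Ddiff N t * rad m N (Vsub m x t)"
  have locA: "level_fun m N (\<lambda>t. ?A (Vsub m x t))"
    by (intro level_fun_Vsub[where g = ?A] level_fun_comp2[where F = "\<lambda>a b. a + of_nat q * b"] level_fun_Fker level_fun_Dker order_refl)
  have locF: "level_fun m N (\<lambda>t. Fker m q (Vsub m x t))"
    by (intro level_fun_Vsub level_fun_Fker q)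
  have split: "Fker m (M N + q) y = ?A y + rad m N y * Fker m q y" for y
    using Fker_split[OF q, of 1 y] m_ge[of N] by simp
  have "M N + q \<le> M (Suc N)" using q M_double[of N] by linarith
  then have "fejer m \<mu> (M N + q) (mart_of m \<mu> (Ddiff N)) x
      = avg m (Suc N) (\<lambda>t. mart_of m \<mu> (Ddiff N) (Suc N) t * Fker m (M N + q) (Vsub m x t)) / of_nat (M N + q)"
    by (rule fejer_eq[OF step_mart_Ddiff])
  also have "avg m (Suc N) (\<lambda>t. mart_of m \<mu> (Ddiff N) (Suc N) t * Fker m (M N + q) (Vsub m x t))
      = avg m (Suc N) (\<lambda>t. Ddiff N t * ?A (Vsub m x t) + ?g t * Fker m q (Vsub m x t))"
    by (rule avg_cong) (simp only: mart_of_Ddiff Z_in_G split, simp add: algebra_simps)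
  also have "\<dots> = avg m (Suc N) (\<lambda>t. Ddiff N t * ?A (Vsub m x t)) + avg m (Suc N) (\<lambda>t. ?g t * Fker m q (Vsub m x t))"
    by (rule avg_add)
  also have "avg m (Suc N) (\<lambda>t. Ddiff N t * ?A (Vsub m x t))
      = avg m N (\<lambda>t. (\<Sum>c<m N. Ddiff N (t(N := c))) / of_nat (m N) * ?A (Vsub m x t))"
    by (rule avg_Suc_mult[OF locA])
  also have "\<dots> = avg m N (\<lambda>t. 0)"
    by (intro avg_cong) (simp add: sum_Ddiff Z_in_G)
  also have "avg m (Suc N) (\<lambda>t. ?g t * Fker m q (Vsub m x t))
      = avg m N (\<lambda>t. (\<Sum>c<m N. ?g (t(N := c))) / of_nat (m N) * Fker m q (Vsub m x t))"
    by (rule avg_Suc_mult[OF locF])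
  also have "\<dots> = avg m N (\<lambda>t. if t = (\<lambda>_. 0) then of_nat (M N) * rad m N x * Fker m q x else 0)"
  proof (rule avg_cong)
    fix t assume t: "t \<in> Zset m N"
    then have tG: "t \<in> G" by (rule Z_in_G)
    have t0: "(\<forall>j<N. t j = 0) \<longleftrightarrow> t = (\<lambda>_. 0)"
      using t by (auto simp: Zset_def fun_eq_iff not_less[symmetric])
    have rad_t: "rad m N (Vsub m x (t(N := c))) = rad m N x * cnj (rad m N (t(N := c)))" if "c < m N" for c
      by (rule rad_Vsub[OF fun_upd_in_G[OF tG that]])
    have "(\<Sum>c<m N. ?g (t(N := c)))
        = (\<Sum>c<m N. of_bool (t = (\<lambda>_. 0)) * rad m N x *
            (of_bool (c = 0) * (of_nat (M (Suc N)) * cnj (rad m N (t(N := c)))) - of_nat (M N) * cnj (rad m N (t(N := c)))))"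
      by (intro sum.cong refl) (simp only: Ddiff_upd[OF tG] rad_t lessThan_iff t0, simp add: algebra_simps)
    also have "\<dots> = of_bool (t = (\<lambda>_. 0)) * rad m N x *
        ((\<Sum>c<m N. of_bool (c = 0) * (of_nat (M (Suc N)) * cnj (rad m N (t(N := c))))) - of_nat (M N) * cnj (\<Sum>c<m N. rad m N (t(N := c))))"
      by (simp only: sum_distrib_left[symmetric] sum_subtractf cnj_sum)
    \<comment> \<open>The roots of unity sum to 0, which removes the part with \<open>M N\<close>;
      only \<open>c = 0\<close> survives, where \<open>rad\<close> is 1.\<close>
    also have "\<dots> = of_bool (t = (\<lambda>_. 0)) * rad m N x * of_nat (M (Suc N))"
      unfolding sum_rad_upd sum_of_bool_0 by (simp add: rad_def)
    finally have "(\<Sum>c<m N. ?g (t(N := c))) / of_nat (m N) = of_bool (t = (\<lambda>_. 0)) * rad m N x * of_nat (M N)"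
      using m_pos[of N] by (simp add: Mseq.simps)
    then show "(\<Sum>c<m N. ?g (t(N := c))) / of_nat (m N) * Fker m q (Vsub m x t)
        = (if t = (\<lambda>_. 0) then of_nat (M N) * rad m N x * Fker m q x else 0)"
      by (auto simp: Vsub_0[OF x])
  qed
  also have "\<dots> = rad m N x * Fker m q x"
  proof -
    have "(\<lambda>_. 0) \<in> Zset m N" using zero_in_G by (simp add: Zset_def)
    then show ?thesis using M_pos[of N] by (simp add: avg_def)
  qed
  finally have "fejer m \<mu> (M N + q) (mart_of m \<mu> (Ddiff N)) x = rad m N x * Fker m q x / of_nat (M N + q)"
    by (simp add: avg_const)
  then show ?thesis by (simp add: norm_mult norm_divide del: of_nat_add)
qed

end

section \<open>Sharpness of the weight\<close>

lemma ennreal_inverse_antimono: "a \<le> b \<Longrightarrow> inverse b \<le> (inverse a :: ennreal)"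
  including ennreal.lifting by transfer (rule ereal_inverse_antimono)

context vilenkin
begin

text \<open>The set where the first two nonzero coordinates are \<open>2 * s\<close> and \<open>2 * s + 1\<close>: there all
  the Fejer kernels of index \<open>qnum m k\<close> with \<open>k \<ge> s\<close> have the same modulus.\<close>

definition spike :: "nat \<Rightarrow> (nat \<Rightarrow> nat) set" where
  "spike s = {x \<in> G. \<forall>i<Suc (Suc (2 * s)). x i = 0 \<longleftrightarrow> i < 2 * s}"

lemma level_fun_spike: "level_fun m (Suc (Suc (2 * s))) (\<lambda>x. \<forall>i<Suc (Suc (2 * s)). x i = 0 \<longleftrightarrow> i < 2 * s)"
  unfolding level_fun_def by (intro ballI impI) simp

text \<open>By independence each of the \<open>2 * s\<close> zeros has probability
  \<open>1 / m i\<close>, and each of the two nonzero coordinates has probability at least 1/2;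
  hence the 4.\<close>

lemma emeasure_spike: "ennreal (1 / (4 * M (2 * s))) \<le> emeasure \<mu> (spike s)"
proof -
  let ?n = "Suc (Suc (2 * s))"
  let ?w = "\<lambda>i c. of_bool (c = 0 \<longleftrightarrow> i < 2 * s) :: real"
  have "avg m ?n (\<lambda>x. of_bool (\<forall>i<?n. x i = 0 \<longleftrightarrow> i < 2 * s)) = avg m ?n (\<lambda>x. \<Prod>i<?n. ?w i (x i))"
  proof (rule avg_cong)
    fix x :: "nat \<Rightarrow> nat"
    show "(of_bool (\<forall>i<?n. x i = 0 \<longleftrightarrow> i < 2 * s) :: real) = (\<Prod>i<?n. ?w i (x i))"
    proof (cases "\<forall>i<?n. x i = 0 \<longleftrightarrow> i < 2 * s")
      case True
      then have "(\<Prod>i<?n. ?w i (x i)) = (\<Prod>i<?n. 1)" by (intro prod.cong refl) simp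
      then show ?thesis using True by simp
    next
      case False
      then obtain i where "i < ?n" "\<not> (x i = 0 \<longleftrightarrow> i < 2 * s)" by blast
      then have "(\<Prod>i<?n. ?w i (x i)) = 0" by (intro prod_zero bexI[of _ i]) simp_all
      then show ?thesis using False by (simp only: of_bool_eq)
    qed
  qed
  also have "\<dots> = (\<Prod>i<?n. (\<Sum>c<m i. ?w i c) / of_nat (m i))" by (rule avg_prod)
  also have "\<dots> \<ge> (\<Prod>i<?n. if i < 2 * s then 1 / real (m i) else 1 / 2)"
  proof (rule prod_mono, intro conjI)
    fix i assume "i \<in> {..<?n}"
    have 1: "(\<Sum>c<m i. of_bool (c = 0)) = (1::real)"
      using m_pos[of i] by (subst sum.remove[of _ 0]) auto
    have "(\<Sum>c<m i. of_bool (c = 0) + of_bool (c \<noteq> 0)) = (\<Sum>c<m i. (1::real))"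
      by (intro sum.cong) auto
    then have 2: "(\<Sum>c<m i. of_bool (c \<noteq> 0)) = real (m i) - 1"
      unfolding sum.distrib 1 by simp
    show "(if i < 2 * s then 1 / real (m i) else 1 / 2) \<le> (\<Sum>c<m i. ?w i c) / of_nat (m i)"
    proof (cases "i < 2 * s")
      case True
      then show ?thesis using 1 by simp
    next
      case False
      then have "(\<Sum>c<m i. ?w i c) = real (m i) - 1" using 2 by simp
      moreover have "2 \<le> real (m i)" using m_ge[of i] by simp
      ultimately show ?thesis using False by (simp add: field_simps)
    qed
  qed auto
  also have "(\<Prod>i<?n. if i < 2 * s then 1 / real (m i) else 1 / 2) = (\<Prod>i<2 * s. 1 / real (m i)) * (1 / 4)"
    by simp
  also have "(\<Prod>i<2 * s. 1 / real (m i)) = 1 / M (2 * s)"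
    by (simp add: M_prod prod_dividef)
  finally have "1 / (4 * M (2 * s)) \<le> avg m ?n (\<lambda>x. of_bool (\<forall>i<?n. x i = 0 \<longleftrightarrow> i < 2 * s))"
    by simp
  then show ?thesis
    unfolding spike_def emeasure_level_fun[OF level_fun_spike] by (rule ennreal_leI)
qed

lemma spike_unique: "x \<in> spike s \<Longrightarrow> x \<in> spike t \<Longrightarrow> s = t"
proof (induction s t rule: linorder_wlog)
  case (le s t)
  show ?case
  proof (rule ccontr)
    assume "s \<noteq> t"
    then have "s < t" using le by simp
    then have "2 * s < 2 * t" by simp
    then have "x (2 * s) = 0" using le(3) by (auto simp: spike_def)
    then show False using le(2) by (auto simp: spike_def)
  qed
qed auto

lemma norm_Fker_qnum_spike:
  assumes "x \<in> spike s" "s \<le> k"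
  shows "(real (M (2 * s)))\<^sup>2 / 2 \<le> norm (Fker m (qnum m k) x)"
  using assms by (intro norm_Fker_qnum_ge) (auto simp: spike_def)

lemma Lp_fejer_Ddiff_ge:
  fixes \<phi> :: real
  assumes "0 < \<phi>" "1 \<le> n"
  shows "ennreal ((real n)\<^sup>2 / (32 * (qnum m n * \<phi>)))
    \<le> Lp_norm \<mu> (1/2) (\<lambda>x. ennreal (norm (fejer m \<mu> (qnum m n) (mart_of m \<mu> (Ddiff (2 * n))) x / of_real \<phi>)))"
proof -
  obtain k where k: "n = Suc k" using assms(2) by (cases n) auto
  define q where "q = qnum m n"
  have q: "q = M (2 * n) + qnum m k" unfolding q_def k by (rule qnum_Suc)
  have q0: "0 < real q * \<phi>" using qnum_pos[of n] assms by (simp add: q_def)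
  have qk: "qnum m k \<le> M (2 * n)"
    by (rule order_trans[OF qnum_le M_mono]) (simp add: k)
  let ?g = "\<lambda>x. ennreal (norm (fejer m \<mu> q (mart_of m \<mu> (Ddiff (2 * n))) x / of_real \<phi>))"
  \<comment> \<open>The root of the lower bound on the spike. Its product with the measure bound
    \<open>1 / (4 * M (2 * s))\<close> is independent of \<open>s\<close>, so all \<open>n\<close>
    spikes contribute equally.\<close>
  define c where "c s = M (2 * s) / sqrt (2 * (real q * \<phi>))" for s
  have c0: "0 \<le> c s" for s using q0 by (simp add: c_def)
  have spike_sets: "spike s \<in> sets \<mu>" for s
    unfolding spike_def by (rule sets_level_fun[OF level_fun_spike])
  have pt: "(\<Sum>s<n. ennreal (c s) * indicator (spike s) x) \<le> epow (?g x) (1/2)" for x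
  proof (cases "\<exists>s<n. x \<in> spike s")
    case True
    then obtain s where s: "s < n" "x \<in> spike s" by blast
    then have x: "x \<in> G" by (simp add: spike_def)
    have "(\<Sum>s<n. ennreal (c s) * indicator (spike s) x) = (\<Sum>i<n. if i = s then ennreal (c s) else 0)"
      by (intro sum.cong refl) (use s spike_unique in \<open>auto simp: indicator_def\<close>)
    also have "\<dots> = ennreal (c s)" using s by simp
    also have "\<dots> \<le> ennreal (sqrt (norm (fejer m \<mu> q (mart_of m \<mu> (Ddiff (2 * n))) x / of_real \<phi>)))"
    proof (rule ennreal_leI)
      have "norm (fejer m \<mu> q (mart_of m \<mu> (Ddiff (2 * n))) x / of_real \<phi>) = norm (Fker m (qnum m k) x) / (real q * \<phi>)"
        using norm_fejer_Ddiff[OF x qk] assms(1) by (simp add: q norm_divide)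
      moreover have "(real (M (2 * s)))\<^sup>2 / 2 / (real q * \<phi>) \<le> norm (Fker m (qnum m k) x) / (real q * \<phi>)"
        using s q0 k by (intro divide_right_mono norm_Fker_qnum_spike) auto
      moreover have "(c s)\<^sup>2 = (real (M (2 * s)))\<^sup>2 / 2 / (real q * \<phi>)"
        using q0 unfolding c_def power_divide by (subst real_sqrt_pow2) auto
      ultimately show "c s \<le> sqrt (norm (fejer m \<mu> q (mart_of m \<mu> (Ddiff (2 * n))) x / of_real \<phi>))"
        by (intro real_le_rsqrt) simp
    qed
    also have "\<dots> = epow (?g x) (1/2)" by (rule epow_half_ennreal[symmetric]) simp
    finally show ?thesis .
  next
    case False
    then have "(\<Sum>s<n. ennreal (c s) * indicator (spike s) x) = 0" by (intro sum.neutral) auto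
    then show ?thesis by simp
  qed
  have "ennreal (n / (4 * sqrt (2 * (real q * \<phi>)))) = ennreal (\<Sum>s<n. c s * (1 / (4 * M (2 * s))))"
  proof -
    have "c s * (1 / (4 * M (2 * s))) = 1 / (4 * sqrt (2 * (real q * \<phi>)))" for s
      using M_pos[of "2 * s"] by (simp add: c_def)
    then show ?thesis by simp
  qed
  also have "\<dots> = (\<Sum>s<n. ennreal (c s) * ennreal (1 / (4 * M (2 * s))))"
    using c0 by (simp add: ennreal_mult[symmetric] sum_ennreal del: times_divide_eq_right)
  also have "\<dots> \<le> (\<Sum>s<n. ennreal (c s) * emeasure \<mu> (spike s))"
    by (intro sum_mono mult_left_mono emeasure_spike) auto
  also have "\<dots> = (\<integral>\<^sup>+ x. (\<Sum>s<n. ennreal (c s) * indicator (spike s) x) \<partial>\<mu>)"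
    using spike_sets by (subst nn_integral_sum) (auto simp: nn_integral_cmult_indicator)
  also have "\<dots> \<le> (\<integral>\<^sup>+ x. epow (?g x) (1/2) \<partial>\<mu>)"
    by (intro nn_integral_mono pt)
  finally have I: "ennreal (n / (4 * sqrt (2 * (real q * \<phi>)))) \<le> (\<integral>\<^sup>+ x. epow (?g x) (1/2) \<partial>\<mu>)" .
  have "ennreal ((real n)\<^sup>2 / (32 * (q * \<phi>))) = ennreal (n / (4 * sqrt (2 * (real q * \<phi>)))) * ennreal (n / (4 * sqrt (2 * (real q * \<phi>))))"
    using q0 by (subst ennreal_mult[symmetric]) (auto simp: power2_eq_square)
  also have "\<dots> \<le> (\<integral>\<^sup>+ x. epow (?g x) (1/2) \<partial>\<mu>) * (\<integral>\<^sup>+ x. epow (?g x) (1/2) \<partial>\<mu>)"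
    by (intro mult_mono I) auto
  also have "\<dots> = Lp_norm \<mu> (1/2) ?g" by (simp add: Lp_norm_def epow_2)
  finally show ?thesis unfolding q_def .
qed

text \<open>The maximal function is at most \<open>M (Suc N)\<close> and lives on a set of measure
  \<open>1 / M N\<close>; for exponent 1/2 this gives
  \<open>M (Suc N) / (M N * M N)\<close>.\<close>

lemma Hp_norm_Ddiff_le: "Hp_norm \<mu> (1/2) (mart_of m \<mu> (Ddiff N)) \<le> ennreal (L / M N)"
proof -
  let ?h = "mart_of m \<mu> (Ddiff N)"
  let ?P = "\<lambda>x. \<forall>i<N. (\<lambda>_. 0) i = x i"
  have pt: "epow (mart_max ?h x) (1/2) \<le> ennreal (sqrt (M (Suc N)) * of_bool (?P x))" if x: "x \<in> G" for x
  proof -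
    have "mart_max ?h x \<le> ennreal (M (Suc N) * of_bool (?P x))"
      unfolding mart_max_def
    proof (intro SUP_least ennreal_leI)
      fix n
      have le: "real (M N) \<le> real (M (Suc N))" using M_mono[of N "Suc N"] by simp
      have "norm (of_nat (M (Suc N)) - of_nat (M N) :: complex) = norm (of_nat (M (Suc N) - M N) :: complex)"
        by (subst of_nat_diff) (auto intro: M_mono)
      also have "\<dots> = real (M (Suc N) - M N)" by (rule norm_of_nat)
      finally have "norm (of_bool (x N = 0) * of_nat (M (Suc N)) - of_nat (M N) :: complex) \<le> real (M (Suc N))"
        using le by (cases "x N = 0") auto
      then have "norm (Ddiff N x) \<le> M (Suc N) * of_bool (?P x)"
        unfolding Ddiff_eq[OF x] by (cases "?P x") (auto simp: norm_mult)
      moreover have "norm (?h n x) \<le> norm (Ddiff N x)"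
        unfolding mart_of_Ddiff[OF x] by (simp add: norm_mult)
      ultimately show "norm (?h n x) \<le> M (Suc N) * of_bool (?P x)" by linarith
    qed
    then have "epow (mart_max ?h x) (1/2) \<le> epow (ennreal (M (Suc N) * of_bool (?P x))) (1/2)"
      by (intro epow_mono) auto
    also have "\<dots> = ennreal (sqrt (M (Suc N)) * of_bool (?P x))"
      by (subst epow_half_ennreal) auto
    finally show ?thesis .
  qed
  have level_fun: "level_fun m N (\<lambda>x. sqrt (M (Suc N)) * of_bool (?P x))"
    by (intro level_fun_comp[where F = "\<lambda>a. _ * of_bool a"] level_fun_agree order_refl)
  have "(\<integral>\<^sup>+ x. epow (mart_max ?h x) (1/2) \<partial>\<mu>) \<le> (\<integral>\<^sup>+ x. ennreal (sqrt (M (Suc N)) * of_bool (?P x)) \<partial>\<mu>)"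
    by (intro nn_integral_mono pt) (simp add: space_mu)
  also have "\<dots> = ennreal (avg m N (\<lambda>x. sqrt (M (Suc N)) * of_bool (?P x)))"
    by (rule nn_integral_level_fun[OF level_fun]) simp
  also have "avg m N (\<lambda>x. sqrt (M (Suc N)) * of_bool (?P x)) = sqrt (M (Suc N)) * (1 / M N)"
    unfolding avg_cmult avg_agree_lessThan[OF zero_in_G order_refl] ..
  finally have I: "(\<integral>\<^sup>+ x. epow (mart_max ?h x) (1/2) \<partial>\<mu>) \<le> ennreal (sqrt (M (Suc N)) * (1 / M N))" .
  have "Hp_norm \<mu> (1/2) ?h = (\<integral>\<^sup>+ x. epow (mart_max ?h x) (1/2) \<partial>\<mu>) * (\<integral>\<^sup>+ x. epow (mart_max ?h x) (1/2) \<partial>\<mu>)"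
    by (simp add: Hp_norm_def Lp_norm_def epow_2)
  also have "\<dots> \<le> ennreal (sqrt (M (Suc N)) * (1 / M N)) * ennreal (sqrt (M (Suc N)) * (1 / M N))"
    by (intro mult_mono I) auto
  also have "\<dots> = ennreal (M (Suc N) / (M N * M N))"
    by (subst ennreal_mult[symmetric]) auto
  also have "\<dots> \<le> ennreal (L / M N)"
  proof (rule ennreal_leI)
    have "real (M (Suc N)) / (M N * M N) \<le> real (L * M N) / (M N * M N)"
      by (intro divide_right_mono of_nat_mono M_Suc_le) simp
    then show "M (Suc N) / (M N * M N) \<le> L / M N" using M_pos[of N] by simp
  qed
  finally show ?thesis .
qed

text \<open>\<open>qnum m n\<close> and \<open>M (2 * n)\<close> cancel up to a factor 2, so 64 = 32
  * 2.\<close>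

lemma ratio_ge:
  fixes \<phi> :: real
  assumes "0 < \<phi>" "1 \<le> n"
  shows "ennreal ((real n)\<^sup>2 / (64 * L * \<phi>))
    \<le> Lp_norm \<mu> (1/2) (\<lambda>x. ennreal (norm (fejer m \<mu> (qnum m n) (mart_of m \<mu> (Ddiff (2 * n))) x / of_real \<phi>)))
      / Hp_norm \<mu> (1/2) (mart_of m \<mu> (Ddiff (2 * n)))" (is "_ \<le> ?A / ?B")
proof -
  let ?M = "real (M (2 * n))" and ?q = "real (qnum m n)"
  have M0: "0 < ?M" using M_pos by simp
  have L0: "0 < real L" using L_ge by simp
  have q0: "0 < ?q" using qnum_pos by simp
  have "(real n)\<^sup>2 / (64 * L * \<phi>) \<le> (real n)\<^sup>2 / (32 * (?q * \<phi>)) / (L / ?M)"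
  proof -
    have q: "?q \<le> 2 * ?M" using qnum_le_double[of n] by (simp flip: of_nat_le_iff)
    have "(real n)\<^sup>2 / (64 * L * \<phi>) = (real n)\<^sup>2 * ?M / (32 * L * \<phi> * (2 * ?M))" using M0 by simp
    also have "\<dots> \<le> (real n)\<^sup>2 * ?M / (32 * L * \<phi> * ?q)"
      using q q0 L0 M0 assms by (intro divide_left_mono mult_left_mono mult_pos_pos) auto
    also have "\<dots> = (real n)\<^sup>2 / (32 * (?q * \<phi>)) / (L / ?M)" by (simp add: mult_ac)
    finally show ?thesis .
  qed
  then have "ennreal ((real n)\<^sup>2 / (64 * L * \<phi>)) \<le> ennreal ((real n)\<^sup>2 / (32 * (?q * \<phi>)) / (L / ?M))"
    by (rule ennreal_leI)
  also have "\<dots> = ennreal ((real n)\<^sup>2 / (32 * (?q * \<phi>))) / ennreal (L / ?M)"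
    using assms L0 M0 q0 by (intro divide_ennreal[symmetric]) auto
  also have "\<dots> \<le> ?A / ennreal (L / ?M)"
    by (intro divide_right_mono_ennreal Lp_fejer_Ddiff_ge assms)
  also have "\<dots> \<le> ?A / ?B"
    unfolding divide_ennreal_def by (intro mult_left_mono ennreal_inverse_antimono Hp_norm_Ddiff_le) simp
  finally show ?thesis .
qed

text \<open>The limsup yields a large \<open>N\<close> that need not be of the form
  \<open>qnum m k\<close>. Moving down to \<open>qnum m k \<le> N < qnum m (k + 1)\<close> does not
  increase \<open>\<Phi>\<close>, and the logarithm of \<open>N + 1\<close> is still at most
  \<open>5 * k * L\<close>.\<close>

lemma exists_large_index:
  fixes \<Phi> :: "nat \<Rightarrow> real"
  assumes "mono \<Phi>" "\<And>n. 0 < \<Phi> n" "limsup (\<lambda>n. ereal ((ln (real n + 1))\<^sup>2 / \<Phi> n)) = \<infinity>"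
  shows "\<exists>n\<ge>1. R \<le> (real n)\<^sup>2 / (64 * L * \<Phi> (qnum m n))"
proof -
  let ?r = "\<lambda>n. (ln (real n + 1))\<^sup>2 / \<Phi> n"
  have L0: "0 < real L" using L_ge by simp
  \<comment> \<open>Collects the losses: \<open>64 * L\<close> from the ratio, the square of
    \<open>5 * L\<close> from the logarithm.\<close>
  define R' where "R' = R * (64 * L) * (5 * L)\<^sup>2"
  have "\<exists>N\<ge>qnum m 1. R' < ?r N"
  proof (rule ccontr)
    assume "\<not> ?thesis"
    then have "eventually (\<lambda>N. ereal (?r N) \<le> ereal R') sequentially"
      unfolding eventually_sequentially by (intro exI[of _ "qnum m 1"]) (auto simp: not_less)
    then have "limsup (\<lambda>n. ereal (?r n)) \<le> ereal R'" by (rule Limsup_bounded)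
    then show False using assms(3) by simp
  qed
  then obtain N where N: "qnum m 1 \<le> N" "R' < ?r N" by blast
  have "N < qnum m (N + 1)" using le_qnum[of "N + 1"] by simp
  moreover have "\<not> N < qnum m 0"
    using N(1) qnum_Suc[of m 0] by simp
  ultimately obtain k where k: "\<forall>i\<le>k. \<not> N < qnum m i" "N < qnum m (k + 1)"
    using ex_least_nat_less[of "\<lambda>k. N < qnum m k" "N + 1"] by auto
  have k1: "1 \<le> k"
  proof (rule ccontr)
    assume "\<not> 1 \<le> k"
    then show False using k(2) N(1) by (simp add: not_le)
  qed
  have "N + 1 \<le> qnum m (k + 1)" using k(2) by simp
  also have "\<dots> \<le> M (2 * (k + 1) + 1)" by (rule qnum_le)
  also have "\<dots> \<le> L ^ (2 * (k + 1) + 1)" by (rule M_le_pow)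
  \<comment> \<open>The inequality 2 \<open>k\<close> + 3 \<le> 5 \<open>k\<close> requires
    \<open>k \<ge> 1\<close>; this is why \<open>N\<close> was taken at least
    \<open>qnum m 1\<close>.\<close>
  also have "\<dots> \<le> L ^ (5 * k)" using k1 L_ge by (intro power_increasing) auto
  finally have "real (N + 1) \<le> real (L ^ (5 * k))" by (rule of_nat_mono)
  then have "ln (real N + 1) \<le> ln (real L ^ (5 * k))"
    using L0 by (subst ln_le_cancel_iff) (auto simp: add.commute)
  also have "\<dots> = real (5 * k) * ln L" using L0 by (simp add: ln_realpow)
  also have "\<dots> \<le> real (5 * k) * L"
    using ln_le_minus_one[OF L0] by (intro mult_left_mono) auto
  finally have "(ln (real N + 1))\<^sup>2 \<le> (real (5 * k) * L)\<^sup>2"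
    by (intro power_mono) auto
  then have ln: "(ln (real N + 1))\<^sup>2 \<le> (real k)\<^sup>2 * (5 * L)\<^sup>2"
    by (simp add: power_mult_distrib mult_ac)
  have "qnum m k \<le> N" using k(1) by (simp add: not_less)
  then have mono: "\<Phi> (qnum m k) \<le> \<Phi> N" using assms(1) by (rule monoD[rotated])
  have "R * (64 * L) * (5 * L)\<^sup>2 \<le> (ln (real N + 1))\<^sup>2 / \<Phi> N" using N(2) by (simp add: R'_def)
  also have "\<dots> \<le> (ln (real N + 1))\<^sup>2 / \<Phi> (qnum m k)"
    using mono assms(2) by (intro divide_left_mono mult_pos_pos) auto
  also have "\<dots> \<le> (real k)\<^sup>2 * (5 * L)\<^sup>2 / \<Phi> (qnum m k)"
    using ln assms(2)[of "qnum m k"] by (intro divide_right_mono) auto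
  finally have "(R * (64 * L)) * (5 * L)\<^sup>2 \<le> ((real k)\<^sup>2 / \<Phi> (qnum m k)) * (5 * L)\<^sup>2"
    by simp
  then have "R * (64 * L) \<le> (real k)\<^sup>2 / \<Phi> (qnum m k)"
    by (rule mult_right_le_imp_le) (use L0 in simp)
  then have "R \<le> (real k)\<^sup>2 / \<Phi> (qnum m k) / (64 * L)"
    using L0 by (subst pos_le_divide_eq) auto
  also have "\<dots> = (real k)\<^sup>2 / (64 * L * \<Phi> (qnum m k))" by (simp add: mult_ac)
  finally show ?thesis using k1 by blast
qed

lemma sharpness:
  fixes \<Phi> :: "nat \<Rightarrow> real"
  assumes \<Phi>: "mono \<Phi>" "\<And>n. 0 < \<Phi> n" "limsup (\<lambda>n. ereal ((ln (real n + 1))\<^sup>2 / \<Phi> n)) = \<infinity>"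
  shows "\<exists>nk::nat \<Rightarrow> nat. (\<forall>k. 0 < nk k) \<and>
    (SUP k. Lp_norm \<mu> (1/2)
        (\<lambda>x. ennreal (norm (fejer m \<mu> (qnum m (nk k)) (mart_of m \<mu> (Ddiff (2 * nk k))) x / of_real (\<Phi> (qnum m (nk k))))))
      / Hp_norm \<mu> (1/2) (mart_of m \<mu> (Ddiff (2 * nk k)))) = \<infinity>"
proof -
  \<comment> \<open>The index found for the bound \<open>k\<close> makes the ratio number
    \<open>k\<close> at least \<open>k\<close>.\<close>
  have "\<forall>k. \<exists>n\<ge>1. real k \<le> (real n)\<^sup>2 / (64 * L * \<Phi> (qnum m n))"
    using exists_large_index[OF \<Phi>] by blast
  then obtain nk where nk: "\<And>k. 1 \<le> nk k" "\<And>k. real k \<le> (real (nk k))\<^sup>2 / (64 * L * \<Phi> (qnum m (nk k)))"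
    by metis
  let ?F = "\<lambda>k. Lp_norm \<mu> (1/2)
        (\<lambda>x. ennreal (norm (fejer m \<mu> (qnum m (nk k)) (mart_of m \<mu> (Ddiff (2 * nk k))) x / of_real (\<Phi> (qnum m (nk k))))))
      / Hp_norm \<mu> (1/2) (mart_of m \<mu> (Ddiff (2 * nk k)))"
  have "of_nat k \<le> ?F k" for k
  proof -
    have "of_nat k = ennreal (real k)" by (simp add: ennreal_of_nat_eq_real_of_nat)
    also have "\<dots> \<le> ennreal ((real (nk k))\<^sup>2 / (64 * L * \<Phi> (qnum m (nk k))))" by (rule ennreal_leI[OF nk(2)])
    also have "\<dots> \<le> ?F k" by (rule ratio_ge[OF \<Phi>(2) nk(1)])
    finally show ?thesis .
  qed
  then have "(SUP k. of_nat k :: ennreal) \<le> (SUP k. ?F k)" by (intro SUP_mono) blast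
  then have "(SUP k. ?F k) = \<infinity>" by (simp add: ennreal_SUP_of_nat_eq_top top_unique)
  moreover have "\<forall>k. 0 < nk k" using nk(1) by (simp add: Suc_le_eq)
  ultimately show ?thesis by blast
qed

end

theorem theorem3p8:
  fixes m :: "nat \<Rightarrow> nat" and \<mu> :: "(nat \<Rightarrow> nat) measure"
  assumes "\<And>k. 2 \<le> m k" and "bdd_above (range m)" and "Vhaar m \<mu>"
  shows "bounded_Hp_Lp m \<mu> (1/2) (fejer_max_log m \<mu>) \<and>
    (\<forall>\<Phi>::nat \<Rightarrow> real.
      mono \<Phi> \<and> (\<forall>n. 0 < \<Phi> n) \<and>
      limsup (\<lambda>n. ereal ((ln (real n + 1))\<^sup>2 / \<Phi> n)) = \<infinity> \<longrightarrow>
      (\<exists>nk::nat \<Rightarrow> nat. (\<forall>k. 0 < nk k) \<and>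
        (let f = (\<lambda>k. mart_of m \<mu> (\<lambda>x. Dker m (Mseq m (2 * nk k + 1)) x - Dker m (Mseq m (2 * nk k)) x))
         in (SUP k. Lp_norm \<mu> (1/2)
                (\<lambda>x. ennreal (norm (fejer m \<mu> (qnum m (nk k)) (f k) x / of_real (\<Phi> (qnum m (nk k))))))
              / Hp_norm \<mu> (1/2) (f k)) = \<infinity>)))"
proof -
  obtain L where L: "\<And>k. m k \<le> L" using assms(2) by (auto simp: bdd_above_def)
  interpret vilenkin m L \<mu> by unfold_locales (use assms L in auto)
  have Ddiff: "(\<lambda>x. Dker m (Mseq m (2 * n + 1)) x - Dker m (Mseq m (2 * n)) x) = Ddiff (2 * n)" for n
    by (simp add: Ddiff_def fun_eq_iff)
  show ?thesis
    unfolding Let_def Ddiff using bounded_fejer_max_log sharpness by blast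
qed

end
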